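(* Let $0<\alpha<n$ and let $b$ be a locally integrable function on $\mathbb{R}^n$. Then the following statements are equivalent: (1) $b\in BMO(\mathbb{R}^n)$ and $b^-\in L^\infty(\mathbb{R}^n)$. (2) $[b,M_{\alpha}]$ is bounded from $L^{p(\cdot)}(\mathbb{R}^n)$ to $L^{q(\cdot)}(\mathbb{R}^n)$ for some pair $(p(\cdot),q(\cdot))\in\mathscr{B}^{\alpha}(\mathbb{R}^n)$. (3) $[b,M_{\alpha}]$ is bounded from $L^{p(\cdot)}(\mathbb{R}^n)$ to $L^{q(\cdot)}(\mathbb{R}^n)$ for all pairs $(p(\cdot),q(\cdot))\in\mathscr{B}^{\alpha}(\mathbb{R}^n)$. (4) There exists $s(\cdot)\in\mathscr{B}(\mathbb{R}^n)$ such that $$\sup_{Q}\frac{\big\|\big(b-|Q|^{-\alpha/n}M_{\alpha,Q}(b)\big)\chi_Q\big\|_{L^{s(\cdot)}(\mathbb{R}^n)}}{\|\chi_Q\|_{L^{s(\cdot)}(\mathbb{R}^n)}}<\infty,$$ where the supremum is over all cubes $Q\subset\mathbb{R}^n$. (5) The condition in (4) holds for every $s(\cdot)\in\mathscr{B}(\mathbb{R}^n)$.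
   Context: Cubes $Q\subset\mathbb{R}^n$ have sides parallel to the coordinate axes; $|Q|$ is Lebesgue measure, $\chi_Q$ the characteristic function and $f_Q=|Q|^{-1}\int_Qf$. $BMO(\mathbb{R}^n)$ is the set of locally integrable $f$ with $\sup_Q|Q|^{-1}\int_Q|f-f_Q|<\infty$. For a function $b$, $b^-(x)=|b(x)|$ if $b(x)<0$ and $b^-(x)=0$ otherwise. For $0\le\gamma<n$ and locally integrable $f$, $M_\gamma(f)(x)=\sup_{Q\ni x}|Q|^{\gamma/n-1}\int_Q|f(y)|\,dy$; $M=M_0$. For a fixed cube $Q_0$, $M_{\gamma,Q_0}(f)(x)=\sup\{|Q|^{\gamma/n-1}\int_Q|f(y)|\,dy : x\in Q\subseteq Q_0\}$ for $x\in Q_0$. The nonlinear commutator is $[b,M_\alpha](f)(x)=b(x)M_\alpha(f)(x)-M_\alpha(bf)(x)$. For measurable $p(\cdot):\mathbb{R}^n\to[1,\infty)$, $L^{p(\cdot)}(\mathbb{R}^n)$ is the space of measurable $f$ with $\int(|f(x)|/\lambda)^{p(x)}dx<\infty$ for some $\lambda>0$, normed by $\|f\|_{L^{p(\cdot)}}=\inf\{\lambda>0:\int(|f(x)|/\lambda)^{p(x)}dx\le1\}$. $\mathscr{P}(\mathbb{R}^n)$ is the set of measurable $p(\cdot):\mathbb{R}^n\to[1,\infty)$ with $1<\operatorname{ess\,inf}p$ and $p_+:=\operatorname{ess\,sup}p<\infty$; $\mathscr{B}(\mathbb{R}^n)$ is the set of $p(\cdot)\in\mathscr{P}(\mathbb{R}^n)$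 such that $M$ is bounded on $L^{p(\cdot)}(\mathbb{R}^n)$. For $0<\gamma<n$, $(p(\cdot),q(\cdot))\in\mathscr{B}^\gamma(\mathbb{R}^n)$ means $p(\cdot)\in\mathscr{P}(\mathbb{R}^n)$ with $p_+<n/\gamma$, $1/q(\cdot)=1/p(\cdot)-\gamma/n$, and $q(\cdot)(n-\gamma)/n\in\mathscr{B}(\mathbb{R}^n)$. Bounded from $L^{p(\cdot)}$ to $L^{q(\cdot)}$ means $\|T(f)\|_{L^{q(\cdot)}}\le C\|f\|_{L^{p(\cdot)}}$ for all $f\in L^{p(\cdot)}$. *)

theory Defs
  imports "HOL-Analysis.Analysis"
begin

definition cube :: "(real^'n) set \<Rightarrow> bool" where
  "cube Q \<longleftrightarrow> (\<exists>a h. 0 < h \<and> Q = cbox a (a + h *\<^sub>R One))"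

definition loc_integrable :: "(real^'n \<Rightarrow> real) \<Rightarrow> bool" where
  "loc_integrable f \<longleftrightarrow> (\<forall>K. compact K \<longrightarrow> set_integrable lebesgue K f)"

definition cavg :: "(real^'n) set \<Rightarrow> (real^'n \<Rightarrow> real) \<Rightarrow> real" where
  "cavg Q f = (LINT y:Q|lebesgue. f y) / measure lebesgue Q"

definition BMO :: "(real^'n \<Rightarrow> real) set" where
  "BMO = {f. loc_integrable f \<and>
      (\<exists>C. \<forall>Q. cube Q \<longrightarrow>
         (LINT y:Q|lebesgue. \<bar>f y - cavg Q f\<bar>) / measure lebesgue Q \<le> C)}"

definition negpart :: "(real^'n \<Rightarrow> real) \<Rightarrow> real^'n \<Rightarrow> real" where
  "negpart b x = (if b x < 0 then \<bar>b x\<bar> else 0)"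

definition Linfty :: "(real^'n \<Rightarrow> real) set" where
  "Linfty = {f. f \<in> borel_measurable lebesgue \<and> (\<exists>C. AE x in lebesgue. \<bar>f x\<bar> \<le> C)}"

definition Mfrac :: "real \<Rightarrow> (real^'n \<Rightarrow> real) \<Rightarrow> real^'n \<Rightarrow> ennreal" where
  "Mfrac \<gamma> f x = (SUP Q\<in>{Q. cube Q \<and> x \<in> Q}.
      ennreal (measure lebesgue Q powr (\<gamma> / real CARD('n) - 1)) *
      (\<integral>\<^sup>+ y\<in>Q. ennreal \<bar>f y\<bar> \<partial>lebesgue))"

definition Mloc :: "real \<Rightarrow> (real^'n) set \<Rightarrow> (real^'n \<Rightarrow> real) \<Rightarrow> real^'n \<Rightarrow> ennreal" where
  "Mloc \<gamma> Q0 f x = (SUP Q\<in>{Q. cube Q \<and> x \<in> Q \<and> Q \<subseteq> Q0}.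
      ennreal (measure lebesgue Q powr (\<gamma> / real CARD('n) - 1)) *
      (\<integral>\<^sup>+ y\<in>Q. ennreal \<bar>f y\<bar> \<partial>lebesgue))"

definition comm :: "real \<Rightarrow> (real^'n \<Rightarrow> real) \<Rightarrow> (real^'n \<Rightarrow> real) \<Rightarrow> real^'n \<Rightarrow> ereal" where
  "comm \<alpha> b f x = ereal (b x) * enn2ereal (Mfrac \<alpha> f x) - enn2ereal (Mfrac \<alpha> (\<lambda>y. b y * f y) x)"

(* variable exponent modular and Luxemburg norm (extended-valued functions allowed;
   the norm is \<infinity> when no admissible lambda exists) *)
definition vmodular :: "(real^'n \<Rightarrow> real) \<Rightarrow> (real^'n \<Rightarrow> ereal) \<Rightarrow> real \<Rightarrow> ennreal" where
  "vmodular p f t = (\<integral>\<^sup>+ x. (if \<bar>f x\<bar> = \<infinity> then \<infinity>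
        else ennreal ((real_of_ereal \<bar>f x\<bar> / t) powr p x)) \<partial>lebesgue)"

definition vnorm :: "(real^'n \<Rightarrow> real) \<Rightarrow> (real^'n \<Rightarrow> ereal) \<Rightarrow> ennreal" where
  "vnorm p f = (INF t\<in>{t. 0 < t \<and> vmodular p f t \<le> 1}. ennreal t)"

definition in_Lvar :: "(real^'n \<Rightarrow> real) \<Rightarrow> (real^'n \<Rightarrow> real) \<Rightarrow> bool" where
  "in_Lvar p f \<longleftrightarrow> f \<in> borel_measurable lebesgue \<and>
     (\<exists>t>0. vmodular p (\<lambda>x. ereal (f x)) t < \<infinity>)"

definition bounded_op :: "(real^'n \<Rightarrow> real) \<Rightarrow> (real^'n \<Rightarrow> real) \<Rightarrow>
    ((real^'n \<Rightarrow> real) \<Rightarrow> real^'n \<Rightarrow> ereal) \<Rightarrow> bool" where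
  "bounded_op p q T \<longleftrightarrow> (\<exists>C::real. \<forall>f. in_Lvar p f \<longrightarrow>
       vnorm q (T f) \<le> ennreal C * vnorm p (\<lambda>x. ereal (f x)))"

definition Pexp :: "(real^'n \<Rightarrow> real) set" where
  "Pexp = {p. p \<in> borel_measurable lebesgue \<and> (\<forall>x. 1 \<le> p x) \<and>
      (\<exists>c>1. AE x in lebesgue. c \<le> p x) \<and> (\<exists>C. AE x in lebesgue. p x \<le> C)}"

definition Bexp :: "(real^'n \<Rightarrow> real) set" where
  "Bexp = {p. p \<in> Pexp \<and> bounded_op p p (\<lambda>f x. enn2ereal (Mfrac 0 f x))}"

definition Bgam :: "real \<Rightarrow> (real^'n \<Rightarrow> real) \<Rightarrow> (real^'n \<Rightarrow> real) \<Rightarrow> bool" where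
  "Bgam \<gamma> p q \<longleftrightarrow> p \<in> Pexp \<and>
     (\<exists>C < real CARD('n) / \<gamma>. AE x in lebesgue. p x \<le> C) \<and>
     (\<forall>x. 1 / q x = 1 / p x - \<gamma> / real CARD('n)) \<and>
     (\<lambda>x. q x * (real CARD('n) - \<gamma>) / real CARD('n)) \<in> Bexp"

definition osc_cond :: "real \<Rightarrow> (real^'n \<Rightarrow> real) \<Rightarrow> (real^'n \<Rightarrow> real) \<Rightarrow> bool" where
  "osc_cond \<alpha> b s \<longleftrightarrow>
     (SUP Q\<in>{Q. cube Q}.
        vnorm s (\<lambda>x. if x \<in> Q then ereal (b x) -
              ereal (measure lebesgue Q powr (- \<alpha> / real CARD('n))) * enn2ereal (Mloc \<alpha> Q b x)
            else 0)
        / vnorm s (\<lambda>x. ereal (indicator Q x))) < \<infinity>"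

end

theory Submission
  imports Defs "HOL-Real_Asymp.Real_Asymp"
begin

text \<open>
  The standard route through duality, weighted extrapolation and sparse domination is replaced by an
  argument that uses only the boundedness of the maximal operator \<open>M\<close> on \<open>L\<^bsup>s(\<cdot>)\<^esup>\<close> and
  \<open>s\<^sub>+ < \<infinity>\<close>.

  A Rubio de Francia iteration majorizes \<open>f\<close> by an \<open>A\<^sub>1\<close> weight \<open>w\<close> of comparable norm. For
  \<open>A\<^sub>1\<close> weights, averages over a cube are comparable to infima over a neighbouring dyadic cell, so it
  suffices to control \<open>\<bar>b(x) - b\<^sub>P\<bar>\<^sup>r inf\<^sub>P w\<close> over the dyadic cells \<open>P\<close> containing \<open>x\<close>. On each
  level set \<open>{inf\<^sub>P w > 2\<^sup>n}\<close> the John--Nirenberg stopping argument gives nested sets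
  \<open>\<Omega>\<^sub>n\<^sub>,\<^sub>k\<close> in which \<open>\<bar>b - b\<^sub>P\<bar>\<close> is of size \<open>k\<close>, each filling at most half of every cell of the
  preceding one. Hence \<open>H\<^sub>k = \<Sum>\<^sub>n 2\<^sup>n \<chi>(\<Omega>\<^sub>n\<^sub>,\<^sub>k)\<close> satisfies \<open>H\<^sub>k \<le> 4 M(H\<^sub>k - H\<^sub>k\<^sub>+\<^sub>1)\<close>, which forces the
  norms of the \<open>H\<^sub>k\<close> to decay geometrically. This bounds the maximal commutator on \<open>L\<^bsup>s(\<cdot>)\<^esup>\<close> and
  thereby gives (5); the Hoelder splitting \<open>\<bar>f\<bar> = (\<bar>f\<bar>\<^bsup>p/s\<^esup>)\<^bsup>1-\<alpha>/n\<^esup> (\<bar>f\<bar>\<^sup>p)\<^bsup>\<alpha>/n\<^esup>\<close> with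
  \<open>s = q (n - \<alpha>) / n\<close> carries it over to (3).

  Conversely, (2) and (4) both control \<open>(\<bar>b\<bar>\<^sub>Q - b)\<^sup>+\<close> on every cube \<open>Q\<close> in norm, hence in mean, and
  this dominates both the negative part of \<open>b\<close> and half of the mean oscillation.
\<close>

section \<open>Powers and modulars of extended nonnegative functions\<close>

text \<open>The modular of a variable-exponent space is not homogeneous, so constants cannot be
  pulled out of it. Estimates are therefore stated on its unit ball: \<open>ballbd\<close> says that
  the maximal operator, divided by \<open>A\<close>, preserves the ball, and the commutator estimate
  produces an element \<open>Y\<close> of the ball that dominates pointwise. The ball is closed
  under countable convex combinations and lower limits, which replace the triangle inequality and
  completeness. The kernel is \<open>(|b x - b y| + 1) powr r\<close>. The power is there because
  the Hoelder splitting raises the oscillation to \<open>1 / (1 - \<alpha> / n)\<close>, whereas (5)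
  takes \<open>r = 1\<close>; the summand 1 makes one inequality control both the commutator and the
  fractional maximal function of \<open>f\<close>, including its finiteness. A dyadic grid with
  largest side \<open>h\<close> reaches only cubes of side at most \<open>h\<close>, and its
  majorant depends on \<open>h\<close>; grids of side \<open>2 ^ k\<close> are combined by Fatou's
  lemma. Passing from "all" to "some" exponents requires one admissible exponent. The constant 2
  serves, by way of the Vitali covering lemma.\<close>

definition epow :: "ennreal \<Rightarrow> real \<Rightarrow> ennreal" where
  "epow a p = (if a = top then top else ennreal (enn2real a powr p))"

lemma epow_ennreal [simp]: "0 \<le> a \<Longrightarrow> epow (ennreal a) p = ennreal (a powr p)"
  by (simp add: epow_def)

lemma epow_top [simp]: "epow top p = top"
  by (simp add: epow_def)

lemma epow_0 [simp]: "epow 0 p = 0"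
  by (simp add: epow_def)

lemma epow_1 [simp]: "epow a 1 = a"
  by (cases a) auto

lemma epow_eq_top_iff [simp]: "epow a p = top \<longleftrightarrow> a = top"
  by (simp add: epow_def)

lemma epow_eq_0_iff [simp]: "epow a p = 0 \<longleftrightarrow> a = 0"
  by (cases a) (auto simp: ennreal_eq_0_iff)

lemma epow_mono: "a \<le> b \<Longrightarrow> 0 \<le> p \<Longrightarrow> epow a p \<le> epow b p"
  by (cases a; cases b) (auto simp: powr_mono2 top_unique intro!: ennreal_leI)

lemma epow_epow: "epow (epow a p) q = epow a (p * q)"
  by (cases a) (auto simp: powr_powr)

lemma epow_mult:
  assumes "0 < p"
  shows "epow (a * b) p = epow a p * epow b p"
proof (cases "a = top \<or> b = top")
  case True
  then show ?thesis
    using assms by (cases "a = 0"; cases "b = 0") (auto simp: ennreal_mult_top ennreal_top_mult ennreal_mult_eq_top_iff)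
next
  case False
  then show ?thesis
    by (cases a; cases b) (auto simp: powr_mult simp flip: ennreal_mult)
qed

lemma epow_inverse_le_iff:
  assumes "0 < p"
  shows "epow a p \<le> y \<longleftrightarrow> a \<le> epow y (1 / p)"
proof
  assume "epow a p \<le> y"
  then have "epow (epow a p) (1 / p) \<le> epow y (1 / p)" by (rule epow_mono) (use assms in auto)
  then show "a \<le> epow y (1 / p)" using assms by (simp add: epow_epow)
next
  assume "a \<le> epow y (1 / p)"
  then have "epow a p \<le> epow (epow y (1 / p)) p" by (rule epow_mono) (use assms in auto)
  then show "epow a p \<le> y" using assms by (simp add: epow_epow)
qed

lemma epow_SUP:
  assumes "0 < p"
  shows "epow (SUP i\<in>I. f i) p = (SUP i\<in>I. epow (f i) p)"
proof (rule antisym)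
  show "epow (SUP i\<in>I. f i) p \<le> (SUP i\<in>I. epow (f i) p)"
    unfolding epow_inverse_le_iff[OF assms]
    by (rule SUP_least, subst epow_inverse_le_iff[OF assms, symmetric]) (rule SUP_upper)
  show "(SUP i\<in>I. epow (f i) p) \<le> epow (SUP i\<in>I. f i) p"
    using assms by (intro SUP_least epow_mono SUP_upper) auto
qed

lemma epow_liminf_le:
  fixes f :: "nat \<Rightarrow> ennreal"
  assumes "0 < p"
  shows "epow (liminf f) p \<le> liminf (\<lambda>k. epow (f k) p)"
proof -
  have "epow (liminf f) p = (SUP n. epow (INF m\<in>{n..}. f m) p)"
    by (simp add: liminf_SUP_INF epow_SUP[OF assms])
  also have "\<dots> \<le> (SUP n. INF m\<in>{n..}. epow (f m) p)"
    using assms by (intro SUP_mono' INF_greatest epow_mono INF_lower) auto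
  finally show ?thesis by (simp add: liminf_SUP_INF)
qed

section \<open>Superadditivity, tangent lines and Jensen's inequality for powers\<close>

lemma epow_superadd:
  assumes "1 \<le> p"
  shows "epow a p + epow b p \<le> epow (a + b) p"
proof (cases "a = top \<or> b = top")
  case False
  then obtain x y where xy: "a = ennreal x" "b = ennreal y" "0 \<le> x" "0 \<le> y"
    by (cases a; cases b) auto
  have "x powr p + y powr p \<le> (x + y) powr p"
  proof (cases "x + y = 0")
    case False
    then have pos: "0 < x + y" using xy by auto
    have *: "z powr p \<le> (x + y) powr (p - 1) * z" if "0 \<le> z" "z \<le> x + y" for z
    proof (cases "z = 0")
      case False
      then have "z powr p = z powr (p - 1) * z powr 1"
        by (subst powr_add[symmetric]) simp
      also have "\<dots> \<le> (x + y) powr (p - 1) * z"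
        using that assms by (auto intro!: mult_mono powr_mono2)
      finally show ?thesis .
    qed (use assms in auto)
    have "x powr p + y powr p \<le> (x + y) powr (p - 1) * (x + y)"
      using *[of x] *[of y] xy by (simp add: distrib_left)
    also have "\<dots> = (x + y) powr (p - 1) * (x + y) powr 1" using pos by simp
    also have "\<dots> = (x + y) powr p" by (subst powr_add[symmetric]) simp
    finally show ?thesis .
  qed (use xy in \<open>simp add: add_nonneg_eq_0_iff\<close>)
  then show ?thesis
    using xy by (auto simp flip: ennreal_plus intro!: ennreal_leI)
qed auto

text \<open>The graph of a convex power lies above its tangent at \<open>a\<close>. Young's
  inequality with weights \<open>1 / p\<close> and \<open>(p - 1) / p\<close>, applied to
  \<open>x powr p\<close> and \<open>a powr p\<close>, is this bound divided by
  \<open>p\<close>.\<close>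

lemma tangent_powr:
  fixes x a p :: real
  assumes "0 \<le> x" "0 < a" "1 \<le> p"
  shows "p * a powr (p - 1) * x \<le> x powr p + (p - 1) * a powr p"
proof (cases "p = 1 \<or> x = 0")
  case False
  then have p: "1 < p" "x \<noteq> 0" using assms by auto
  have "(x powr p) powr (1 / p) * (a powr p) powr ((p - 1) / p)
      \<le> (1 / p) * x powr p + ((p - 1) / p) * a powr p"
    using assms p by (intro Youngs_inequality_0) (auto simp: field_simps)
  then have "x * a powr (p - 1) \<le> (1 / p) * x powr p + ((p - 1) / p) * a powr p"
    using assms p by (simp add: powr_powr)
  then have "p * (x * a powr (p - 1)) \<le> p * ((1 / p) * x powr p + ((p - 1) / p) * a powr p)"
    using p by (intro mult_left_mono) auto
  also have "\<dots> = x powr p + (p - 1) * a powr p"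
    unfolding distrib_left times_divide_eq_left using p by simp
  finally show ?thesis by (simp add: mult_ac)
qed (use assms in auto)

lemma tangent_epow:
  fixes x :: ennreal
  assumes "0 < a" "1 \<le> p"
  shows "ennreal (p * a powr (p - 1)) * x \<le> epow x p + ennreal ((p - 1) * a powr p)"
proof (cases x)
  case (real r)
  have "ennreal (p * a powr (p - 1) * r) \<le> ennreal (r powr p + (p - 1) * a powr p)"
    using tangent_powr[of r a p] assms real by (intro ennreal_leI) auto
  then show ?thesis
    using assms real by (simp add: ennreal_mult ennreal_plus)
qed simp

lemma ennreal_le_if_add_le: "a + c \<le> b + c \<Longrightarrow> c \<noteq> top \<Longrightarrow> a \<le> (b::ennreal)"
  by (simp add: add.commute[of _ c] ennreal_add_left_cancel_le)

text \<open>Sum the tangent inequality with weights \<open>l k\<close>, then take the tangent at the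
  mean \<open>?A\<close> itself. A total weight at most 1 suffices because the constant term
  \<open>(p - 1) * a powr p\<close> stands on the larger side and is nonnegative.\<close>

lemma epow_jensen:
  fixes l :: "nat \<Rightarrow> ennreal"
  assumes p: "1 \<le> p" and l: "(\<Sum>k. l k) \<le> 1"
  shows "epow (\<Sum>k. l k * f k) p \<le> (\<Sum>k. l k * epow (f k) p)"
proof -
  let ?A = "\<Sum>k. l k * f k" and ?R = "\<Sum>k. l k * epow (f k) p"
  have main: "ennreal (p * a powr (p - 1)) * ?A \<le> ?R + ennreal ((p - 1) * a powr p)" if "0 < a" for a
  proof -
    have "ennreal (p * a powr (p - 1)) * ?A = (\<Sum>k. l k * (ennreal (p * a powr (p - 1)) * f k))"
      by (simp add: ennreal_suminf_cmult[symmetric] mult.left_commute)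
    also have "\<dots> \<le> (\<Sum>k. l k * epow (f k) p + l k * ennreal ((p - 1) * a powr p))"
      by (intro suminf_le allI) (auto simp: distrib_left[symmetric] intro!: mult_left_mono tangent_epow that p)
    also have "\<dots> = ?R + (\<Sum>k. l k) * ennreal ((p - 1) * a powr p)"
      by (simp add: suminf_add[symmetric])
    also have "\<dots> \<le> ?R + 1 * ennreal ((p - 1) * a powr p)"
      by (intro add_mono mult_right_mono l order_refl) auto
    finally show ?thesis by simp
  qed
  show ?thesis
  proof (cases ?A)
    case top
    \<comment> \<open>An infinite mean has no tangent; the one at 1 already forces the right-hand
      side to be infinite.\<close>
    have "ennreal p * top \<le> ?R + ennreal (p - 1)"
      using main[of 1] top by simp
    then have "?R = top" using p by (auto simp: ennreal_mult_top top_unique split: if_splits)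
    then show ?thesis by simp
  next
    case (real A)
    show ?thesis
    proof (cases "A = 0")
      case False
      then have A: "0 < A" using real by simp
      have "A powr (p - 1) * A powr 1 = A powr p"
        by (subst powr_add[symmetric]) simp
      then have "p * A powr (p - 1) * A = A powr p + (p - 1) * A powr p"
        using A by (simp add: algebra_simps)
      then have "ennreal (p * A powr (p - 1)) * ?A = ennreal (A powr p) + ennreal ((p - 1) * A powr p)"
        using real p by (simp flip: ennreal_mult ennreal_plus)
      with main[OF A] have "ennreal (A powr p) + ennreal ((p - 1) * A powr p)
          \<le> ?R + ennreal ((p - 1) * A powr p)" by simp
      then have "ennreal (A powr p) \<le> ?R"
        by (rule ennreal_le_if_add_le) simp
      then show ?thesis using real by simp
    qed (use real in simp)
  qed
qed

lemma epow_measurable [measurable]: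
  assumes [measurable]: "F \<in> borel_measurable M" "s \<in> borel_measurable M"
  shows "(\<lambda>x. epow (F x) (s x)) \<in> borel_measurable M"
  unfolding epow_def by measurable

text \<open>Where a finite upper bound \<open>S\<close> of the exponent pays: enlarging the argument
  by \<open>t\<close> enlarges the power by a factor at most \<open>t powr S\<close>, uniformly in
  the exponent.\<close>

lemma epow_mult_le:
  assumes "1 \<le> t" "p \<le> S"
  shows "epow (ennreal t * a) p \<le> ennreal (t powr S) * epow a p"
proof (cases a)
  case (real r)
  have "epow (ennreal t * a) p = ennreal (t powr p * r powr p)"
    using assms real by (simp add: powr_mult flip: ennreal_mult)
  also have "\<dots> \<le> ennreal (t powr S * r powr p)"
    using assms by (intro ennreal_leI mult_right_mono powr_mono) auto
  also have "\<dots> = ennreal (t powr S) * epow a p"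
    using real by (simp add: ennreal_mult)
  finally show ?thesis .
next
  case top
  then show ?thesis using assms by (auto simp: ennreal_mult_top)
qed

lemma epow_contract:
  assumes "0 \<le> t" "t \<le> 1" "1 \<le> p"
  shows "epow (ennreal t * a) p \<le> ennreal t * epow a p"
proof (cases "t = 0")
  case False
  then have t: "0 < t" using assms by simp
  have "t powr p \<le> t powr 1" using t assms by (intro powr_mono') auto
  then show ?thesis using assms t
    by (auto simp: epow_mult intro!: mult_right_mono ennreal_leI)
qed simp

section \<open>Modulars, their unit balls and the maximal function of extended functions\<close>

definition mdl :: "(real^'n \<Rightarrow> real) \<Rightarrow> (real^'n \<Rightarrow> ennreal) \<Rightarrow> ennreal" where
  "mdl s F = (\<integral>\<^sup>+x. epow (F x) (s x) \<partial>lebesgue)"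

definition MX :: "(real^'n \<Rightarrow> ennreal) \<Rightarrow> real^'n \<Rightarrow> ennreal" where
  "MX F x = (SUP Q\<in>{Q. cube Q \<and> x \<in> Q}. (\<integral>\<^sup>+y\<in>Q. F y \<partial>lebesgue) / emeasure lebesgue Q)"

definition ballbd :: "(real^'n \<Rightarrow> real) \<Rightarrow> real \<Rightarrow> bool" where
  "ballbd s A \<longleftrightarrow> (\<forall>F\<in>borel_measurable lebesgue. mdl s F \<le> 1 \<longrightarrow> mdl s (\<lambda>x. MX F x / ennreal A) \<le> 1)"

lemma mdl_mono_AE:
  assumes "AE x in lebesgue. F x \<le> G x" "\<And>x. 0 \<le> s x"
  shows "mdl s F \<le> mdl s G"
  unfolding mdl_def by (rule nn_integral_mono_AE) (use assms in \<open>auto intro!: epow_mono\<close>)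

lemma mdl_mono: "(\<And>x. F x \<le> G x) \<Longrightarrow> (\<And>x. 0 \<le> s x) \<Longrightarrow> mdl s F \<le> mdl s G"
  by (rule mdl_mono_AE) auto

text \<open>Jensen's inequality at each point keeps a countable subconvex combination in the unit
  ball; the series \<open>w\<close>, \<open>Y\<close> and \<open>Z\<close> built later are all
  normalised to this form.\<close>

lemma mdl_jensen:
  fixes l :: "nat \<Rightarrow> ennreal"
  assumes s: "s \<in> borel_measurable lebesgue" "\<And>x. 1 \<le> s x"
    and l: "(\<Sum>k. l k) \<le> 1" and F: "\<And>k. F k \<in> borel_measurable lebesgue" "\<And>k. mdl s (F k) \<le> 1"
  shows "mdl s (\<lambda>x. \<Sum>k. l k * F k x) \<le> 1"
proof -
  note [measurable] = s(1) F(1)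
  have "mdl s (\<lambda>x. \<Sum>k. l k * F k x) \<le> (\<integral>\<^sup>+x. (\<Sum>k. l k * epow (F k x) (s x)) \<partial>lebesgue)"
    unfolding mdl_def by (intro nn_integral_mono epow_jensen s l)
  also have "\<dots> = (\<Sum>k. l k * mdl s (F k))"
    by (simp add: nn_integral_suminf nn_integral_cmult mdl_def)
  also have "\<dots> \<le> (\<Sum>k. l k * 1)"
    by (intro suminf_le allI mult_left_mono F) auto
  finally show ?thesis using l by simp
qed

lemma mdl_liminf:
  assumes s: "s \<in> borel_measurable lebesgue" "\<And>x. 1 \<le> s x"
    and F: "\<And>k. F k \<in> borel_measurable lebesgue" "\<And>k::nat. mdl s (F k) \<le> 1"
  shows "mdl s (\<lambda>x. liminf (\<lambda>k. F k x)) \<le> 1"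
proof -
  note [measurable] = s(1) F(1)
  have "0 < s x" for x using s(2)[of x] by simp
  then have "mdl s (\<lambda>x. liminf (\<lambda>k. F k x)) \<le> (\<integral>\<^sup>+x. liminf (\<lambda>k. epow (F k x) (s x)) \<partial>lebesgue)"
    unfolding mdl_def by (intro nn_integral_mono epow_liminf_le)
  also have "\<dots> \<le> liminf (\<lambda>k. mdl s (F k))"
    unfolding mdl_def by (intro nn_integral_liminf) measurable
  also have "\<dots> \<le> liminf (\<lambda>k::nat. 1 :: ennreal)"
    by (intro Liminf_mono always_eventually allI F)
  finally show ?thesis by (simp add: Liminf_const)
qed

lemma mdl_finite_AE:
  assumes s: "s \<in> borel_measurable lebesgue" and F: "F \<in> borel_measurable lebesgue" "mdl s F \<le> 1"
  shows "AE x in lebesgue. F x < top"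
proof -
  note [measurable] = s F(1)
  have "(\<integral>\<^sup>+x. epow (F x) (s x) \<partial>lebesgue) \<noteq> top"
    using F(2) by (auto simp: mdl_def top_unique)
  then have "AE x in lebesgue. epow (F x) (s x) \<noteq> \<infinity>"
    by (intro nn_integral_PInf_AE) (auto simp: infinity_ennreal_def)
  then show ?thesis by (auto simp: less_top infinity_ennreal_def)
qed

section \<open>Cubes and the maximal function\<close>

lemma One_nth [simp]: "(One :: real^'n) $ l = 1"
  by (simp add: cart_eq_inner_axis inner_sum_left_Basis axis_in_Basis_iff)

lemma sum_Basis_nth [simp]: "(\<Sum>x\<in>Basis. (x :: real^'n) $ l) = 1"
  using One_nth[of l] by (simp only: sum_component)

lemma cubeE:
  assumes "cube (Q :: (real^'n) set)"
  obtains a h where "0 < h" "Q = cbox a (a + h *\<^sub>R One)"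
    "emeasure lebesgue Q = ennreal (h ^ CARD('n))" "measure lebesgue Q = h ^ CARD('n)"
proof -
  obtain a h where h: "0 < h" "Q = cbox a (a + h *\<^sub>R One)"
    using assms by (auto simp: cube_def)
  have "emeasure lebesgue Q = ennreal (h ^ CARD('n))"
    using h by (simp add: emeasure_completion emeasure_lborel_cbox inner_add_left prod_constant)
  moreover from this have "measure lebesgue Q = h ^ CARD('n)"
    using h by (simp add: measure_def)
  ultimately show thesis using h that by blast
qed

lemma cube_cbox: "0 < h \<Longrightarrow> cube (cbox a (a + h *\<^sub>R One))"
  by (auto simp: cube_def)

lemma mem_cube_iff: "x \<in> cbox a (a + h *\<^sub>R (One :: real^'n)) \<longleftrightarrow> (\<forall>l. a $ l \<le> x $ l \<and> x $ l \<le> a $ l + h)"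
  by (simp add: mem_box_cart)

lemma emeasure_cube: "0 < h \<Longrightarrow> emeasure lebesgue (cbox a (a + h *\<^sub>R (One :: real^'n))) = ennreal (h ^ CARD('n))"
  by (simp add: emeasure_lborel_cbox inner_add_left prod_constant)

lemma cube_sets [intro]: "cube Q \<Longrightarrow> Q \<in> sets lebesgue"
  by (auto simp: cube_def)

lemma cube_emeasure:
  assumes "cube Q"
  shows "emeasure lebesgue Q = ennreal (measure lebesgue Q)" "0 < measure lebesgue Q"
    "emeasure lebesgue Q \<noteq> 0" "emeasure lebesgue Q \<noteq> top" "0 < emeasure lebesgue Q"
proof -
  obtain a h where h: "0 < h" "emeasure lebesgue Q = ennreal (h ^ CARD('a))" "measure lebesgue Q = h ^ CARD('a)"
    using cubeE[OF assms] by metis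
  then show "emeasure lebesgue Q = ennreal (measure lebesgue Q)" "0 < measure lebesgue Q"
    "emeasure lebesgue Q \<noteq> 0" "emeasure lebesgue Q \<noteq> top" "0 < emeasure lebesgue Q"
    using zero_less_power[OF h(1), of "CARD('a)"] by (simp_all add: ennreal_eq_0_iff not_le)
qed

declare emeasure_completion [simp del]

lemma ennreal_divide_le_iff_mult:
  assumes "c \<noteq> 0" "c \<noteq> top"
  shows "(a / c \<le> b) = (a \<le> b * (c::ennreal))"
proof
  assume "a / c \<le> b"
  then have "a / c * c \<le> b * c" by (rule mult_right_mono) simp
  then show "a \<le> b * c" using assms
    by (simp add: ennreal_divide_times ennreal_mult_divide_eq less_top)
next
  assume "a \<le> b * c"
  then have "a / c \<le> b * c / c" by (rule divide_right_mono_ennreal)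
  then show "a / c \<le> b" using assms by (simp add: ennreal_mult_divide_eq)
qed

lemma MX_upper:
  assumes "cube Q" "x \<in> Q"
  shows "(\<integral>\<^sup>+y\<in>Q. F y \<partial>lebesgue) \<le> MX F x * emeasure lebesgue Q"
proof -
  have "(\<integral>\<^sup>+y\<in>Q. F y \<partial>lebesgue) / emeasure lebesgue Q \<le> MX F x"
    unfolding MX_def using assms by (intro SUP_upper) auto
  then show ?thesis using cube_emeasure(3,4)[OF assms(1)] by (simp add: ennreal_divide_le_iff_mult)
qed

lemma MX_le_iff:
  "MX F x \<le> c \<longleftrightarrow> (\<forall>Q. cube Q \<longrightarrow> x \<in> Q \<longrightarrow> (\<integral>\<^sup>+y\<in>Q. F y \<partial>lebesgue) \<le> c * emeasure lebesgue Q)"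
  unfolding MX_def by (auto simp: SUP_le_iff ennreal_divide_le_iff_mult cube_emeasure(3,4))

lemma MX_cmult:
  assumes "F \<in> borel_measurable lebesgue"
  shows "MX (\<lambda>y. c * F y) x = c * MX F x"
proof -
  have "(\<integral>\<^sup>+y\<in>Q. c * F y \<partial>lebesgue) = c * (\<integral>\<^sup>+y\<in>Q. F y \<partial>lebesgue)" if "cube Q" for Q
  proof -
    note [measurable] = assms cube_sets[OF that]
    show ?thesis unfolding mult.assoc by (rule nn_integral_cmult) measurable
  qed
  then show ?thesis
    unfolding MX_def by (simp add: SUP_mult_left_ennreal ennreal_times_divide)
qed

lemma MX_suminf_le:
  assumes [measurable]: "\<And>k::nat. F k \<in> borel_measurable lebesgue"
  shows "MX (\<lambda>y. \<Sum>k. F k y) x \<le> (\<Sum>k. MX (F k) x)"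
  unfolding MX_le_iff
proof (intro allI impI)
  fix Q :: "(real^'a) set" assume Q: "cube Q" "x \<in> Q"
  note [measurable] = cube_sets[OF Q(1)]
  have "(\<integral>\<^sup>+y\<in>Q. (\<Sum>k. F k y) \<partial>lebesgue) = (\<Sum>k. \<integral>\<^sup>+y\<in>Q. F k y \<partial>lebesgue)"
    by (subst nn_integral_suminf[symmetric]) (auto simp: ennreal_suminf_multc)
  also have "\<dots> \<le> (\<Sum>k. MX (F k) x * emeasure lebesgue Q)"
    by (intro suminf_le allI MX_upper Q) auto
  finally show "(\<integral>\<^sup>+y\<in>Q. (\<Sum>k. F k y) \<partial>lebesgue) \<le> (\<Sum>k. MX (F k) x) * emeasure lebesgue Q"
    by (simp add: ennreal_suminf_multc)
qed

text \<open>The cubes are closed, so \<open>x\<close> may lie on the boundary of the cube that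
  witnesses \<open>t < MX F x\<close>. Widening that cube by a small \<open>d\<close> keeps the
  average above \<open>t\<close>, by continuity of the volume, and places \<open>x\<close> in the
  interior.\<close>

lemma MX_open: "open {x. t < MX F (x :: real^'n)}"
proof (subst open_subopen, intro ballI)
  fix x assume "x \<in> {x. t < MX F x}"
  then obtain Q where Q: "cube Q" "x \<in> Q" and t: "t < (\<integral>\<^sup>+y\<in>Q. F y \<partial>lebesgue) / emeasure lebesgue Q"
    by (auto simp: MX_def less_SUP_iff)
  obtain a h where h: "0 < h" "Q = cbox a (a + h *\<^sub>R One)" using cubeE[OF Q(1)] by metis
  define R where "R d = cbox (a - d *\<^sub>R One) ((a - d *\<^sub>R One) + (h + 2 * d) *\<^sub>R (One :: real^'n))" for d
  define I where "I = (\<integral>\<^sup>+y\<in>Q. F y \<partial>lebesgue)"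
  have "\<exists>d>0. t < I / ennreal ((h + 2 * d) ^ CARD('n))"
  proof (cases I)
    case top
    have "t < top" using t by (rule less_le_trans) simp
    then show ?thesis using top by (intro exI[of _ 1]) (auto simp: ennreal_top_divide)
  next
    case (real i)
    have tlt: "t < ennreal (i / h ^ CARD('n))"
    proof -
      have "t < I / ennreal (h ^ CARD('n))" using t h by (simp add: I_def emeasure_cube)
      then show ?thesis using real h(1) by (simp add: divide_ennreal)
    qed
    have "((\<lambda>d. i / (h + 2 * d) ^ CARD('n)) \<longlongrightarrow> i / (h + 2 * 0) ^ CARD('n)) (at_right 0)"
      using h by (intro tendsto_intros) auto
    then have "((\<lambda>d. ennreal (i / (h + 2 * d) ^ CARD('n))) \<longlongrightarrow> ennreal (i / h ^ CARD('n))) (at_right 0)"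
      by (intro tendsto_ennrealI) simp
    from order_tendstoD(1)[OF this tlt]
    have "\<forall>\<^sub>F d in at_right 0. t < ennreal (i / (h + 2 * d) ^ CARD('n))" .
    then obtain e where e: "0 < e" "\<And>d. 0 < d \<Longrightarrow> d < e \<Longrightarrow> t < ennreal (i / (h + 2 * d) ^ CARD('n))"
      unfolding eventually_at_right_field by auto
    have "t < I / ennreal ((h + 2 * (e / 2)) ^ CARD('n))"
      using e(2)[of "e / 2"] e(1) h real by (simp add: divide_ennreal)
    then show ?thesis using e(1) by (intro exI[of _ "e / 2"]) auto
  qed
  then obtain d where d: "0 < d" "t < I / ennreal ((h + 2 * d) ^ CARD('n))" by blast
  have R: "cube (R d)" "emeasure lebesgue (R d) = ennreal ((h + 2 * d) ^ CARD('n))"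
    using d h by (auto simp: R_def emeasure_cube intro!: cube_cbox)
  have "Q \<subseteq> R d"
  proof
    fix y assume "y \<in> Q"
    then have "a $ l \<le> y $ l \<and> y $ l \<le> a $ l + h" for l unfolding h(2) mem_cube_iff by blast
    then show "y \<in> R d" unfolding R_def mem_cube_iff using d(1) by (simp add: add_increasing2) (smt (verit))
  qed
  then have "I \<le> (\<integral>\<^sup>+y\<in>R d. F y \<partial>lebesgue)"
    unfolding I_def by (intro nn_integral_mono mult_left_mono) (auto simp: indicator_def)
  then have "t < (\<integral>\<^sup>+y\<in>R d. F y \<partial>lebesgue) / emeasure lebesgue (R d)"
    using d R(2) by (auto intro: less_le_trans divide_right_mono_ennreal)
  then have sub: "R d \<subseteq> {x. t < MX F x}"
    using R(1) by (auto simp: MX_def less_SUP_iff)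
  define S where "S = box (a - d *\<^sub>R One) ((a - d *\<^sub>R One) + (h + 2 * d) *\<^sub>R (One :: real^'n))"
  have "S \<subseteq> R d" by (simp add: S_def R_def box_subset_cbox)
  moreover have "x \<in> S"
  proof -
    have "a $ l \<le> x $ l \<and> x $ l \<le> a $ l + h" for l using Q(2) unfolding h(2) mem_cube_iff by blast
    then show ?thesis unfolding S_def mem_box_cart using d(1) by simp (smt (verit))
  qed
  ultimately show "\<exists>T. open T \<and> x \<in> T \<and> T \<subseteq> {x. t < MX F x}"
    using sub by (intro exI[of _ S]) (auto simp: S_def)
qed

lemma MX_measurable [measurable]: "MX (F :: real^'n \<Rightarrow> ennreal) \<in> borel_measurable lebesgue"
proof -
  have "MX F \<in> borel_measurable borel"
    by (intro borel_measurableI_greater) (use borel_open[OF MX_open] in auto)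
  then show ?thesis by (simp add: measurable_completion)
qed

text \<open>Rubio de Francia's iteration, a weighted sum of all iterates of \<open>MX / A\<close>.
  The term \<open>k = 0\<close> gives \<open>F \<le> 2 * w\<close>; the maximal operator shifts the
  series by one index and so costs \<open>2 * A\<close>; the weights add up to 1, which keeps
  \<open>w\<close> in the unit ball.\<close>

lemma A1_majorant:
  fixes s :: "real^'n \<Rightarrow> real"
  assumes s: "s \<in> borel_measurable lebesgue" "\<And>x. 1 \<le> s x"
    and A: "0 < A" "ballbd s A" and F: "F \<in> borel_measurable lebesgue" "mdl s F \<le> 1"
  obtains w where "w \<in> borel_measurable lebesgue" "mdl s w \<le> 1" "\<And>x. F x \<le> 2 * w x"
    "\<And>x. MX w x \<le> ennreal (2 * A) * w x"
proof -
  define T where "T = (\<lambda>(G :: real^'n \<Rightarrow> ennreal) x. MX G x / ennreal A)"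
  define G where "G k = (T ^^ k) F" for k
  define l where "l k = ennreal ((1/2) ^ Suc k)" for k
  have Gm [measurable]: "G k \<in> borel_measurable lebesgue" for k
    by (induction k) (auto simp: G_def T_def F)
  have Gb: "mdl s (G k) \<le> 1" for k
  proof (induction k)
    case (Suc k)
    then show ?case using A(2) Gm[of k] by (auto simp: ballbd_def G_def T_def)
  qed (simp add: G_def F)
  have MG: "MX (G k) x = ennreal A * G (Suc k) x" for k x
    using A(1) by (simp add: G_def T_def ennreal_times_divide mult.commute[of "ennreal A"]
        ennreal_mult_divide_eq ennreal_eq_0_iff)
  define w where "w x = (\<Sum>k. l k * G k x)" for x
  have lsum: "(\<Sum>k. l k) \<le> 1"
  proof -
    have "(\<lambda>k. (1/2) ^ Suc k :: real) sums 1" by (rule power_half_series)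
    then have "(\<Sum>k. l k) = ennreal 1" unfolding l_def by (intro suminf_ennreal_eq) auto
    then show ?thesis by simp
  qed
  have w1: "w \<in> borel_measurable lebesgue" unfolding w_def l_def by measurable
  have w2: "mdl s w \<le> 1" unfolding w_def by (rule mdl_jensen[OF s lsum Gm Gb])
  have w3: "F x \<le> 2 * w x" for x
  proof -
    have "ennreal 2 * ennreal (1/2) = 1" by (subst ennreal_mult[symmetric]) auto
    then have "F x = 2 * (l 0 * G 0 x)"
      unfolding l_def G_def mult.assoc[symmetric] by simp
    also have "l 0 * G 0 x \<le> w x"
      unfolding w_def using sum_le_suminf[of "\<lambda>k. l k * G k x" "{0}"] by simp
    finally show ?thesis by (simp add: mult_left_mono)
  qed
  have w4: "MX w x \<le> ennreal (2 * A) * w x" for x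
  proof -
    have "MX w x \<le> (\<Sum>k. MX (\<lambda>y. l k * G k y) x)"
      unfolding w_def by (rule MX_suminf_le) (simp add: l_def)
    also have "\<dots> = (\<Sum>k. ennreal (2 * A) * (l (Suc k) * G (Suc k) x))"
    proof (rule suminf_cong)
      fix k
      have "l k * ennreal A = ennreal (2 * A) * l (Suc k)"
        unfolding l_def using A(1) by (subst (1 2) ennreal_mult[symmetric]) auto
      then show "MX (\<lambda>y. l k * G k y) x = ennreal (2 * A) * (l (Suc k) * G (Suc k) x)"
        by (simp add: MX_cmult MG mult.assoc[symmetric])
    qed
    also have "\<dots> = ennreal (2 * A) * (\<Sum>k. l (k + 1) * G (k + 1) x)"
      by (simp add: ennreal_suminf_cmult)
    also have "(\<Sum>k. l (k + 1) * G (k + 1) x) \<le> w x"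
    proof -
      have "w x = (\<Sum>k. l (k + 1) * G (k + 1) x) + (\<Sum>k<1. l k * G k x)"
        unfolding w_def by (rule suminf_offset) auto
      then show ?thesis by simp
    qed
    finally show ?thesis by (simp add: mult_left_mono)
  qed
  show thesis by (rule that[OF w1 w2 w3 w4])
qed

section \<open>Dyadic cells\<close>

text \<open>Origin and largest side of the grid are free, so that any given cube can be made the top
  cell; sides larger than \<open>h\<close> do not occur.\<close>

definition idx :: "real^'n \<Rightarrow> real \<Rightarrow> nat \<Rightarrow> real^'n \<Rightarrow> int^'n" where
  "idx a h i x = (\<chi> l. \<lfloor>(x $ l - a $ l) / h * 2 ^ i\<rfloor>)"

definition cell :: "real^'n \<Rightarrow> real \<Rightarrow> nat \<Rightarrow> real^'n \<Rightarrow> (real^'n) set" where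
  "cell a h i x = {y. idx a h i y = idx a h i x}"

definition corner :: "real^'n \<Rightarrow> real \<Rightarrow> nat \<Rightarrow> real^'n \<Rightarrow> real^'n" where
  "corner a h i x = (\<chi> l. a $ l + h / 2 ^ i * of_int (idx a h i x $ l))"

text \<open>Half-open cells partition the space, but only closed boxes are cubes in the sense of
  \<open>cube\<close>. The two differ by a null set, so integrals pass freely between them.\<close>

definition ccell :: "real^'n \<Rightarrow> real \<Rightarrow> nat \<Rightarrow> real^'n \<Rightarrow> (real^'n) set" where
  "ccell a h i x = cbox (corner a h i x) (corner a h i x + (h / 2 ^ i) *\<^sub>R One)"

lemma cell_self [simp]: "x \<in> cell a h i x"
  by (simp add: cell_def)

lemma cell_eq: "y \<in> cell a h i x \<Longrightarrow> cell a h i y = cell a h i x"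
  by (simp add: cell_def)

lemma ccell_eq: "y \<in> cell a h i x \<Longrightarrow> ccell a h i y = ccell a h i x"
  by (simp add: cell_def ccell_def corner_def)

lemma idx_mono:
  assumes "idx a h j x = idx a h j y" "i \<le> j"
  shows "idx a h i x = idx a h i y"
proof -
  \<comment> \<open>Refining the grid appends binary digits to each index, so the coarse index is
    the integer quotient of the fine one.\<close>
  have "idx a h i z $ l = (idx a h j z $ l) div 2 ^ (j - i)" for z l
  proof -
    have "(2::real) ^ j = 2 ^ i * 2 ^ (j - i)" using assms(2) by (simp flip: power_add)
    then have "(z $ l - a $ l) / h * 2 ^ i = (z $ l - a $ l) / h * 2 ^ j / real_of_int (2 ^ (j - i))"
      by simp
    then show ?thesis
      unfolding idx_def by (simp only: vec_lambda_beta) (subst floor_divide_real_eq_div[symmetric], auto)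
  qed
  then show ?thesis using assms(1) by (simp add: vec_eq_iff)
qed

lemma cell_mono: "i \<le> j \<Longrightarrow> cell a h j x \<subseteq> cell a h i x"
  unfolding cell_def using idx_mono by blast

lemma mem_cell_iff:
  assumes "0 < h"
  shows "y \<in> cell a h i x \<longleftrightarrow> (\<forall>l. corner a h i x $ l \<le> y $ l \<and> y $ l < corner a h i x $ l + h / 2 ^ i)"
proof -
  have "\<lfloor>(y $ l - a $ l) / h * 2 ^ i\<rfloor> = m \<longleftrightarrow>
      a $ l + h / 2 ^ i * of_int m \<le> y $ l \<and> y $ l < a $ l + h / 2 ^ i * of_int m + h / 2 ^ i" for l m
    using assms unfolding floor_eq_iff by (simp add: field_simps)
  then show ?thesis
    unfolding cell_def corner_def by (simp add: vec_eq_iff) (simp add: idx_def)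
qed

lemma ccell_cube: "0 < h \<Longrightarrow> cube (ccell a h i x)"
  unfolding ccell_def by (rule cube_cbox) simp

lemma emeasure_ccell: "0 < h \<Longrightarrow> emeasure lebesgue (ccell a h i (x::real^'n)) = ennreal ((h / 2 ^ i) ^ CARD('n))"
  unfolding ccell_def by (rule emeasure_cube) simp

lemma cell_subset_ccell: "0 < h \<Longrightarrow> cell a h i x \<subseteq> ccell a h i x"
  by (auto simp: mem_cell_iff ccell_def mem_cube_iff) (meson less_imp_le)

lemma null_ccell_diff_cell: "0 < h \<Longrightarrow> ccell a h i x - cell a h i x \<in> null_sets lebesgue"
proof -
  assume h: "0 < h"
  have "box (corner a h i x) (corner a h i x + (h / 2 ^ i) *\<^sub>R One) \<subseteq> cell a h i x"
    using h by (auto simp: mem_cell_iff mem_box_cart) (meson less_imp_le)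
  then have "ccell a h i x - cell a h i x \<subseteq> ccell a h i x - box (corner a h i x) (corner a h i x + (h / 2 ^ i) *\<^sub>R One)"
    by blast
  then have "negligible (ccell a h i x - cell a h i x)"
    using negligible_frontier_interval negligible_subset unfolding ccell_def by blast
  then show ?thesis by (simp add: negligible_iff_null_sets)
qed

lemma cell_sets: "0 < h \<Longrightarrow> cell a h i x \<in> sets lebesgue"
proof -
  assume h: "0 < h"
  have "cell a h i x = ccell a h i x - (ccell a h i x - cell a h i x)"
    using cell_subset_ccell[OF h] by blast
  also have "\<dots> \<in> sets lebesgue"
    by (rule sets.Diff[OF cube_sets[OF ccell_cube[OF h]] null_setsD2[OF null_ccell_diff_cell[OF h]]])
  finally show ?thesis .
qed

lemma AE_cell_ccell: "0 < h \<Longrightarrow> AE y in lebesgue. y \<in> cell a h i x \<longleftrightarrow> y \<in> ccell a h i x"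
  using AE_not_in[OF null_ccell_diff_cell, of h a i x] cell_subset_ccell[of h a i x] by (auto elim!: AE_mp)

lemma nn_cell: "0 < h \<Longrightarrow> (\<integral>\<^sup>+y\<in>cell a h i x. F y \<partial>lebesgue) = (\<integral>\<^sup>+y\<in>ccell a h i x. F y \<partial>lebesgue)"
  using AE_cell_ccell[of h a i x] by (intro nn_integral_cong_AE) (auto simp: indicator_def elim!: AE_mp)

lemma emeasure_cell: "0 < h \<Longrightarrow> emeasure lebesgue (cell a h i (x::real^'n)) = ennreal ((h / 2 ^ i) ^ CARD('n))"
  using AE_cell_ccell[of h a i x]
  by (subst emeasure_eq_AE[where B = "ccell a h i x"]) (auto intro: cube_sets ccell_cube simp: emeasure_ccell cell_sets)

lemma emeasure_cell_eq: "0 < h \<Longrightarrow> emeasure lebesgue (cell a h i x) = emeasure lebesgue (ccell a h i x)"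
  by (simp add: emeasure_cell emeasure_ccell)

lemma countable_cells: "countable {cell a h i x | i x. P i x}"
proof (rule countable_subset)
  show "{cell a h i x | i x. P i x} \<subseteq> (\<lambda>(i, m). {y. idx a h i y = m}) ` UNIV"
    by (auto simp: cell_def)
qed simp

text \<open>The cells on which a cell-invariant condition holds for the first time partition the set
  where it ever holds, so integrals can be compared cell by cell.\<close>

lemma stopping:
  fixes \<Phi> :: "nat \<Rightarrow> real^'n \<Rightarrow> bool"
  assumes h: "0 < h" and inv: "\<And>i x y. \<Phi> i x \<Longrightarrow> y \<in> cell a h i x \<Longrightarrow> \<Phi> i y"
  shows stopping_sets: "{x. \<exists>i. \<Phi> i x} \<in> sets lebesgue"
    and stopping_le: "\<And>f g. f \<in> borel_measurable lebesgue \<Longrightarrow> g \<in> borel_measurable lebesgue \<Longrightarrow>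
      (\<And>i x. \<Phi> i x \<Longrightarrow> (\<And>j. j < i \<Longrightarrow> \<not> \<Phi> j x) \<Longrightarrow>
        (\<integral>\<^sup>+y\<in>cell a h i x. f y \<partial>lebesgue) \<le> (\<integral>\<^sup>+y\<in>cell a h i x. g y \<partial>lebesgue)) \<Longrightarrow>
      (\<integral>\<^sup>+y\<in>{x. \<exists>i. \<Phi> i x}. f y \<partial>lebesgue) \<le> (\<integral>\<^sup>+y\<in>{x. \<exists>i. \<Phi> i x}. g y \<partial>lebesgue)"
proof -
  define C where "C = {cell a h i x | i x. \<Phi> i x \<and> (\<forall>j<i. \<not> \<Phi> j x)}"
  have C_count: "countable C" unfolding C_def by (rule countable_cells)
  have C_sets: "X \<in> sets lebesgue" if "X \<in> C" for X
    using that h by (auto simp: C_def cell_sets)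
  have C_U: "\<Union>C = {x. \<exists>i. \<Phi> i x}"
  proof
    show "\<Union>C \<subseteq> {x. \<exists>i. \<Phi> i x}" using inv by (fastforce simp: C_def)
    show "{x. \<exists>i. \<Phi> i x} \<subseteq> \<Union>C"
    proof
      fix x assume "x \<in> {x. \<exists>i. \<Phi> i x}"
      then have ex: "\<exists>i. \<Phi> i x" by simp
      define i where "i = (LEAST i. \<Phi> i x)"
      have "\<Phi> i x" "\<forall>j<i. \<not> \<Phi> j x"
        unfolding i_def using LeastI_ex[OF ex] not_less_Least by blast+
      then show "x \<in> \<Union>C" unfolding C_def using cell_self[of x a h i] by blast
    qed
  qed
  \<comment> \<open>The first time is constant on its own cell: an earlier hit at a point
    \<open>z\<close> would, by invariance on the coarser cell that \<open>z\<close> shares with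
    \<open>x\<close>, be a hit at \<open>x\<close>.\<close>
  have first: "\<Phi> i z \<and> (\<forall>j<i. \<not> \<Phi> j z)"
    if "\<Phi> i x" "\<forall>j<i. \<not> \<Phi> j x" "z \<in> cell a h i x" for i x z
  proof (intro conjI allI impI notI)
    show "\<Phi> i z" using inv that by blast
    fix j assume j: "j < i" "\<Phi> j z"
    have "x \<in> cell a h i z" using that(3) by (simp add: cell_def)
    then have "x \<in> cell a h j z" using cell_mono[of j i] j by auto
    then show False using inv j that by blast
  qed
  have C_disj: "disjoint_family_on (\<lambda>X. X) C"
  proof (clarsimp simp: disjoint_family_on_def C_def)
    fix i x j y assume *: "\<Phi> i x" "\<forall>k<i. \<not> \<Phi> k x" "\<Phi> j y" "\<forall>k<j. \<not> \<Phi> k y" "cell a h i x \<noteq> cell a h j y"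
    show "cell a h i x \<inter> cell a h j y = {}"
    proof (rule ccontr)
      assume "cell a h i x \<inter> cell a h j y \<noteq> {}"
      then obtain z where z: "z \<in> cell a h i x" "z \<in> cell a h j y" by blast
      have "i = j" using first[OF *(1,2) z(1)] first[OF *(3,4) z(2)] by (metis linorder_neqE_nat)
      then show False using *(5) cell_eq[OF z(1)] cell_eq[OF z(2)] by simp
    qed
  qed
  show U: "{x. \<exists>i. \<Phi> i x} \<in> sets lebesgue"
    unfolding C_U[symmetric] using C_count C_sets by (intro sets.countable_Union) auto
  fix f g :: "real^'n \<Rightarrow> ennreal"
  assume f: "f \<in> borel_measurable lebesgue" and g: "g \<in> borel_measurable lebesgue"
    and le: "\<And>i x. \<Phi> i x \<Longrightarrow> (\<And>j. j < i \<Longrightarrow> \<not> \<Phi> j x) \<Longrightarrow>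
        (\<integral>\<^sup>+y\<in>cell a h i x. f y \<partial>lebesgue) \<le> (\<integral>\<^sup>+y\<in>cell a h i x. g y \<partial>lebesgue)"
  \<comment> \<open>Reading the integral as the \<open>density\<close> measure of the union lets
    countable additivity be indexed by the cells themselves, without enumerating them.\<close>
  have sum: "(\<integral>\<^sup>+y\<in>{x. \<exists>i. \<Phi> i x}. k y \<partial>lebesgue) =
      (\<integral>\<^sup>+X. (\<integral>\<^sup>+y\<in>X. k y \<partial>lebesgue) \<partial>count_space C)" if "k \<in> borel_measurable lebesgue" for k
  proof -
    have "(\<integral>\<^sup>+y\<in>{x. \<exists>i. \<Phi> i x}. k y \<partial>lebesgue) = emeasure (density lebesgue k) (\<Union>X\<in>C. X)"
      using that U C_U by (simp add: emeasure_density)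
    also have "\<dots> = (\<integral>\<^sup>+X. emeasure (density lebesgue k) X \<partial>count_space C)"
      using C_sets C_count C_disj by (intro emeasure_UN_countable) auto
    also have "\<dots> = (\<integral>\<^sup>+X. (\<integral>\<^sup>+y\<in>X. k y \<partial>lebesgue) \<partial>count_space C)"
      using that C_sets by (intro nn_integral_cong) (simp add: emeasure_density)
    finally show ?thesis .
  qed
  show "(\<integral>\<^sup>+y\<in>{x. \<exists>i. \<Phi> i x}. f y \<partial>lebesgue) \<le> (\<integral>\<^sup>+y\<in>{x. \<exists>i. \<Phi> i x}. g y \<partial>lebesgue)"
    unfolding sum[OF f] sum[OF g]
  proof (rule nn_integral_mono)
    fix X assume "X \<in> space (count_space C)"
    then obtain i x where X: "X = cell a h i x" "\<Phi> i x" "\<forall>j<i. \<not> \<Phi> j x"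
      by (auto simp: C_def)
    show "(\<integral>\<^sup>+y\<in>X. f y \<partial>lebesgue) \<le> (\<integral>\<^sup>+y\<in>X. g y \<partial>lebesgue)"
      unfolding X(1) by (rule le) (use X in auto)
  qed
qed

section \<open>Mean oscillation and differentiation along cells\<close>

lemma loc_integrable_cube: "loc_integrable b \<Longrightarrow> cube Q \<Longrightarrow> set_integrable lebesgue Q b"
  unfolding loc_integrable_def cube_def using compact_cbox by blast

lemma loc_integrable_measurable:
  assumes "loc_integrable (b :: real^'n \<Rightarrow> real)"
  shows "b \<in> borel_measurable lebesgue"
proof -
  define u where "u n x = indicator (cball 0 (real n)) x *\<^sub>R b x" for n :: nat and x
  have "u n \<in> borel_measurable lebesgue" for n
    using assms compact_cball unfolding loc_integrable_def set_integrable_def u_def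
    by (blast dest: borel_measurable_integrable)
  moreover have "(\<lambda>n. u n x) \<longlonglongrightarrow> b x" for x
  proof (rule tendsto_eventually)
    obtain N :: nat where "norm x \<le> real N" using real_arch_simple by blast
    then have "u n x = b x" if "N \<le> n" for n using that by (auto simp: u_def indicator_def)
    then show "\<forall>\<^sub>F n in sequentially. u n x = b x" by (auto simp: eventually_sequentially)
  qed
  ultimately show ?thesis by (rule borel_measurable_LIMSEQ_real[rotated])
qed

lemma cavg_diff_const:
  assumes "loc_integrable b" "cube Q"
  shows "integrable lebesgue (\<lambda>y. indicator Q y * (b y - c))"
    "(LINT y|lebesgue. indicator Q y * (b y - c)) = (cavg Q b - c) * measure lebesgue Q"
proof -
  have 1: "integrable lebesgue (\<lambda>y. indicator Q y * b y)"
    using loc_integrable_cube[OF assms] by (simp add: set_integrable_def)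
  have 2: "integrable lebesgue (\<lambda>y. indicator Q y * c)"
    using cube_emeasure(4)[OF assms(2)] cube_sets[OF assms(2)]
    by (intro integrable_mult_left integrable_real_indicator) (auto simp: less_top)
  show "integrable lebesgue (\<lambda>y. indicator Q y * (b y - c))"
    using Bochner_Integration.integrable_diff[OF 1 2] by (simp add: algebra_simps)
  have "(LINT y|lebesgue. indicator Q y * (b y - c)) =
      (LINT y|lebesgue. indicator Q y * b y) - (LINT y|lebesgue. indicator Q y * c)"
    using Bochner_Integration.integral_diff[OF 1 2] by (simp add: algebra_simps)
  also have "\<dots> = cavg Q b * measure lebesgue Q - measure lebesgue Q * c"
    using cube_emeasure(2)[OF assms(2)] by (simp add: cavg_def set_lebesgue_integral_def)
  finally show "(LINT y|lebesgue. indicator Q y * (b y - c)) = (cavg Q b - c) * measure lebesgue Q"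
    by (simp add: algebra_simps)
qed

lemma nn_abs_eq:
  assumes "loc_integrable b" "cube Q"
  shows "(\<integral>\<^sup>+y\<in>Q. ennreal \<bar>b y - c\<bar> \<partial>lebesgue) = ennreal (LINT y:Q|lebesgue. \<bar>b y - c\<bar>)"
proof -
  have "integrable lebesgue (\<lambda>y. \<bar>indicator Q y * (b y - c)\<bar>)"
    using cavg_diff_const(1)[OF assms] by (rule integrable_abs)
  then have int: "integrable lebesgue (\<lambda>y. indicator Q y * \<bar>b y - c\<bar>)"
    by (simp add: abs_mult)
  have "(\<integral>\<^sup>+y\<in>Q. ennreal \<bar>b y - c\<bar> \<partial>lebesgue) = (\<integral>\<^sup>+y. ennreal (indicator Q y * \<bar>b y - c\<bar>) \<partial>lebesgue)"
    by (intro nn_integral_cong) (auto simp: indicator_def)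
  also have "\<dots> = ennreal (LINT y|lebesgue. indicator Q y * \<bar>b y - c\<bar>)"
    using int by (intro nn_integral_eq_integral) auto
  finally show ?thesis by (simp add: set_lebesgue_integral_def)
qed

lemma cavg_dev:
  assumes "loc_integrable b" "cube Q"
  shows "ennreal \<bar>cavg Q b - c\<bar> * emeasure lebesgue Q \<le> (\<integral>\<^sup>+y\<in>Q. ennreal \<bar>b y - c\<bar> \<partial>lebesgue)"
proof -
  have "\<bar>cavg Q b - c\<bar> * measure lebesgue Q = \<bar>LINT y|lebesgue. indicator Q y * (b y - c)\<bar>"
    by (simp add: cavg_diff_const(2)[OF assms] abs_mult)
  also have "\<dots> \<le> (LINT y|lebesgue. \<bar>indicator Q y * (b y - c)\<bar>)"
    by (rule integral_abs_bound)
  finally have "ennreal (\<bar>cavg Q b - c\<bar> * measure lebesgue Q) \<le> ennreal (LINT y:Q|lebesgue. \<bar>b y - c\<bar>)"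
    by (intro ennreal_leI) (simp add: abs_mult set_lebesgue_integral_def)
  then show ?thesis
    unfolding nn_abs_eq[OF assms] cube_emeasure(1)[OF assms(2)] by (simp add: ennreal_mult)
qed

text \<open>The integral of \<open>b - p\<close> over \<open>Q\<close> is nonpositive, so its
  positive part has no more mass than its negative part. With \<open>p\<close> the mean of
  \<open>b\<close>, control of the part below the mean is control of the whole oscillation.\<close>

lemma cavg_le_parts:
  assumes "loc_integrable b" "cube Q" "cavg Q b \<le> p"
  shows "(\<integral>\<^sup>+y\<in>Q. ennreal (b y - p) \<partial>lebesgue) \<le> (\<integral>\<^sup>+y\<in>Q. ennreal (p - b y) \<partial>lebesgue)"
proof -
  let ?g = "\<lambda>y. indicator Q y * (b y - p)"
  have int: "integrable lebesgue ?g" by (rule cavg_diff_const(1)[OF assms(1,2)])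
  have 1: "(\<integral>\<^sup>+y\<in>Q. ennreal (b y - p) \<partial>lebesgue) = (\<integral>\<^sup>+y. ennreal (?g y) \<partial>lebesgue)"
    by (intro nn_integral_cong) (auto simp: indicator_def)
  have 2: "(\<integral>\<^sup>+y\<in>Q. ennreal (p - b y) \<partial>lebesgue) = (\<integral>\<^sup>+y. ennreal (- ?g y) \<partial>lebesgue)"
    by (intro nn_integral_cong) (auto simp: indicator_def)
  have "(LINT y|lebesgue. ?g y) \<le> 0"
    unfolding cavg_diff_const(2)[OF assms(1,2)] using assms(3) cube_emeasure(2)[OF assms(2)]
    by (intro mult_nonpos_nonneg) auto
  then have "enn2real (\<integral>\<^sup>+y. ennreal (?g y) \<partial>lebesgue) \<le> enn2real (\<integral>\<^sup>+y. ennreal (- ?g y) \<partial>lebesgue)"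
    unfolding real_lebesgue_integral_def[OF int] by simp
  moreover have "(\<integral>\<^sup>+y. ennreal (?g y) \<partial>lebesgue) \<noteq> top" "(\<integral>\<^sup>+y. ennreal (- ?g y) \<partial>lebesgue) \<noteq> top"
    using int by (auto simp: real_integrable_def infinity_ennreal_def)
  ultimately show ?thesis
    unfolding 1 2 by (cases "\<integral>\<^sup>+y. ennreal (?g y) \<partial>lebesgue"; cases "\<integral>\<^sup>+y. ennreal (- ?g y) \<partial>lebesgue")
      (auto intro: ennreal_leI)
qed

definition bmo_bd :: "(real^'n \<Rightarrow> real) \<Rightarrow> real \<Rightarrow> bool" where
  "bmo_bd b B \<longleftrightarrow> loc_integrable b \<and> 0 < B \<and>
     (\<forall>Q. cube Q \<longrightarrow> (\<integral>\<^sup>+y\<in>Q. ennreal \<bar>b y - cavg Q b\<bar> \<partial>lebesgue) \<le> ennreal B * emeasure lebesgue Q)"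

lemma BMO_iff: "b \<in> BMO \<longleftrightarrow> (\<exists>B. bmo_bd b B)"
proof -
  have *: "(\<integral>\<^sup>+y\<in>Q. ennreal \<bar>b y - cavg Q b\<bar> \<partial>lebesgue) \<le> ennreal C * emeasure lebesgue Q \<longleftrightarrow>
     (LINT y:Q|lebesgue. \<bar>b y - cavg Q b\<bar>) / measure lebesgue Q \<le> C"
    if "loc_integrable b" "cube Q" "0 \<le> C" for Q C
    using cube_emeasure(2)[OF that(2)] that(3)
    unfolding nn_abs_eq[OF that(1,2)] cube_emeasure(1)[OF that(2)]
    by (simp add: pos_divide_le_eq flip: ennreal_mult)
  show ?thesis
  proof
    assume "b \<in> BMO"
    then obtain C where b: "loc_integrable b"
      and C: "\<And>Q. cube Q \<Longrightarrow> (LINT y:Q|lebesgue. \<bar>b y - cavg Q b\<bar>) / measure lebesgue Q \<le> C"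
      by (auto simp: BMO_def)
    have "bmo_bd b (max C 1)"
      unfolding bmo_bd_def using b *[OF b, of _ "max C 1"] order_trans[OF C max.cobounded1] by auto
    then show "\<exists>B. bmo_bd b B" ..
  next
    assume "\<exists>B. bmo_bd b B"
    then show "b \<in> BMO" unfolding bmo_bd_def BMO_def using * by fastforce
  qed
qed

lemma cavg_nested:
  assumes "bmo_bd b B" "cube P" "cube Q" "P \<subseteq> Q" "measure lebesgue Q \<le> k * measure lebesgue P"
  shows "\<bar>cavg P b - cavg Q b\<bar> \<le> k * B"
proof -
  have b: "loc_integrable b" "0 < B" using assms(1) by (auto simp: bmo_bd_def)
  have "ennreal \<bar>cavg P b - cavg Q b\<bar> * emeasure lebesgue P \<le> (\<integral>\<^sup>+y\<in>P. ennreal \<bar>b y - cavg Q b\<bar> \<partial>lebesgue)"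
    by (rule cavg_dev[OF b(1) assms(2)])
  also have "\<dots> \<le> (\<integral>\<^sup>+y\<in>Q. ennreal \<bar>b y - cavg Q b\<bar> \<partial>lebesgue)"
    using assms(4) by (intro nn_integral_mono mult_left_mono) (auto simp: indicator_def)
  also have "\<dots> \<le> ennreal B * emeasure lebesgue Q" using assms(1,3) by (simp add: bmo_bd_def)
  finally have "\<bar>cavg P b - cavg Q b\<bar> * measure lebesgue P \<le> B * measure lebesgue Q"
    using b(2) unfolding cube_emeasure(1)[OF assms(2)] cube_emeasure(1)[OF assms(3)]
    by (simp flip: ennreal_mult)
  also have "\<dots> \<le> B * (k * measure lebesgue P)" using assms(5) b(2) by (intro mult_left_mono) auto
  finally have "\<bar>cavg P b - cavg Q b\<bar> * measure lebesgue P \<le> (k * B) * measure lebesgue P" by (simp add: mult_ac)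
  then show ?thesis using cube_emeasure(2)[OF assms(2)] by simp
qed

section \<open>Lebesgue differentiation along dyadic cells\<close>

lemma cell_in_open:
  assumes h: "0 < h" and "open S" "x \<in> S"
  shows "\<exists>i\<ge>i0. cell a h i (x::real^'n) \<subseteq> S"
proof -
  obtain r where r: "0 < r" "ball x r \<subseteq> S" using assms(2,3) open_contains_ball by blast
  obtain m where m: "(1/2) ^ m < r / (real CARD('n) * h)"
    using real_arch_pow_inv[of "r / (real CARD('n) * h)" "1/2"] r h by auto
  define i where "i = max i0 m"
  have "(1/2::real) ^ i \<le> (1/2) ^ m" by (rule power_decreasing) (auto simp: i_def)
  then have "real CARD('n) * h * (1/2) ^ i \<le> real CARD('n) * h * (1/2) ^ m"
    using h by (intro mult_left_mono) auto
  also have "\<dots> < r" using m h by (simp add: pos_less_divide_eq mult_ac)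
  finally have i: "real CARD('n) * (h / 2 ^ i) < r" by (simp add: power_one_over field_simps)
  have "y \<in> ball x r" if y: "y \<in> cell a h i x" for y
  proof -
    have "\<bar>(x - y) $ l\<bar> \<le> h / 2 ^ i" for l
      using y cell_self[of x a h i] unfolding mem_cell_iff[OF h] by (auto simp: abs_le_iff) (smt (verit))+
    then have "norm (x - y) \<le> real CARD('n) * (h / 2 ^ i)"
      using sum_bounded_above[of UNIV "\<lambda>l. \<bar>(x - y) $ l\<bar>"] norm_le_l1_cart[of "x - y"] by fastforce
    then show ?thesis using i by (simp add: dist_norm)
  qed
  then show ?thesis using r by (intro exI[of _ i]) (auto simp: i_def)
qed

text \<open>A covering argument. Inside an open set containing the bad set \<open>E\<close>, the
  first cells with mean at most \<open>p\<close> cover \<open>E\<close>, and on each of them the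
  excess of \<open>b\<close> above \<open>p\<close> is outweighed by the deficit below
  \<open>p\<close>. The excess is at least \<open>q - p\<close> on \<open>E\<close>, while the
  deficit vanishes on \<open>E\<close>. It is thus carried by the rest of the open set, whose
  measure can be made arbitrarily small.\<close>

lemma differentiation_null:
  fixes b :: "real^'n \<Rightarrow> real"
  assumes h: "0 < h" and b: "loc_integrable b" and pq: "p < q"
  shows "{x. q \<le> b x \<and> (\<forall>i\<ge>i0. cavg (ccell a h i x) b \<le> p)} \<inter> ball 0 N \<in> null_sets lebesgue"
proof -
  define G where "G = ball (0::real^'n) N"
  define E where "E = {x. q \<le> b x \<and> (\<forall>i\<ge>i0. cavg (ccell a h i x) b \<le> p)} \<inter> G"
  note [measurable] = loc_integrable_measurable[OF b]
  have lev: "{x. cavg (ccell a h i x) b \<le> p} \<in> sets lebesgue" for i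
  proof -
    have "{x. \<exists>j. j = i \<and> cavg (ccell a h j x) b \<le> p} \<in> sets lebesgue"
      by (rule stopping_sets[OF h, where a = a]) (auto dest: ccell_eq)
    then show ?thesis by simp
  qed
  have lev': "{x \<in> space lebesgue. q \<le> b x} \<in> sets lebesgue" by measurable
  have "E = {x \<in> space lebesgue. q \<le> b x} \<inter> (\<Inter>i\<in>{i0..}. {x. cavg (ccell a h i x) b \<le> p}) \<inter> G"
    by (auto simp: E_def)
  also have "\<dots> \<in> sets lebesgue"
    using lev by (intro sets.Int[OF sets.Int[OF lev']] sets.countable_INT') (auto simp: G_def)
  finally have E [measurable]: "E \<in> sets lebesgue" .
  have [measurable]: "G \<in> sets lebesgue" by (simp add: G_def)
  define g where "g y = ennreal (p - b y) * indicator G y" for y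
  have g [measurable]: "g \<in> borel_measurable lebesgue" unfolding g_def[abs_def] by measurable
  \<comment> \<open>The deficit as a measure. Truncation to the ball \<open>G\<close> makes it
    finite, which the continuity from above in \<open>INF_emeasure_decseq\<close> requires.\<close>
  define \<nu> where "\<nu> = density lebesgue g"
  have \<nu>fin: "emeasure \<nu> X \<noteq> top" for X
  proof -
    have "compact (cball (0::real^'n) N)" by simp
    then have "set_integrable lebesgue (cball 0 N) b" using b by (simp add: loc_integrable_def)
    moreover have "set_integrable lebesgue (cball (0::real^'n) N) (\<lambda>y. p)"
      unfolding set_integrable_def
      by (intro integrable_scaleR_left integrable_real_indicator) (use emeasure_bounded_finite[of "cball (0::real^'n) N"] in \<open>auto simp: emeasure_completion\<close>)
    ultimately have "set_integrable lebesgue (cball 0 N) (\<lambda>y. p - b y)" by (intro set_integral_diff)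
    then have int: "integrable lebesgue (\<lambda>y. indicator (cball 0 N) y * (p - b y))" by (simp add: set_integrable_def)
    have "emeasure \<nu> X \<le> emeasure \<nu> (space \<nu>)" by (rule emeasure_space)
    also have "\<dots> = (\<integral>\<^sup>+y. g y \<partial>lebesgue)" by (simp add: \<nu>_def emeasure_density)
    also have "\<dots> \<le> (\<integral>\<^sup>+y. ennreal (indicator (cball 0 N) y * (p - b y)) \<partial>lebesgue)"
      by (intro nn_integral_mono) (auto simp: g_def G_def indicator_def)
    also have "\<dots> < top" using int by (auto simp: real_integrable_def infinity_ennreal_def less_top)
    finally show ?thesis by (simp add: less_top)
  qed
  have "\<exists>T. open T \<and> E \<subseteq> T \<and> emeasure lebesgue (T - E) < ennreal (1 / real (Suc m))" for m
    using sets_lebesgue_outer_open[OF E, of "1 / real (Suc m)"] by (metis zero_less_divide_1_iff of_nat_0_less_iff zero_less_Suc)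
  then obtain T where T: "\<And>m. open (T m)" "\<And>m. E \<subseteq> T m" "\<And>m. emeasure lebesgue (T m - E) < ennreal (1 / real (Suc m))"
    by metis
  \<comment> \<open>Intersecting the outer approximations makes them decrease; intersecting with
    \<open>G\<close> keeps the stopping cells where \<open>g\<close> equals the deficit.\<close>
  define S where "S m = G \<inter> (\<Inter>k\<le>m. T k)" for m
  have S_open: "open (S m)" for m unfolding S_def G_def using T(1) by (intro open_Int open_INT) auto
  have ES: "E \<subseteq> S m" for m using T(2) by (auto simp: S_def E_def)
  have SG: "S m \<subseteq> G" for m by (auto simp: S_def)
  have S_sets [measurable]: "S m \<in> sets lebesgue" for m using S_open by auto
  have key: "ennreal (q - p) * emeasure lebesgue E \<le> emeasure \<nu> (S m - E)" for m
  proof -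
    define \<Phi> where "\<Phi> i x \<longleftrightarrow> i0 \<le> i \<and> cell a h i x \<subseteq> S m \<and> cavg (ccell a h i x) b \<le> p" for i x
    define U where "U = {x. \<exists>i. \<Phi> i x}"
    have inv: "\<Phi> i y" if "\<Phi> i x" "y \<in> cell a h i x" for i x y
      using that by (simp add: \<Phi>_def cell_eq ccell_eq)
    have U [measurable]: "U \<in> sets lebesgue" unfolding U_def by (rule stopping_sets[OF h inv])
    have "E \<subseteq> U"
    proof
      fix x assume "x \<in> E"
      then show "x \<in> U" using cell_in_open[OF h S_open, of x m i0 a] ES[of m] by (auto simp: U_def \<Phi>_def E_def)
    qed
    have US: "U \<subseteq> S m" using cell_self by (fastforce simp: U_def \<Phi>_def)
    have "ennreal (q - p) * emeasure lebesgue E = (\<integral>\<^sup>+y\<in>E. ennreal (q - p) \<partial>lebesgue)"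
      by (simp add: nn_integral_cmult_indicator)
    also have "\<dots> \<le> (\<integral>\<^sup>+y\<in>U. ennreal (b y - p) \<partial>lebesgue)"
      using \<open>E \<subseteq> U\<close> by (intro nn_integral_mono) (auto simp: indicator_def E_def intro!: ennreal_leI)
    also have "\<dots> \<le> (\<integral>\<^sup>+y\<in>U. ennreal (p - b y) \<partial>lebesgue)"
      unfolding U_def
      by (rule stopping_le[OF h inv]) (auto simp: nn_cell[OF h] \<Phi>_def intro!: cavg_le_parts b ccell_cube h)
    also have "\<dots> \<le> (\<integral>\<^sup>+y. g y * indicator (S m - E) y \<partial>lebesgue)"
    proof (intro nn_integral_mono)
      fix y
      have "y \<in> E \<Longrightarrow> ennreal (p - b y) = 0" using pq by (auto simp: E_def ennreal_neg)
      then show "ennreal (p - b y) * indicator U y \<le> g y * indicator (S m - E) y"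
        using US SG[of m] by (auto simp: indicator_def g_def)
    qed
    also have "\<dots> = emeasure \<nu> (S m - E)" by (simp add: \<nu>_def emeasure_density)
    finally show ?thesis .
  qed
  have "(INF m. emeasure \<nu> (S m - E)) = emeasure \<nu> (\<Inter>m. S m - E)"
  proof (rule INF_emeasure_decseq)
    show "decseq (\<lambda>m. S m - E)" by (auto simp: decseq_def S_def)
  qed (use \<nu>fin in \<open>auto simp: \<nu>_def infinity_ennreal_def\<close>)
  also have "\<dots> = 0"
  proof -
    have eps: "emeasure lebesgue (\<Inter>m. S m - E) \<le> ennreal e" if "0 < e" for e
    proof -
      obtain m where m: "1 / real (Suc m) < e" using \<open>0 < e\<close> by (meson nat_approx_posE)
      have "emeasure lebesgue (\<Inter>m. S m - E) \<le> emeasure lebesgue (T m - E)"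
        using T(1) by (intro emeasure_mono) (auto simp: S_def)
      also have "\<dots> \<le> ennreal e" using T(3)[of m] m by (meson ennreal_leI less_imp_le order_trans)
      finally show ?thesis .
    qed
    have "emeasure lebesgue (\<Inter>m. S m - E) \<le> 0"
    proof (rule ennreal_le_epsilon)
      fix e :: real assume "0 < e"
      then show "emeasure lebesgue (\<Inter>m. S m - E) \<le> 0 + ennreal e" using eps by (simp only: add_0)
    qed
    moreover have "(\<Inter>m. S m - E) \<in> sets lebesgue"
      by (rule sets.countable_INT') auto
    ultimately have null: "(\<Inter>m. S m - E) \<in> null_sets lebesgue" by (intro null_setsI) auto
    have "emeasure \<nu> (\<Inter>m. S m - E) = (\<integral>\<^sup>+y\<in>(\<Inter>m. S m - E). g y \<partial>lebesgue)"
      unfolding \<nu>_def by (rule emeasure_density[OF g null_setsD2[OF null]])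
    also have "\<dots> = (\<integral>\<^sup>+y. 0 \<partial>(lebesgue :: (real^'n) measure))"
    proof (rule nn_integral_cong_AE)
      show "AE y in lebesgue. g y * indicator (\<Inter>m. S m - E) y = 0"
        using AE_not_in[OF null] by (rule AE_mp) (auto simp: indicator_def)
    qed
    finally show ?thesis by simp
  qed
  finally have inf0: "(INF m. emeasure \<nu> (S m - E)) = 0" .
  have "ennreal (q - p) * emeasure lebesgue E \<le> (INF m. emeasure \<nu> (S m - E))"
    by (intro INF_greatest key)
  then have "ennreal (q - p) * emeasure lebesgue E = 0" unfolding inf0 by simp
  then have "emeasure lebesgue E = 0" using pq by (auto simp: ennreal_eq_0_iff)
  then have "E \<in> null_sets lebesgue" using E by (rule null_setsI)
  then show ?thesis unfolding E_def G_def .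
qed

text \<open>Not convergence, only infinitely many good levels; this is enough, since the stopping
  argument bounds the averages at every level. Two rationals between \<open>b x - e\<close> and
  \<open>b x\<close> reduce the claim to countably many null sets.\<close>

lemma cavg_frequently_gt:
  fixes b :: "real^'n \<Rightarrow> real"
  assumes h: "0 < h" and b: "loc_integrable b"
  shows "AE x in lebesgue. \<forall>i0. \<forall>e>0. \<exists>i\<ge>i0. b x - e < cavg (ccell a h i x) b"
proof -
  have "AE x in lebesgue. \<forall>p q. \<forall>i0 N :: nat. real_of_rat p < real_of_rat q \<longrightarrow>
      x \<notin> {x. real_of_rat q \<le> b x \<and> (\<forall>i\<ge>i0. cavg (ccell a h i x) b \<le> real_of_rat p)} \<inter> ball 0 (real N)"
    unfolding AE_all_countable
    by (intro allI AE_impI impI AE_not_in differentiation_null h b)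
  then show ?thesis
  proof (rule AE_mp, intro AE_I2 impI allI)
    fix x i0 and e :: real
    assume *: "\<forall>p q. \<forall>i0 N :: nat. real_of_rat p < real_of_rat q \<longrightarrow>
      x \<notin> {x. real_of_rat q \<le> b x \<and> (\<forall>i\<ge>i0. cavg (ccell a h i x) b \<le> real_of_rat p)} \<inter> ball 0 (real N)"
      and e: "0 < e"
    obtain q where q: "b x - e / 2 < real_of_rat q" "real_of_rat q < b x" using of_rat_dense[of "b x - e/2" "b x"] e by auto
    obtain p where p: "b x - e < real_of_rat p" "real_of_rat p < b x - e / 2" using of_rat_dense[of "b x - e" "b x - e/2"] e by auto
    obtain N :: nat where "norm x < real N" using reals_Archimedean2 by blast
    then have "\<not> (\<forall>i\<ge>i0. cavg (ccell a h i x) b \<le> real_of_rat p)" using *[rule_format, of p q i0 N] p q by auto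
    then show "\<exists>i\<ge>i0. b x - e < cavg (ccell a h i x) b" using p(1) by force
  qed
qed

lemma cavg_uminus: "cavg Q (\<lambda>x. - b x) = - cavg Q b"
  by (simp add: cavg_def set_lebesgue_integral_def)

lemma cavg_frequently_lt:
  fixes b :: "real^'n \<Rightarrow> real"
  assumes h: "0 < h" and b: "loc_integrable b"
  shows "AE x in lebesgue. \<forall>i0. \<forall>e>0. \<exists>i\<ge>i0. cavg (ccell a h i x) b < b x + e"
proof -
  have "loc_integrable (\<lambda>x. - b x)"
    using b by (auto simp: loc_integrable_def set_integrable_def)
  from cavg_frequently_gt[OF h this, of a] show ?thesis
    by (rule AE_mp) (auto simp: cavg_uminus algebra_simps)
qed

section \<open>The John--Nirenberg stopping sets\<close>

definition first_at :: "(nat \<Rightarrow> 'a \<Rightarrow> bool) \<Rightarrow> nat \<Rightarrow> 'a \<Rightarrow> bool" where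
  "first_at \<Psi> i x \<longleftrightarrow> \<Psi> i x \<and> (\<forall>j<i. \<not> \<Psi> j x)"

lemma first_at_unique: "first_at \<Psi> i x \<Longrightarrow> first_at \<Psi> j x \<Longrightarrow> i = j"
  unfolding first_at_def by (metis linorder_neqE_nat)

lemma first_at_exists: "\<Psi> i x \<Longrightarrow> \<exists>i0\<le>i. first_at \<Psi> i0 x"
  unfolding first_at_def
  by (intro exI[of _ "LEAST i. \<Psi> i x"] conjI allI impI) (auto intro: LeastI Least_le dest: not_less_Least)

definition cell_inv :: "real^'n \<Rightarrow> real \<Rightarrow> (nat \<Rightarrow> real^'n \<Rightarrow> bool) \<Rightarrow> bool" where
  "cell_inv a h \<Psi> \<longleftrightarrow> (\<forall>i x y. \<Psi> i x \<longrightarrow> y \<in> cell a h i x \<longrightarrow> \<Psi> i y)"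

lemma cell_invD: "cell_inv a h \<Psi> \<Longrightarrow> \<Psi> i x \<Longrightarrow> y \<in> cell a h i x \<Longrightarrow> \<Psi> i y"
  by (auto simp: cell_inv_def)

lemma cell_sym: "y \<in> cell a h i x \<Longrightarrow> x \<in> cell a h i y"
  by (simp add: cell_def)

lemma cell_down: "y \<in> cell a h i x \<Longrightarrow> j \<le> i \<Longrightarrow> y \<in> cell a h j x"
  using cell_mono by blast

lemma first_at_cell:
  assumes "cell_inv a h \<Psi>" "first_at \<Psi> i0 x" "i0 \<le> i" "y \<in> cell a h i x"
  shows "first_at \<Psi> i0 y"
  unfolding first_at_def
proof (intro conjI allI impI notI)
  show "\<Psi> i0 y" using assms by (auto simp: first_at_def intro: cell_invD cell_down)
  fix j assume "j < i0" "\<Psi> j y"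
  moreover have "x \<in> cell a h j y"
    by (rule cell_sym[OF cell_down[OF assms(4)]]) (use \<open>j < i0\<close> assms(3) in simp)
  ultimately have "\<Psi> j x" using cell_invD[OF assms(1)] by blast
  then show False using \<open>j < i0\<close> assms(2) by (auto simp: first_at_def)
qed

text \<open>Generation \<open>k\<close> of the stopping cells. The drift is measured from the first
  cell that satisfies \<open>\<Psi>\<close>, not from the previous generation, so the generations
  are nested without any recursion. The choice of \<open>\<Psi>\<close> decides where the argument
  starts.\<close>

definition stop_at :: "(real^'n \<Rightarrow> real) \<Rightarrow> real^'n \<Rightarrow> real \<Rightarrow> real \<Rightarrow> (nat \<Rightarrow> real^'n \<Rightarrow> bool) \<Rightarrow> nat \<Rightarrow> nat \<Rightarrow> real^'n \<Rightarrow> bool" where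
  "stop_at b a h c \<Psi> k i x \<longleftrightarrow> (\<exists>i0\<le>i. first_at \<Psi> i0 x \<and>
      real k * c \<le> \<bar>cavg (ccell a h i x) b - cavg (ccell a h i0 x) b\<bar>)"

lemma stop_at_inv:
  assumes "cell_inv a h \<Psi>"
  shows "cell_inv a h (stop_at b a h c \<Psi> k)"
  unfolding cell_inv_def
proof (intro allI impI)
  fix i x y assume st: "stop_at b a h c \<Psi> k i x" and y: "y \<in> cell a h i x"
  then obtain i0 where i0: "i0 \<le> i" "first_at \<Psi> i0 x"
    "real k * c \<le> \<bar>cavg (ccell a h i x) b - cavg (ccell a h i0 x) b\<bar>" by (auto simp: stop_at_def)
  have "ccell a h i y = ccell a h i x" "ccell a h i0 y = ccell a h i0 x"
    by (rule ccell_eq[OF y] ccell_eq[OF cell_down[OF y i0(1)]])+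
  then show "stop_at b a h c \<Psi> k i y"
    unfolding stop_at_def using i0 first_at_cell[OF assms i0(2,1) y] by auto
qed

lemma stop_at_0: "first_at \<Psi> i x \<Longrightarrow> stop_at b a h c \<Psi> 0 i x"
  by (auto simp: stop_at_def)

lemma stop_at_Suc: "0 \<le> c \<Longrightarrow> stop_at b a h c \<Psi> (Suc k) i x \<Longrightarrow> stop_at b a h c \<Psi> k i x"
  by (auto simp: stop_at_def distrib_right intro: order_trans)

definition stop_set :: "(real^'n \<Rightarrow> real) \<Rightarrow> real^'n \<Rightarrow> real \<Rightarrow> real \<Rightarrow> (nat \<Rightarrow> real^'n \<Rightarrow> bool) \<Rightarrow> nat \<Rightarrow> (real^'n) set" where
  "stop_set b a h c \<Psi> k = {x. \<exists>i. stop_at b a h c \<Psi> k i x}"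

lemma stop_set_sets:
  assumes "0 < h" "cell_inv a h \<Psi>"
  shows "stop_set b a h c \<Psi> k \<in> sets lebesgue"
  unfolding stop_set_def by (rule stopping_sets[OF assms(1)]) (rule cell_invD[OF stop_at_inv[OF assms(2)]])

lemma stop_set_Suc: "0 \<le> c \<Longrightarrow> stop_set b a h c \<Psi> (Suc k) \<subseteq> stop_set b a h c \<Psi> k"
  using stop_at_Suc by (fastforce simp: stop_set_def)

lemma measure_ccell: "0 < h \<Longrightarrow> measure lebesgue (ccell a h i (x::real^'n)) = (h / 2 ^ i) ^ CARD('n)"
  by (simp add: measure_def emeasure_ccell)

lemma ccell_mono:
  assumes "0 < h"
  shows "ccell a h (Suc i) x \<subseteq> ccell a h i (x::real^'n)"
proof -
  have *: "corner a h i x $ l \<le> corner a h (Suc i) x $ l \<and>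
      corner a h (Suc i) x $ l + h / 2 ^ Suc i \<le> corner a h i x $ l + h / 2 ^ i" for l
  proof -
    define z where "z = (x $ l - a $ l) / h * 2 ^ i"
    have "(x $ l - a $ l) / h * 2 ^ Suc i = 2 * z" by (simp add: z_def)
    then have "corner a h (Suc i) x $ l = a $ l + h / 2 ^ Suc i * of_int \<lfloor>2 * z\<rfloor>"
      unfolding corner_def idx_def by (simp only: vec_lambda_beta)
    then have **: "corner a h i x $ l = a $ l + h / 2 ^ i * of_int \<lfloor>z\<rfloor>"
      "corner a h (Suc i) x $ l = a $ l + h / 2 ^ i * (of_int \<lfloor>2 * z\<rfloor> / 2)"
      unfolding corner_def idx_def z_def by (simp_all only: vec_lambda_beta) simp
    \<comment> \<open>In each coordinate the child is the left or the right half of its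
      parent.\<close>
    have f: "2 * \<lfloor>z\<rfloor> \<le> \<lfloor>2 * z\<rfloor>" "\<lfloor>2 * z\<rfloor> \<le> 2 * \<lfloor>z\<rfloor> + 1" by linarith+
    have "real_of_int (2 * \<lfloor>z\<rfloor>) \<le> real_of_int \<lfloor>2 * z\<rfloor>" using f(1) by (rule of_int_le_iff[THEN iffD2])
    then have 1: "real_of_int \<lfloor>z\<rfloor> \<le> of_int \<lfloor>2 * z\<rfloor> / 2" by simp
    have "real_of_int \<lfloor>2 * z\<rfloor> \<le> real_of_int (2 * \<lfloor>z\<rfloor> + 1)" using f(2) by (rule of_int_le_iff[THEN iffD2])
    then have 2: "of_int \<lfloor>2 * z\<rfloor> / 2 + 1 / 2 \<le> real_of_int \<lfloor>z\<rfloor> + 1" by simp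
    have pos: "0 \<le> h / 2 ^ i" using assms by simp
    have "h / 2 ^ i * (of_int \<lfloor>2 * z\<rfloor> / 2 + 1 / 2) \<le> h / 2 ^ i * (real_of_int \<lfloor>z\<rfloor> + 1)"
      by (rule mult_left_mono[OF 2 pos])
    then show ?thesis
      unfolding ** using mult_left_mono[OF 1 pos] by (simp add: algebra_simps add_divide_distrib)
  qed
  show ?thesis
  proof
    fix y assume "y \<in> ccell a h (Suc i) x"
    then have y: "corner a h (Suc i) x $ l \<le> y $ l \<and> y $ l \<le> corner a h (Suc i) x $ l + h / 2 ^ Suc i" for l
      unfolding ccell_def mem_cube_iff by blast
    show "y \<in> ccell a h i x"
      unfolding ccell_def mem_cube_iff using y * by (meson order_trans)
  qed
qed

lemma cavg_cell_step:
  assumes "bmo_bd b B" "0 < h"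
  shows "\<bar>cavg (ccell a h (Suc i) x) b - cavg (ccell a h i (x::real^'n)) b\<bar> \<le> 2 ^ CARD('n) * B"
proof (rule cavg_nested[OF assms(1)])
  show "measure lebesgue (ccell a h i x) \<le> 2 ^ CARD('n) * measure lebesgue (ccell a h (Suc i) x)"
    using assms(2) by (simp add: measure_ccell flip: power_mult_distrib)
qed (use assms(2) in \<open>auto intro: ccell_cube ccell_mono[THEN subsetD]\<close>)

text \<open>Chebyshev's inequality along stopping cells: on each first cell whose mean has drifted
  by \<open>2 * B\<close>, the deviation from the starting mean integrates to at least
  \<open>2 * B\<close> times the volume, while over the whole starting cell it integrates to at most
  \<open>B\<close> times the volume.\<close>

lemma weak_type_oscillation:
  assumes b: "bmo_bd b B" and h: "0 < h"
  shows "2 * emeasure lebesgue {y \<in> cell a h i1 x. \<exists>i\<ge>i1. 2 * B \<le> \<bar>cavg (ccell a h i y) b - cavg (ccell a h i1 x) b\<bar>}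
    \<le> emeasure lebesgue (cell a h i1 x)"
proof -
  define m where "m = cavg (ccell a h i1 x) b"
  define R where "R = cell a h i1 x"
  define \<Phi> where "\<Phi> i y \<longleftrightarrow> i1 \<le> i \<and> y \<in> R \<and> 2 * B \<le> \<bar>cavg (ccell a h i y) b - m\<bar>" for i y
  define E where "E = {y. \<exists>i. \<Phi> i y}"
  have loc: "loc_integrable b" and B: "0 < B" using b by (auto simp: bmo_bd_def)
  note [measurable] = loc_integrable_measurable[OF loc]
  have inv: "\<Phi> i y" if "\<Phi> i z" "y \<in> cell a h i z" for i y z
  proof -
    have "y \<in> cell a h i1 z" using that cell_down[of y a h i z i1] by (auto simp: \<Phi>_def)
    then have "y \<in> R" using that by (auto simp: \<Phi>_def R_def cell_def)
    then show ?thesis using that by (simp add: \<Phi>_def ccell_eq)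
  qed
  have E [measurable]: "E \<in> sets lebesgue" unfolding E_def by (rule stopping_sets[OF h inv])
  have "ennreal (2 * B) * emeasure lebesgue E = (\<integral>\<^sup>+y\<in>E. ennreal (2 * B) \<partial>lebesgue)"
    by (simp add: nn_integral_cmult_indicator)
  also have "\<dots> \<le> (\<integral>\<^sup>+y\<in>E. ennreal \<bar>b y - m\<bar> \<partial>lebesgue)"
    unfolding E_def
  proof (rule stopping_le[OF h inv])
    fix i z assume z: "\<Phi> i z"
    have "(\<integral>\<^sup>+y\<in>cell a h i z. ennreal (2 * B) \<partial>lebesgue) = ennreal (2 * B) * emeasure lebesgue (ccell a h i z)"
      using h by (simp add: nn_integral_cmult_indicator cell_sets emeasure_cell_eq)
    also have "\<dots> \<le> ennreal \<bar>cavg (ccell a h i z) b - m\<bar> * emeasure lebesgue (ccell a h i z)"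
      using z by (intro mult_right_mono ennreal_leI) (auto simp: \<Phi>_def)
    also have "\<dots> \<le> (\<integral>\<^sup>+y\<in>ccell a h i z. ennreal \<bar>b y - m\<bar> \<partial>lebesgue)"
      by (rule cavg_dev[OF loc ccell_cube[OF h]])
    finally show "(\<integral>\<^sup>+y\<in>cell a h i z. ennreal (2 * B) \<partial>lebesgue) \<le> (\<integral>\<^sup>+y\<in>cell a h i z. ennreal \<bar>b y - m\<bar> \<partial>lebesgue)"
      by (simp add: nn_cell[OF h])
  qed auto
  also have "\<dots> \<le> (\<integral>\<^sup>+y\<in>R. ennreal \<bar>b y - m\<bar> \<partial>lebesgue)"
    by (intro nn_integral_mono mult_left_mono) (auto simp: indicator_def E_def \<Phi>_def)
  also have "\<dots> \<le> ennreal B * emeasure lebesgue R"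
    using b ccell_cube[OF h, of a i1 x] unfolding R_def nn_cell[OF h] emeasure_cell_eq[OF h] m_def by (simp add: bmo_bd_def)
  finally have "ennreal B * (2 * emeasure lebesgue E) \<le> ennreal B * emeasure lebesgue R"
    using B by (simp add: ennreal_mult mult_ac)
  then have "2 * emeasure lebesgue E \<le> emeasure lebesgue R"
    using B by (subst (asm) ennreal_mult_le_mult_iff) (auto simp: ennreal_eq_0_iff)
  moreover have "{y \<in> cell a h i1 x. \<exists>i\<ge>i1. 2 * B \<le> \<bar>cavg (ccell a h i y) b - cavg (ccell a h i1 x) b\<bar>} = E"
    by (auto simp: E_def \<Phi>_def R_def m_def)
  ultimately show ?thesis by (simp add: R_def)
qed

text \<open>The gap between consecutive generations. A mean changes by at most
  \<open>2 ^ n * B\<close> from a cell to its child, which bounds the overshoot of a stopping cell,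
  and \<open>2 * B\<close> is what the half-measure estimate consumes.\<close>

definition jn_const :: "nat \<Rightarrow> real \<Rightarrow> real" where
  "jn_const n B = (2 ^ n + 2) * B"

lemma jn_const_pos: "0 < B \<Longrightarrow> 0 < jn_const n B"
  unfolding jn_const_def by (intro mult_pos_pos add_pos_pos) auto

text \<open>When generation \<open>k\<close> stops, the drift exceeds \<open>k * c\<close> by no
  more than one step \<open>2 ^ CARD('n) * B\<close>, since the preceding cell had not reached
  \<open>k * c\<close>. A point of generation \<open>k + 1\<close> in the same cell must therefore
  drift a further \<open>2 * B\<close> from the mean of that cell, and such points fill at most half
  of it.\<close>

lemma stop_set_half:
  fixes b :: "real^'n \<Rightarrow> real"
  assumes b: "bmo_bd b B" and h: "0 < h" and \<Psi>: "cell_inv a h \<Psi>" and c: "c = jn_const CARD('n) B"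
    and first: "first_at (stop_at b a h c \<Psi> k) i1 x"
  shows "2 * emeasure lebesgue (cell a h i1 x \<inter> stop_set b a h c \<Psi> (Suc k)) \<le> emeasure lebesgue (cell a h i1 x)"
proof -
  define \<beta> where "\<beta> i y = cavg (ccell a h i y) b" for i y
  have B: "0 < B" using b by (simp add: bmo_bd_def)
  have cpos: "0 < c" using B by (simp add: c jn_const_pos)
  have c2: "2 * B \<le> c" "c - 2 ^ CARD('n) * B = 2 * B" using B by (auto simp: c jn_const_def algebra_simps)
  obtain i0 where i0: "i0 \<le> i1" "first_at \<Psi> i0 x" "real k * c \<le> \<bar>\<beta> i1 x - \<beta> i0 x\<bar>"
    using first by (auto simp: first_at_def stop_at_def \<beta>_def)
  have up: "\<bar>\<beta> i1 x - \<beta> i0 x\<bar> \<le> real k * c + (c - 2 * B)"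
  proof (cases "i1 = i0")
    case True
    then show ?thesis using cpos c2 by simp
  next
    case False
    then obtain j where j: "i1 = Suc j" "i0 \<le> j" using i0(1) by (cases i1) auto
    then have "\<not> stop_at b a h c \<Psi> k j x" using first by (auto simp: first_at_def)
    then have "\<bar>\<beta> j x - \<beta> i0 x\<bar> < real k * c" using i0(2) j by (force simp: stop_at_def \<beta>_def)
    moreover have "\<bar>\<beta> i1 x - \<beta> j x\<bar> \<le> 2 ^ CARD('n) * B"
      unfolding j \<beta>_def by (rule cavg_cell_step[OF b h])
    ultimately show ?thesis using c2 by linarith
  qed
  have "cell a h i1 x \<inter> stop_set b a h c \<Psi> (Suc k)
      \<subseteq> {y \<in> cell a h i1 x. \<exists>i\<ge>i1. 2 * B \<le> \<bar>\<beta> i y - \<beta> i1 x\<bar>}"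
  proof clarsimp
    fix y assume y: "y \<in> cell a h i1 x" "y \<in> stop_set b a h c \<Psi> (Suc k)"
    then obtain i where st: "stop_at b a h c \<Psi> (Suc k) i y" by (auto simp: stop_set_def)
    then obtain j0 where j0: "j0 \<le> i" "first_at \<Psi> j0 y" "real (Suc k) * c \<le> \<bar>\<beta> i y - \<beta> j0 y\<bar>"
      by (auto simp: stop_at_def \<beta>_def)
    have "first_at \<Psi> i0 y" by (rule first_at_cell[OF \<Psi> i0(2,1) y(1)])
    then have [simp]: "j0 = i0" using j0(2) first_at_unique by metis
    have "ccell a h i0 y = ccell a h i0 x" by (rule ccell_eq[OF cell_down[OF y(1) i0(1)]])
    then have [simp]: "\<beta> i0 y = \<beta> i0 x" by (simp add: \<beta>_def)
    have big: "real k * c + c \<le> \<bar>\<beta> i y - \<beta> i0 x\<bar>" using j0(3) by (simp add: distrib_right)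
    \<comment> \<open>At levels coarser than \<open>i1\<close> the points \<open>x\<close> and
      \<open>y\<close> share their cells, so an earlier stop at \<open>y\<close> would be an earlier
      stop at \<open>x\<close>.\<close>
    have "i1 \<le> i"
    proof (rule ccontr)
      assume "\<not> i1 \<le> i"
      then have "x \<in> cell a h i y" using y(1) by (auto intro: cell_sym cell_down)
      then have "stop_at b a h c \<Psi> k i x"
        using cell_invD[OF stop_at_inv[OF \<Psi>] stop_at_Suc[OF less_imp_le[OF cpos] st]] by blast
      then show False using first \<open>\<not> i1 \<le> i\<close> by (auto simp: first_at_def)
    qed
    moreover have "2 * B \<le> \<bar>\<beta> i y - \<beta> i1 x\<bar>" using big up by linarith
    ultimately show "\<exists>i\<ge>i1. 2 * B \<le> \<bar>\<beta> i y - \<beta> i1 x\<bar>" by blast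
  qed
  then have "emeasure lebesgue (cell a h i1 x \<inter> stop_set b a h c \<Psi> (Suc k))
      \<le> emeasure lebesgue {y \<in> cell a h i1 x. \<exists>i\<ge>i1. 2 * B \<le> \<bar>\<beta> i y - \<beta> i1 x\<bar>}"
  proof (rule emeasure_mono)
    have "{y \<in> cell a h i1 x. \<exists>i\<ge>i1. 2 * B \<le> \<bar>\<beta> i y - \<beta> i1 x\<bar>} =
       {y. \<exists>i. i1 \<le> i \<and> y \<in> cell a h i1 x \<and> 2 * B \<le> \<bar>\<beta> i y - \<beta> i1 x\<bar>}" by auto
    also have "\<dots> \<in> sets lebesgue"
    proof (rule stopping_sets[OF h, where a = a])
      fix i z y assume *: "i1 \<le> i \<and> z \<in> cell a h i1 x \<and> 2 * B \<le> \<bar>\<beta> i z - \<beta> i1 x\<bar>" "y \<in> cell a h i z"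
      then have "y \<in> cell a h i1 z" by (auto intro: cell_down)
      then have "y \<in> cell a h i1 x" using * by (auto simp: cell_def)
      then show "i1 \<le> i \<and> y \<in> cell a h i1 x \<and> 2 * B \<le> \<bar>\<beta> i y - \<beta> i1 x\<bar>" using * by (simp add: \<beta>_def ccell_eq)
    qed
    finally show "{y \<in> cell a h i1 x. \<exists>i\<ge>i1. 2 * B \<le> \<bar>\<beta> i y - \<beta> i1 x\<bar>} \<in> sets lebesgue" .
  qed
  then show ?thesis
    using order_trans[OF mult_left_mono weak_type_oscillation[OF b h, of a i1 x]] by (simp add: \<beta>_def)
qed

text \<open>The drift stays below \<open>k * c\<close> at every level from \<open>i0\<close> on, and
  up to any \<open>e\<close> the value \<open>b x\<close> is caught between averages at such levels,
  so it inherits the bound.\<close>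

lemma stop_at_pointwise:
  fixes b :: "real^'n \<Rightarrow> real"
  assumes x: "\<forall>i0. \<forall>e>0. \<exists>i\<ge>i0. b x - e < cavg (ccell a h i x) b"
      "\<forall>i0. \<forall>e>0. \<exists>i\<ge>i0. cavg (ccell a h i x) b < b x + e"
    and first: "first_at \<Psi> i0 x" and out: "x \<notin> stop_set b a h c \<Psi> k"
  shows "\<bar>b x - cavg (ccell a h i0 x) b\<bar> \<le> real k * c"
    and "\<And>i. i0 \<le> i \<Longrightarrow> \<bar>cavg (ccell a h i x) b - cavg (ccell a h i0 x) b\<bar> < real k * c"
proof -
  show *: "\<bar>cavg (ccell a h i x) b - cavg (ccell a h i0 x) b\<bar> < real k * c" if "i0 \<le> i" for i
  proof (rule ccontr)
    assume "\<not> ?thesis"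
    then have "stop_at b a h c \<Psi> k i x" using that first unfolding stop_at_def by force
    then show False using out by (auto simp: stop_set_def)
  qed
  have "b x - cavg (ccell a h i0 x) b \<le> real k * c + e \<and> - (b x - cavg (ccell a h i0 x) b) \<le> real k * c + e" if e: "0 < e" for e
  proof -
    obtain i where i: "i0 \<le> i" "b x - e < cavg (ccell a h i x) b" using x(1) e by blast
    obtain j where j: "i0 \<le> j" "cavg (ccell a h j x) b < b x + e" using x(2) e by blast
    show ?thesis using *[OF i(1)] *[OF j(1)] i(2) j(2) by linarith
  qed
  then have "b x - cavg (ccell a h i0 x) b \<le> real k * c" "- (b x - cavg (ccell a h i0 x) b) \<le> real k * c"
    by (meson field_le_epsilon)+
  then show "\<bar>b x - cavg (ccell a h i0 x) b\<bar> \<le> real k * c" by linarith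
qed

section \<open>Oscillation against Muckenhoupt weights\<close>

lemma suminf_ennreal_top:
  fixes f :: "nat \<Rightarrow> ennreal"
  assumes "\<And>k. e \<le> f k" "0 < e"
  shows "(\<Sum>k. f k) = top"
proof (rule ccontr)
  assume "(\<Sum>k. f k) \<noteq> top"
  then obtain S where S: "0 \<le> S" "(\<Sum>k. f k) = ennreal S" by (cases "\<Sum>k. f k") auto
  have le: "of_nat n * e \<le> ennreal S" for n
  proof -
    have "of_nat n * e = (\<Sum>k<n. e)" by simp
    also have "\<dots> \<le> (\<Sum>k<n. f k)" by (intro sum_mono assms)
    also have "\<dots> \<le> (\<Sum>k. f k)" by (intro sum_le_suminf) auto
    finally show ?thesis using S by simp
  qed
  have "e \<noteq> top" using le[of 1] by (auto simp: top_unique)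
  then obtain t where t: "e = ennreal t" "0 < t" using assms(2) by (cases e) auto
  obtain n :: nat where "S < real n * t" using reals_Archimedean3[OF t(2)] by blast
  moreover have "real n * t \<le> S"
    using le[of n] S t unfolding ennreal_of_nat_eq_real_of_nat by (simp flip: ennreal_mult)
  ultimately show False by simp
qed

lemma summable_poly_geometric:
  fixes r \<theta> :: real
  assumes "0 < \<theta>" "\<theta> < 1"
  shows "summable (\<lambda>k::nat. (real k + 1) powr r * \<theta> ^ k)"
proof (rule summable_comparison_test_bigo)
  show "summable (\<lambda>k::nat. norm (1 / real k ^ 2))"
    using inverse_power_summable[of 2] by (simp add: field_simps)
  show "(\<lambda>k::nat. (real k + 1) powr r * \<theta> ^ k) \<in> O(\<lambda>k. 1 / real k ^ 2)"
    using assms by real_asymp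
qed

text \<open>If \<open>x\<close> belongs to generation \<open>k\<close> but not to the next one, both
  \<open>b x\<close> and the mean at level \<open>i\<close> are within \<open>(k + 1) * c\<close> of
  the mean of the starting cell, whence the factor 2; the single term \<open>k\<close> then
  suffices. If \<open>x\<close> belongs to every generation, the series is infinite unless
  \<open>v = 0\<close>.\<close>

lemma stop_at_sum:
  fixes b :: "real^'n \<Rightarrow> real" and v :: ennreal
  assumes x: "\<forall>i0. \<forall>e>0. \<exists>i\<ge>i0. b x - e < cavg (ccell a h i x) b"
      "\<forall>i0. \<forall>e>0. \<exists>i\<ge>i0. cavg (ccell a h i x) b < b x + e"
    and first: "first_at \<Psi> i0 x" "i0 \<le> i" and c: "0 < c" and r: "0 \<le> r"
  shows "ennreal (\<bar>b x - cavg (ccell a h i x) b\<bar> powr r) * v \<le>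
    (\<Sum>k. ennreal ((2 * (real k + 1) * c) powr r) * indicator (stop_set b a h c \<Psi> k) x * v)"
    (is "?L \<le> (\<Sum>k. ?f k)")
proof (cases "v = 0")
  case False
  show ?thesis
  proof (cases "\<forall>k. x \<in> stop_set b a h c \<Psi> k")
    case True
    have "(\<Sum>k. ?f k) = top"
    proof (rule suminf_ennreal_top)
      show "0 < ennreal ((2 * c) powr r) * v"
        using c False by (simp add: ennreal_zero_less_mult_iff zero_less_iff_neq_zero)
      fix k :: nat
      have "1 * (2 * c) \<le> (real k + 1) * (2 * c)" using c by (intro mult_right_mono) auto
      then have "(2 * c) powr r \<le> (2 * (real k + 1) * c) powr r"
        using c r by (intro powr_mono2) (auto simp: mult_ac)
      then show "ennreal ((2 * c) powr r) * v \<le> ?f k"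
        using True by (auto intro!: mult_right_mono ennreal_leI)
    qed
    then show ?thesis by simp
  next
    case False
    have "x \<in> stop_set b a h c \<Psi> 0" unfolding stop_set_def using stop_at_0[OF first(1)] by blast
    moreover have "\<exists>k. x \<in> stop_set b a h c \<Psi> k \<and> x \<notin> stop_set b a h c \<Psi> (Suc k)"
    proof (rule ccontr)
      assume "\<not> ?thesis"
      then have "x \<in> stop_set b a h c \<Psi> k" for k
        using \<open>x \<in> stop_set b a h c \<Psi> 0\<close> by (induction k) auto
      then show False using False by blast
    qed
    ultimately obtain k where k: "x \<in> stop_set b a h c \<Psi> k" "x \<notin> stop_set b a h c \<Psi> (Suc k)" by blast
    note pt = stop_at_pointwise[OF x first(1) k(2)]
    have "\<bar>b x - cavg (ccell a h i x) b\<bar> \<le> real (Suc k) * c + real (Suc k) * c"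
      using pt(1) pt(2)[OF first(2)] by linarith
    then have "\<bar>b x - cavg (ccell a h i x) b\<bar> \<le> 2 * (real k + 1) * c" by (simp add: algebra_simps)
    then have "?L \<le> ?f k"
      using k(1) r by (auto intro!: mult_right_mono ennreal_leI powr_mono2)
    also have "\<dots> \<le> (\<Sum>k. ?f k)" using sum_le_suminf[of ?f "{k}"] by simp
    finally show ?thesis .
  qed
qed simp

lemma half_complement:
  assumes "2 * emeasure M (R \<inter> X) \<le> emeasure M R" "emeasure M R \<noteq> top" "R \<in> sets M" "X \<in> sets M"
  shows "emeasure M R \<le> 2 * emeasure M (R - X)"
proof -
  have e: "emeasure M R = emeasure M (R \<inter> X) + emeasure M (R - X)"
    using assms by (subst plus_emeasure) (auto simp: Un_Diff_Int Int_Diff_Un)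
  have fin: "emeasure M (R \<inter> X) \<noteq> top" using e assms(2) by auto
  have "emeasure M (R \<inter> X) + emeasure M (R \<inter> X) \<le> emeasure M (R - X) + emeasure M (R \<inter> X)"
    using assms(1) e by (simp add: mult_2 add.commute)
  then have "emeasure M (R \<inter> X) \<le> emeasure M (R - X)" using fin by (rule ennreal_le_if_add_le)
  then show ?thesis using e by (simp add: mult_2 add_mono)
qed

text \<open>Each value of \<open>w\<close> on the cell, multiplied by \<open>A\<close>, is at least
  the mean of \<open>w\<close> there. Hence the part outside \<open>X\<close>, which has at least
  half of the volume, keeps at least the share \<open>1 / (2 * A)\<close> of the weight.\<close>

lemma A1_cell:
  fixes w :: "real^'n \<Rightarrow> ennreal"
  assumes w: "w \<in> borel_measurable lebesgue" "\<And>x. MX w x \<le> ennreal A * w x" and h: "0 < h"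
    and X: "X \<in> sets lebesgue" "2 * emeasure lebesgue (cell a h i x \<inter> X) \<le> emeasure lebesgue (cell a h i x)"
  shows "(\<integral>\<^sup>+y\<in>cell a h i x. w y \<partial>lebesgue) \<le> (\<integral>\<^sup>+y\<in>cell a h i x. 2 * ennreal A * w y * indicator (- X) y \<partial>lebesgue)"
proof -
  define R where "R = cell a h i x"
  define I where "I = (\<integral>\<^sup>+y\<in>R. w y \<partial>lebesgue)"
  note [measurable] = w(1) X(1)
  have R [measurable]: "R \<in> sets lebesgue" unfolding R_def by (rule cell_sets[OF h])
  have cR: "cube (ccell a h i x)" by (rule ccell_cube[OF h])
  have nz: "emeasure lebesgue R \<noteq> 0" "emeasure lebesgue R \<noteq> top"
    unfolding R_def emeasure_cell_eq[OF h] using cube_emeasure[OF cR] by auto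
  have pt: "I / emeasure lebesgue R \<le> ennreal A * w y" if "y \<in> R" for y
  proof -
    have "y \<in> ccell a h i x" using that cell_subset_ccell[OF h] by (auto simp: R_def)
    then have "I \<le> MX w y * emeasure lebesgue R"
      using MX_upper[OF cR, of y w] unfolding I_def R_def nn_cell[OF h] emeasure_cell_eq[OF h] by simp
    also have "\<dots> \<le> ennreal A * w y * emeasure lebesgue R" by (intro mult_right_mono w) simp
    finally show ?thesis using nz by (simp add: ennreal_divide_le_iff_mult)
  qed
  have "I = I / emeasure lebesgue R * emeasure lebesgue R"
    using nz by (simp add: ennreal_divide_times less_top ennreal_mult_divide_eq)
  also have "\<dots> \<le> I / emeasure lebesgue R * (2 * emeasure lebesgue (R - X))"
    using half_complement[OF X(2)[folded R_def] nz(2) R X(1)] by (intro mult_left_mono) auto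
  also have "\<dots> = (\<integral>\<^sup>+y\<in>R - X. 2 * (I / emeasure lebesgue R) \<partial>lebesgue)"
    by (subst nn_integral_cmult_indicator) (auto simp: mult_ac)
  also have "\<dots> \<le> (\<integral>\<^sup>+y\<in>R. 2 * ennreal A * w y * indicator (- X) y \<partial>lebesgue)"
    using pt by (intro nn_integral_mono) (auto simp: indicator_def mult.assoc intro!: mult_left_mono)
  finally show ?thesis by (simp add: I_def R_def)
qed

text \<open>With respect to an \<open>A\<^sub>1\<close> weight the stopping sets of the John--Nirenberg argument still
  decay geometrically, so the weighted oscillations are controlled without a reverse Hoelder inequality.\<close>

lemma A1_oscillation:
  fixes b :: "real^'n \<Rightarrow> real"
  assumes b: "bmo_bd b B" and r: "0 \<le> r"
  obtains C where "0 < C"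
    "\<And>w Q. w \<in> borel_measurable lebesgue \<Longrightarrow> (\<And>x. MX w x \<le> ennreal A * w x) \<Longrightarrow> cube Q \<Longrightarrow>
      (\<integral>\<^sup>+y\<in>Q. ennreal (\<bar>b y - cavg Q b\<bar> powr r) * w y \<partial>lebesgue) \<le> ennreal C * (\<integral>\<^sup>+y\<in>Q. w y \<partial>lebesgue)"
proof -
  define c where "c = jn_const CARD('n) B"
  have B: "0 < B" and loc: "loc_integrable b" using b by (auto simp: bmo_bd_def)
  have c: "0 < c" unfolding c_def by (rule jn_const_pos[OF B])
  \<comment> \<open>One generation loses at least the share \<open>1 / (2 * D)\<close> of the
    weight, so the share \<open>\<kappa>\<close> remains. Raising \<open>A\<close> to at least 1
    keeps \<open>\<kappa>\<close> strictly between 0 and 1.\<close>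
  define D where "D = max A 1"
  define \<kappa> where "\<kappa> = 1 - 1 / (2 * D)"
  have D: "1 \<le> D" "A \<le> D" by (auto simp: D_def)
  have \<kappa>: "0 < \<kappa>" "\<kappa> < 1" using D by (auto simp: \<kappa>_def field_simps)
  define \<mu> where "\<mu> k = (2 * (real k + 1) * c) powr r * \<kappa> ^ k" for k :: nat
  have "summable (\<lambda>k::nat. (2 * c) powr r * ((real k + 1) powr r * \<kappa> ^ k))"
    by (intro summable_mult summable_poly_geometric \<kappa>)
  moreover have "(2 * c) powr r * ((real k + 1) powr r * \<kappa> ^ k) = \<mu> k" for k
  proof -
    have "2 * (real k + 1) * c = (2 * c) * (real k + 1)" by simp
    then have "\<mu> k = ((2 * c) * (real k + 1)) powr r * \<kappa> ^ k" by (simp only: \<mu>_def)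
    also have "((2 * c) * (real k + 1)) powr r = (2 * c) powr r * (real k + 1) powr r"
      by (rule powr_mult)
    finally show ?thesis by simp
  qed
  ultimately have \<mu>_sum: "summable \<mu>" by simp
  have \<mu>_nn: "0 \<le> \<mu> k" for k using \<kappa> by (simp add: \<mu>_def)
  show thesis
  proof (rule that[of "suminf \<mu> + 1"])
    show "0 < suminf \<mu> + 1" using suminf_nonneg[OF \<mu>_sum \<mu>_nn] by simp
    fix w :: "real^'n \<Rightarrow> ennreal" and Q :: "(real^'n) set"
    assume w [measurable]: "w \<in> borel_measurable lebesgue" and A: "\<And>x. MX w x \<le> ennreal A * w x" and Q: "cube Q"
    have A': "MX w x \<le> ennreal D * w x" for x
      using A[of x] D by (meson ennreal_leI mult_right_mono order_trans zero_le)
    obtain a h where h: "0 < h" "Q = cbox a (a + h *\<^sub>R One)" using cubeE[OF Q] by metis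
    define W where "W = cell a h 0 a"
    have "corner a h 0 a = a" by (simp add: corner_def idx_def vec_eq_iff)
    then have QW: "ccell a h 0 a = Q" by (simp add: ccell_def h(2))
    have W [measurable]: "W \<in> sets lebesgue" unfolding W_def by (rule cell_sets[OF h(1)])
    \<comment> \<open>Start everywhere at level 0. The grid is fitted to \<open>Q\<close>, so that
      the starting cell \<open>W\<close> is \<open>Q\<close> up to a null set.\<close>
    define \<Psi> where "\<Psi> = (\<lambda>(i::nat) (x::real^'n). True)"
    have \<Psi>: "cell_inv a h \<Psi>" by (simp add: cell_inv_def \<Psi>_def)
    have first0: "first_at \<Psi> 0 x" for x by (simp add: first_at_def \<Psi>_def)
    define \<Omega> where "\<Omega> = stop_set b a h c \<Psi>"
    have \<Omega> [measurable]: "\<Omega> k \<in> sets lebesgue" for k unfolding \<Omega>_def by (rule stop_set_sets[OF h(1) \<Psi>])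
    have \<Omega>Suc: "\<Omega> (Suc k) \<subseteq> \<Omega> k" for k unfolding \<Omega>_def by (rule stop_set_Suc) (use c in simp)
    define I where "I k = (\<integral>\<^sup>+y\<in>W \<inter> \<Omega> k. w y \<partial>lebesgue)" for k
    have step: "I k \<le> 2 * ennreal D * (\<integral>\<^sup>+y\<in>W \<inter> \<Omega> k - \<Omega> (Suc k). w y \<partial>lebesgue)" for k
    proof -
      define \<Phi> where "\<Phi> i x \<longleftrightarrow> x \<in> W \<and> stop_at b a h c \<Psi> k i x" for i x
      have U: "{x. \<exists>i. \<Phi> i x} = W \<inter> \<Omega> k" by (auto simp: \<Phi>_def \<Omega>_def stop_set_def)
      have inv: "\<Phi> i y" if "\<Phi> i x" "y \<in> cell a h i x" for i x y
        using that cell_invD[OF stop_at_inv[OF \<Psi>]] cell_down[of y a h i x 0] by (auto simp: \<Phi>_def W_def cell_def)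
      have "I k = (\<integral>\<^sup>+y\<in>{x. \<exists>i. \<Phi> i x}. w y \<partial>lebesgue)" by (simp add: I_def U)
      also have "\<dots> \<le> (\<integral>\<^sup>+y\<in>{x. \<exists>i. \<Phi> i x}. (2 * ennreal D * w y * indicator (- \<Omega> (Suc k)) y) \<partial>lebesgue)"
      proof (rule stopping_le[OF h(1) inv])
        fix i x assume *: "\<Phi> i x" "\<And>j. j < i \<Longrightarrow> \<not> \<Phi> j x"
        then have "first_at (stop_at b a h c \<Psi> k) i x" by (auto simp: first_at_def \<Phi>_def)
        from stop_set_half[OF b h(1) \<Psi> c_def this]
        show "(\<integral>\<^sup>+y\<in>cell a h i x. w y \<partial>lebesgue) \<le> (\<integral>\<^sup>+y\<in>cell a h i x. 2 * ennreal D * w y * indicator (- \<Omega> (Suc k)) y \<partial>lebesgue)"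
          by (intro A1_cell w A' h \<Omega>) (simp add: \<Omega>_def)
      qed measurable
      also have "\<dots> = (\<integral>\<^sup>+y. 2 * ennreal D * (w y * indicator (W \<inter> \<Omega> k - \<Omega> (Suc k)) y) \<partial>lebesgue)"
        unfolding U by (intro nn_integral_cong) (auto simp: indicator_def)
      also have "\<dots> = 2 * ennreal D * (\<integral>\<^sup>+y\<in>W \<inter> \<Omega> k - \<Omega> (Suc k). w y \<partial>lebesgue)"
        by (intro nn_integral_cmult) measurable
      finally show ?thesis .
    qed
    have split: "I k = (\<integral>\<^sup>+y\<in>W \<inter> \<Omega> k - \<Omega> (Suc k). w y \<partial>lebesgue) + I (Suc k)" for k
    proof -
      have "I k = (\<integral>\<^sup>+y. w y * indicator (W \<inter> \<Omega> k - \<Omega> (Suc k)) y + w y * indicator (W \<inter> \<Omega> (Suc k)) y \<partial>lebesgue)"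
        unfolding I_def using \<Omega>Suc[of k] by (intro nn_integral_cong) (auto simp: indicator_def)
      also have "\<dots> = (\<integral>\<^sup>+y\<in>W \<inter> \<Omega> k - \<Omega> (Suc k). w y \<partial>lebesgue) + I (Suc k)"
        unfolding I_def by (intro nn_integral_add) measurable
      finally show ?thesis .
    qed
    have I0: "I 0 = (\<integral>\<^sup>+y\<in>Q. w y \<partial>lebesgue)"
    proof -
      have "\<Omega> 0 = UNIV" unfolding \<Omega>_def stop_set_def using stop_at_0[OF first0] by blast
      then show ?thesis by (simp add: I_def W_def nn_cell[OF h(1)] QW)
    qed
    show "(\<integral>\<^sup>+y\<in>Q. ennreal (\<bar>b y - cavg Q b\<bar> powr r) * w y \<partial>lebesgue) \<le> ennreal (suminf \<mu> + 1) * (\<integral>\<^sup>+y\<in>Q. w y \<partial>lebesgue)"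
    proof (cases "I 0 = top")
      case True
      then show ?thesis using suminf_nonneg[OF \<mu>_sum \<mu>_nn] by (simp add: I0[symmetric] ennreal_mult_top)
    next
      case False
      \<comment> \<open>Finite total weight is what permits the subtraction that turns
        \<open>step\<close> and \<open>split\<close> into geometric decay.\<close>
      have Ile: "I k \<le> ennreal (\<kappa> ^ k) * I 0" for k
      proof (induction k)
        case (Suc k)
        have "I k \<le> I 0"
          using Suc \<kappa> mult_right_mono[of "ennreal (\<kappa> ^ k)" 1 "I 0"] by (simp add: power_le_one order_trans)
        then have fin: "I k \<noteq> top" using False by (auto simp: top_unique)
        then obtain u where u: "I k = ennreal u" "0 \<le> u" by (cases "I k") auto
        obtain v where v: "(\<integral>\<^sup>+y\<in>W \<inter> \<Omega> k - \<Omega> (Suc k). w y \<partial>lebesgue) = ennreal v" "0 \<le> v"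
          using fin split[of k] by (cases "\<integral>\<^sup>+y\<in>W \<inter> \<Omega> k - \<Omega> (Suc k). w y \<partial>lebesgue") auto
        obtain t where t: "I (Suc k) = ennreal t" "0 \<le> t" using fin split[of k] by (cases "I (Suc k)") auto
        have "u = v + t" using split[of k] u v t by (simp flip: ennreal_plus)
        have "ennreal u \<le> ennreal (2 * D * v)"
          using step[of k] D(1) v(2) unfolding u v(1) by (simp add: ennreal_mult)
        then have "u \<le> 2 * D * v" using D v by (subst (asm) ennreal_le_iff) auto
        then have "u / (2 * D) \<le> v" using D by (simp add: divide_le_eq mult.commute)
        then have "t \<le> \<kappa> * u" using \<open>u = v + t\<close> by (simp add: \<kappa>_def left_diff_distrib)
        then have "I (Suc k) \<le> ennreal \<kappa> * I k"
          unfolding t u(1) using \<kappa> u(2) by (simp flip: ennreal_mult)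
        also have "\<dots> \<le> ennreal \<kappa> * (ennreal (\<kappa> ^ k) * I 0)" by (intro mult_left_mono Suc) simp
        also have "\<dots> = ennreal (\<kappa> ^ Suc k) * I 0" using \<kappa> by (simp add: ennreal_mult mult.assoc)
        finally show ?case .
      qed simp
      have "(\<integral>\<^sup>+y\<in>Q. ennreal (\<bar>b y - cavg Q b\<bar> powr r) * w y \<partial>lebesgue) =
          (\<integral>\<^sup>+y\<in>W. ennreal (\<bar>b y - cavg Q b\<bar> powr r) * w y \<partial>lebesgue)"
        by (simp add: W_def nn_cell[OF h(1)] QW)
      also have "\<dots> \<le> (\<integral>\<^sup>+y. (\<Sum>k. ennreal ((2 * (real k + 1) * c) powr r) * (w y * indicator (W \<inter> \<Omega> k) y)) \<partial>lebesgue)"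
      proof (rule nn_integral_mono_AE)
        show "AE y in lebesgue. ennreal (\<bar>b y - cavg Q b\<bar> powr r) * w y * indicator W y \<le>
            (\<Sum>k. ennreal ((2 * (real k + 1) * c) powr r) * (w y * indicator (W \<inter> \<Omega> k) y))"
          using cavg_frequently_gt[OF h(1) loc, of a] cavg_frequently_lt[OF h(1) loc, of a]
        proof eventually_elim
          case (elim y)
          show ?case
          proof (cases "y \<in> W")
            case True
            then have "ccell a h 0 y = Q" using ccell_eq[of y a h 0 a] QW by (simp add: W_def)
            then show ?thesis
              using stop_at_sum[OF elim first0 le_refl c r, of "w y"] True by (simp add: \<Omega>_def indicator_def mult_ac)
          qed simp
        qed
      qed
      also have "\<dots> = (\<Sum>k. ennreal ((2 * (real k + 1) * c) powr r) * I k)"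
        unfolding I_def by (subst nn_integral_suminf) (auto simp: nn_integral_cmult)
      also have "\<dots> \<le> (\<Sum>k. ennreal (\<mu> k) * I 0)"
      proof (intro suminf_le allI)
        fix k
        have "ennreal ((2 * (real k + 1) * c) powr r) * I k \<le> ennreal ((2 * (real k + 1) * c) powr r) * (ennreal (\<kappa> ^ k) * I 0)"
          by (intro mult_left_mono Ile) simp
        also have "\<dots> = ennreal (\<mu> k) * I 0" using \<kappa> by (simp add: \<mu>_def ennreal_mult mult.assoc)
        finally show "ennreal ((2 * (real k + 1) * c) powr r) * I k \<le> ennreal (\<mu> k) * I 0" .
      qed auto
      also have "\<dots> = ennreal (suminf \<mu>) * I 0"
        using \<mu>_nn \<mu>_sum by (simp add: suminf_ennreal2)
      also have "\<dots> \<le> ennreal (suminf \<mu> + 1) * I 0"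
        by (intro mult_right_mono ennreal_leI) auto
      finally show ?thesis by (simp add: I0)
    qed
  qed
qed

section \<open>Geometric decay of modulars\<close>

lemma ennreal_div_const: "0 < A \<Longrightarrow> a / ennreal A = ennreal (1 / A) * a"
  by (simp add: divide_ennreal_def inverse_ennreal inverse_eq_divide mult.commute)

lemma ballbdD:
  assumes "ballbd s A" "0 < A" "F \<in> borel_measurable lebesgue" "mdl s F \<le> 1"
  shows "mdl s (\<lambda>x. ennreal (1 / A) * MX F x) \<le> 1"
  using assms unfolding ballbd_def ennreal_div_const[OF assms(2)] by blast

lemma ballbd_mono:
  assumes "ballbd s A" "0 < A" "A \<le> A'" "\<And>x. 0 \<le> s x"
  shows "ballbd s A'"
  unfolding ballbd_def
proof (intro ballI impI)
  fix F assume F: "F \<in> borel_measurable lebesgue" "mdl s F \<le> 1"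
  have "mdl s (\<lambda>x. MX F x / ennreal A') \<le> mdl s (\<lambda>x. MX F x / ennreal A)"
    using assms by (intro mdl_mono) (auto simp: ennreal_div_const intro!: mult_right_mono ennreal_leI frac_le)
  then show "mdl s (\<lambda>x. MX F x / ennreal A') \<le> 1" using assms(1) F by (auto simp: ballbd_def)
qed

text \<open>If \<open>G = H - H'\<close> had small modular, then so would \<open>H \<le> 4 M G\<close>; hence removing \<open>G\<close> from \<open>H\<close>
  decreases the norm by a fixed factor. This is the only place where \<open>s\<^sub>+ < \<infinity>\<close> is essential.\<close>

lemma mdl_decay:
  fixes s :: "real^'n \<Rightarrow> real"
  assumes s: "s \<in> borel_measurable lebesgue" "\<And>x. 1 \<le> s x" "AE x in lebesgue. s x \<le> S"
    and A: "ballbd s A" "0 < A"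
  obtains \<theta> where "0 < \<theta>" "\<theta> < 1"
    "\<And>H H' G. H \<in> borel_measurable lebesgue \<Longrightarrow> H' \<in> borel_measurable lebesgue \<Longrightarrow> G \<in> borel_measurable lebesgue \<Longrightarrow>
      (\<And>x. H x = H' x + G x) \<Longrightarrow> (\<And>x. H x \<le> 4 * MX G x) \<Longrightarrow> mdl s H \<le> 1 \<Longrightarrow>
      mdl s (\<lambda>x. ennreal (1 / \<theta>) * H' x) \<le> 1"
proof -
  define D where "D = max A 1"
  have D: "1 \<le> D" "0 < D" and Db: "ballbd s D"
    using A s(2) by (auto simp: D_def intro!: ballbd_mono[OF A] order_trans[OF zero_le_one])
  define T where "T = max S 1"
  have T: "1 \<le> T" and sT: "AE x in lebesgue. s x \<le> T" using s(3) by (auto simp: T_def)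
  \<comment> \<open>Here \<open>8 = 2 * 4\<close>: the 4 of the hypothesis
    \<open>H \<le> 4 * MX G\<close>, and a 2 so that the modular of \<open>2 * H\<close>, and not
    merely that of \<open>H\<close>, comes out at most 1.\<close>
  define t where "t = 8 * D"
  have t: "1 \<le> t" "0 < t" using D by (auto simp: t_def)
  \<comment> \<open>The worse of two cases: \<open>1/2\<close> if the modular of \<open>G\<close> is
    at most \<open>1 / t powr T\<close>, and \<open>1 - 1 / t powr T\<close> if it is larger and is
    split off from that of \<open>H\<close>.\<close>
  define \<kappa> where "\<kappa> = max (1/2) (1 - 1 / t powr T)"
  have \<kappa>: "0 < \<kappa>" "\<kappa> < 1" using t by (auto simp: \<kappa>_def)
  \<comment> \<open>Turns a gain in the modular into a dilation: the factor
    \<open>1 / \<theta>\<close> multiplies the modular by at most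
    \<open>(1 / \<theta>) powr T = 1 / \<kappa>\<close>, exactly the room that the bound
    \<open>\<kappa>\<close> on \<open>H'\<close> leaves.\<close>
  define \<theta> where "\<theta> = \<kappa> powr (1 / T)"
  have \<theta>: "0 < \<theta>" "\<theta> < 1" using \<kappa> T powr_less_mono2[of "1 / T" \<kappa> 1] by (auto simp: \<theta>_def)
  have \<theta>T: "(1 / \<theta>) powr T = 1 / \<kappa>"
    using T \<kappa> by (simp add: \<theta>_def powr_divide powr_powr)
  have s0: "0 \<le> s x" for x using s(2)[of x] by simp
  have scale: "mdl s (\<lambda>x. ennreal u * F x) \<le> ennreal (u powr T) * mdl s F"
    if "1 \<le> u" "F \<in> borel_measurable lebesgue" for u F
  proof -
    have "mdl s (\<lambda>x. ennreal u * F x) \<le> (\<integral>\<^sup>+x. ennreal (u powr T) * epow (F x) (s x) \<partial>lebesgue)"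
      unfolding mdl_def using sT by (intro nn_integral_mono_AE) (auto intro!: epow_mult_le that elim!: AE_mp)
    also have "\<dots> = ennreal (u powr T) * mdl s F"
      unfolding mdl_def using that s(1) by (intro nn_integral_cmult) measurable
    finally show ?thesis .
  qed
  show thesis
  proof (rule that[OF \<theta>])
    fix H H' G :: "real^'n \<Rightarrow> ennreal"
    assume m [measurable]: "H \<in> borel_measurable lebesgue" "H' \<in> borel_measurable lebesgue" "G \<in> borel_measurable lebesgue"
      and HG: "\<And>x. H x = H' x + G x" and HM: "\<And>x. H x \<le> 4 * MX G x" and H: "mdl s H \<le> 1"
    note [measurable] = s(1)
    have sum: "mdl s H' + mdl s G \<le> mdl s H"
    proof -
      have "mdl s H' + mdl s G = (\<integral>\<^sup>+x. epow (H' x) (s x) + epow (G x) (s x) \<partial>lebesgue)"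
        unfolding mdl_def by (intro nn_integral_add[symmetric]) measurable
      also have "\<dots> \<le> mdl s H"
        unfolding mdl_def HG by (intro nn_integral_mono epow_superadd s)
      finally show ?thesis .
    qed
    have "mdl s H' \<le> ennreal \<kappa>"
    proof (cases "mdl s G \<le> ennreal (1 / t powr T)")
      case True
      have "mdl s (\<lambda>x. ennreal t * G x) \<le> ennreal (t powr T) * mdl s G" by (rule scale[OF t(1) m(3)])
      also have "\<dots> \<le> ennreal (t powr T) * ennreal (1 / t powr T)" by (intro mult_left_mono True) simp
      also have "\<dots> = 1" using t by (simp flip: ennreal_mult)
      finally have "mdl s (\<lambda>x. ennreal (1 / D) * MX (\<lambda>x. ennreal t * G x) x) \<le> 1"
        by (intro ballbdD[OF Db D(2)]) auto
      moreover have "ennreal 2 * H x \<le> ennreal (1 / D) * MX (\<lambda>x. ennreal t * G x) x" for x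
      proof -
        have "ennreal 2 * H x \<le> ennreal 2 * (ennreal 4 * MX G x)"
          using HM[of x] by (intro mult_left_mono) auto
        also have "\<dots> = (ennreal (1 / D) * ennreal t) * MX G x"
          using D by (simp add: t_def mult.assoc[symmetric] flip: ennreal_mult)
        finally show ?thesis by (simp add: MX_cmult mult.assoc)
      qed
      ultimately have 2: "mdl s (\<lambda>x. ennreal 2 * H x) \<le> 1"
        using mdl_mono[of "\<lambda>x. ennreal 2 * H x" _ s] s0 by (meson order_trans)
      have "mdl s H \<le> (\<integral>\<^sup>+x. ennreal (1/2) * epow (ennreal 2 * H x) (s x) \<partial>lebesgue)"
        unfolding mdl_def
      proof (intro nn_integral_mono)
        fix x
        have "ennreal (1/2) * ennreal 2 = 1" by (subst ennreal_mult[symmetric]) auto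
        then have "H x = ennreal (1/2) * (ennreal 2 * H x)"
          by (simp only: mult.assoc[symmetric] mult_1)
        then show "epow (H x) (s x) \<le> ennreal (1/2) * epow (ennreal 2 * H x) (s x)"
          using epow_contract[of "1/2" "s x" "ennreal 2 * H x"] s(2)[of x] by simp
      qed
      also have "\<dots> = ennreal (1/2) * mdl s (\<lambda>x. ennreal 2 * H x)"
        unfolding mdl_def by (intro nn_integral_cmult) measurable
      also have "\<dots> \<le> ennreal (1/2)" using mult_left_mono[OF 2, of "ennreal (1/2)"] by simp
      also have "\<dots> \<le> ennreal \<kappa>" by (intro ennreal_leI) (simp add: \<kappa>_def)
      finally show ?thesis using sum by (meson add_increasing2 order_trans zero_le le_iff_add)
    next
      case False
      have fin: "mdl s H' \<noteq> top" "mdl s G \<noteq> top"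
        using sum H by (auto simp: top_unique)
      then obtain u v where uv: "mdl s H' = ennreal u" "0 \<le> u" "mdl s G = ennreal v" "0 \<le> v"
        by (cases "mdl s H'"; cases "mdl s G") auto
      have "ennreal (u + v) \<le> 1" using order_trans[OF sum H] uv by simp
      then have "u + v \<le> 1" by (simp only: ennreal_le_1)
      moreover have "1 / t powr T \<le> v" using False uv by (simp add: not_le ennreal_less_iff)
      ultimately have "u \<le> \<kappa>" by (simp add: \<kappa>_def)
      then show ?thesis using uv by (simp add: ennreal_leI)
    qed
    have "mdl s (\<lambda>x. ennreal (1 / \<theta>) * H' x) \<le> ennreal ((1 / \<theta>) powr T) * mdl s H'"
      by (rule scale) (use \<theta> in auto)
    also have "\<dots> \<le> ennreal (1 / \<kappa>) * ennreal \<kappa>"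
      unfolding \<theta>T by (intro mult_left_mono \<open>mdl s H' \<le> ennreal \<kappa>\<close>) simp
    also have "\<dots> = 1" using \<kappa> by (simp flip: ennreal_mult)
    finally show "mdl s (\<lambda>x. ennreal (1 / \<theta>) * H' x) \<le> 1" .
  qed
qed

section \<open>Integer powers of two, enumerated by the naturals so that sums over all scales are
  ordinary series\<close>

definition lev :: "nat \<Rightarrow> real" where
  "lev n = 2 powi int_decode n"

lemma lev_pos [simp]: "0 < lev n"
  by (simp add: lev_def)

lemma sum_half_powers: "(\<Sum>k\<le>n. (1/2::real) ^ k) = 2 - (1/2) ^ n"
proof (induction n)
  case (Suc n)
  then show ?case unfolding sum.atMost_Suc by (simp only: power_Suc)
qed simp

text \<open>Distinct powers of two below \<open>v\<close> are part of a geometric series headed by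
  the largest of them, hence the factor 2.\<close>

lemma sum_powi_le:
  assumes "finite T" "\<And>j. j \<in> T \<Longrightarrow> (2::real) powi j \<le> v" "0 \<le> v"
  shows "(\<Sum>j\<in>T. 2 powi j) \<le> 2 * v"
proof (cases "T = {}")
  case False
  define J d where "J = Max T" and "d = nat (Max T - Min T)"
  have "T \<subseteq> (\<lambda>k. J - int k) ` {..d}"
  proof
    fix j assume j: "j \<in> T"
    have "Min T \<le> j" "j \<le> Max T" using j assms(1) by auto
    then show "j \<in> (\<lambda>k. J - int k) ` {..d}"
      by (intro image_eqI[of _ _ "nat (J - j)"]) (auto simp: J_def d_def)
  qed
  then have "(\<Sum>j\<in>T. (2::real) powi j) \<le> (\<Sum>j\<in>(\<lambda>k. J - int k) ` {..d}. 2 powi j)"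
    by (intro sum_mono2) auto
  also have "\<dots> = (\<Sum>k\<le>d. 2 powi (J - int k))"
    by (subst sum.reindex) (auto simp: inj_on_def)
  also have "\<dots> = 2 powi J * (\<Sum>k\<le>d. (1/2) ^ k)"
    unfolding sum_distrib_left
    by (intro sum.cong refl) (simp add: power_int_diff power_one_over)
  also have "(\<Sum>k\<le>d. (1/2::real) ^ k) = 2 - (1/2) ^ d" by (rule sum_half_powers)
  also have "2 powi J * \<dots> \<le> 2 powi J * (2::real)" by (intro mult_left_mono) auto
  finally have "(\<Sum>j\<in>T. (2::real) powi j) \<le> 2 powi J * 2" .
  also have "2 powi J \<le> v" using assms False by (simp add: J_def)
  finally show ?thesis by simp
qed (use assms in simp)

lemma suminf_lev_le:
  fixes v :: ennreal
  assumes "\<And>n. x \<in> X n \<Longrightarrow> ennreal (lev n) \<le> v"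
  shows "(\<Sum>n. ennreal (lev n) * indicator (X n) x) \<le> 2 * v"
proof (cases v)
  case (real u)
  have "(\<Sum>n<M. ennreal (lev n) * indicator (X n) x) \<le> 2 * v" for M
  proof -
    define N where "N = {n. n < M \<and> x \<in> X n}"
    have "(\<Sum>n<M. ennreal (lev n) * indicator (X n) x) = (\<Sum>n\<in>N. ennreal (lev n))"
      unfolding N_def by (intro sum.mono_neutral_cong_right) auto
    also have "\<dots> = ennreal (\<Sum>n\<in>N. lev n)" by (simp add: sum_ennreal less_imp_le)
    also have "(\<Sum>n\<in>N. lev n) = (\<Sum>j\<in>int_decode ` N. 2 powi j)"
      by (subst sum.reindex) (auto simp: lev_def inj_int_decode)
    also have "ennreal \<dots> \<le> ennreal (2 * u)"
    proof (intro ennreal_leI sum_powi_le)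
      fix j assume "j \<in> int_decode ` N"
      then obtain n where "j = int_decode n" "x \<in> X n" by (auto simp: N_def)
      then show "2 powi j \<le> u" using assms[of n] real by (simp add: lev_def)
    qed (use real in \<open>auto simp: N_def\<close>)
    finally show ?thesis using real by (simp add: ennreal_mult)
  qed
  then show ?thesis by (intro suminf_le_const) auto
qed (simp add: ennreal_mult_top)

lemma lev_bracket:
  fixes m :: ennreal
  assumes "m \<noteq> 0" "m \<noteq> top"
  obtains n where "ennreal (lev n) < m" "m \<le> ennreal (2 * lev n)"
proof -
  obtain u where u: "m = ennreal u" "0 < u" using assms by (cases m) auto
  define j where "j = \<lceil>log 2 u\<rceil> - 1"
  have "real_of_int j < log 2 u" "log 2 u \<le> real_of_int (j + 1)" unfolding j_def by linarith+
  then have "2 powr real_of_int j < u" "u \<le> 2 powr real_of_int (j + 1)"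
    using u(2) by (simp_all add: less_log_iff log_le_iff)
  moreover have "2 powr real_of_int (j + 1) = 2 * 2 powr real_of_int j" by (simp add: powr_add)
  moreover have "lev (int_encode j) = 2 powr real_of_int j" by (simp add: lev_def powr_real_of_int')
  ultimately show thesis using u by (intro that[of "int_encode j"]) (auto simp: ennreal_less_iff)
qed

text \<open>Constant on cells, unlike \<open>w\<close> itself, so that its superlevel sets can start
  a stopping argument.\<close>

definition infcell :: "(real^'n \<Rightarrow> ennreal) \<Rightarrow> real^'n \<Rightarrow> real \<Rightarrow> nat \<Rightarrow> real^'n \<Rightarrow> ennreal" where
  "infcell w a h i x = (INF z\<in>cell a h i x. w z)"

lemma infcell_le: "infcell w a h i x \<le> w x"
  unfolding infcell_def by (rule INF_lower) simp

lemma ennreal_term_le_suminf: "f n \<le> (\<Sum>n::nat. f n :: ennreal)"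
  using sum_le_suminf[of f "{n}"] by simp

text \<open>One factor 2 comes from the half of the cell that \<open>\<Omega>' n\<close> leaves
  free, where the sum under \<open>MX\<close> is at least \<open>lev n\<close>; the other from
  adding up all levels \<open>lev n\<close> that lie below twice the maximal function.\<close>

lemma levels_le_4MX:
  fixes \<Omega> \<Omega>' :: "nat \<Rightarrow> (real^'n) set"
  assumes h: "0 < h" and \<Omega>: "\<And>n. \<Omega> n \<in> sets lebesgue" "\<And>n. \<Omega>' n \<in> sets lebesgue"
    and R: "\<And>n. x \<in> \<Omega> n \<Longrightarrow> \<exists>i. cell a h i x \<subseteq> \<Omega> n \<and>
      2 * emeasure lebesgue (cell a h i x \<inter> \<Omega>' n) \<le> emeasure lebesgue (cell a h i x)"
  shows "(\<Sum>n. ennreal (lev n) * indicator (\<Omega> n) x) \<le>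
    4 * MX (\<lambda>y. \<Sum>n. ennreal (lev n) * indicator (\<Omega> n - \<Omega>' n) y) x"
proof -
  define G where "G y = (\<Sum>n. ennreal (lev n) * indicator (\<Omega> n - \<Omega>' n) y)" for y
  note [measurable] = \<Omega>
  have "ennreal (lev n) \<le> 2 * MX G x" if "x \<in> \<Omega> n" for n
  proof -
    obtain i where i: "cell a h i x \<subseteq> \<Omega> n"
      "2 * emeasure lebesgue (cell a h i x \<inter> \<Omega>' n) \<le> emeasure lebesgue (cell a h i x)"
      using R[OF \<open>x \<in> \<Omega> n\<close>] by blast
    define C where "C = cell a h i x"
    have C [measurable]: "C \<in> sets lebesgue" unfolding C_def by (rule cell_sets[OF h])
    have cc: "cube (ccell a h i x)" by (rule ccell_cube[OF h])
    have nz: "emeasure lebesgue C \<noteq> 0" "emeasure lebesgue C \<noteq> top"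
      unfolding C_def emeasure_cell_eq[OF h] using cube_emeasure[OF cc] by auto
    have "ennreal (lev n) * emeasure lebesgue C \<le> ennreal (lev n) * (2 * emeasure lebesgue (C - \<Omega>' n))"
      using half_complement[OF i(2)[folded C_def] nz(2) C \<Omega>(2)] by (rule mult_left_mono) simp
    also have "\<dots> = 2 * (\<integral>\<^sup>+y\<in>C - \<Omega>' n. ennreal (lev n) \<partial>lebesgue)"
      by (subst nn_integral_cmult_indicator) (auto simp: mult_ac)
    also have "\<dots> \<le> 2 * (\<integral>\<^sup>+y\<in>C. G y \<partial>lebesgue)"
    proof (intro mult_left_mono nn_integral_mono)
      fix y
      show "ennreal (lev n) * indicator (C - \<Omega>' n) y \<le> G y * indicator C y"
      proof (cases "y \<in> C - \<Omega>' n")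
        case True
        then have "y \<in> \<Omega> n - \<Omega>' n" using i(1) by (auto simp: C_def)
        then have "ennreal (lev n) \<le> G y"
          unfolding G_def using sum_le_suminf[of "\<lambda>n. ennreal (lev n) * indicator (\<Omega> n - \<Omega>' n) y" "{n}"] by simp
        then show ?thesis using True by simp
      qed simp
    qed simp
    also have "\<dots> \<le> 2 * (MX G x * emeasure lebesgue C)"
      using MX_upper[OF cc subsetD[OF cell_subset_ccell[OF h] cell_self], of G]
      unfolding C_def nn_cell[OF h] emeasure_cell_eq[OF h] by (intro mult_left_mono) auto
    finally have "ennreal (lev n) * emeasure lebesgue C \<le> (2 * MX G x) * emeasure lebesgue C" by (simp add: mult.assoc)
    then have "ennreal (lev n) \<le> (2 * MX G x) * emeasure lebesgue C / emeasure lebesgue C"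
      using nz by (metis divide_right_mono_ennreal ennreal_mult_divide_eq)
    then show ?thesis using nz by (simp add: ennreal_mult_divide_eq)
  qed
  then have "(\<Sum>n. ennreal (lev n) * indicator (\<Omega> n) x) \<le> 2 * (2 * MX G x)" by (rule suminf_lev_le)
  also have "2 * (2 * MX G x) = 4 * MX G x" by (simp add: mult.assoc[symmetric])
  finally show ?thesis by (simp add: G_def[abs_def])
qed

lemma cell_inv_infcell: "cell_inv a h (\<lambda>i x. t < infcell w a h i x)"
  by (auto simp: cell_inv_def infcell_def cell_eq)

text \<open>One \<open>Y\<close> serves all cells of a grid at once. The decay
  \<open>\<theta> ^ k\<close> of the generations beats the growth \<open>(k + 1) powr r\<close> of
  the oscillation, so they can be added, with summable weights, into a single element of the unit
  ball.\<close>

lemma dyadic_oscillation: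
  fixes b s :: "real^'n \<Rightarrow> real"
  assumes s: "s \<in> borel_measurable lebesgue" "\<And>x. 1 \<le> s x" "AE x in lebesgue. s x \<le> S"
    and A: "ballbd s A" "0 < A" and b: "bmo_bd b B" and r: "0 \<le> r"
  obtains C where "0 < C"
    "\<And>w a h. w \<in> borel_measurable lebesgue \<Longrightarrow> mdl s w \<le> 1 \<Longrightarrow> 0 < h \<Longrightarrow>
      \<exists>Y\<in>borel_measurable lebesgue. mdl s Y \<le> 1 \<and> (AE x in lebesgue. \<forall>i.
        ennreal (\<bar>b x - cavg (ccell a h i x) b\<bar> powr r) * infcell w a h i x \<le> ennreal C * Y x)"
proof -
  define c where "c = jn_const CARD('n) B"
  have B: "0 < B" and loc: "loc_integrable b" using b by (auto simp: bmo_bd_def)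
  have c: "0 < c" unfolding c_def by (rule jn_const_pos[OF B])
  obtain \<theta> where \<theta>: "0 < \<theta>" "\<theta> < 1"
    and dec: "\<And>H H' G. H \<in> borel_measurable lebesgue \<Longrightarrow> H' \<in> borel_measurable lebesgue \<Longrightarrow> G \<in> borel_measurable lebesgue \<Longrightarrow>
      (\<And>x. H x = H' x + G x) \<Longrightarrow> (\<And>x. H x \<le> 4 * MX G x) \<Longrightarrow> mdl s H \<le> 1 \<Longrightarrow>
      mdl s (\<lambda>x. ennreal (1 / \<theta>) * H' x) \<le> 1"
    using mdl_decay[OF s A] by blast
  \<comment> \<open>The factor 4 collects two losses: \<open>H 0 \<le> 2 * w\<close>, which enters
    the normalisation of \<open>F\<close>, and \<open>m \<le> 2 * lev n\<close> from the dyadic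
    bracket of the infimum.\<close>
  define \<mu> where "\<mu> k = 4 * ((2 * (real k + 1) * c) powr r * \<theta> ^ k)" for k :: nat
  have "summable (\<lambda>k::nat. 4 * ((2 * c) powr r * ((real k + 1) powr r * \<theta> ^ k)))"
    by (intro summable_mult summable_poly_geometric \<theta>)
  moreover have "4 * ((2 * c) powr r * ((real k + 1) powr r * \<theta> ^ k)) = \<mu> k" for k
  proof -
    have "2 * (real k + 1) * c = (2 * c) * (real k + 1)" by simp
    then have "\<mu> k = 4 * (((2 * c) * (real k + 1)) powr r * \<theta> ^ k)" by (simp only: \<mu>_def)
    also have "((2 * c) * (real k + 1)) powr r = (2 * c) powr r * (real k + 1) powr r"
      by (rule powr_mult)
    finally show ?thesis by simp
  qed
  ultimately have \<mu>_sum: "summable \<mu>" by simp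
  have \<mu>_pos: "0 < \<mu> k" for k using \<theta> c by (simp add: \<mu>_def)
  define L where "L = suminf \<mu>"
  have L: "0 < L" unfolding L_def by (rule suminf_pos[OF \<mu>_sum \<mu>_pos])
  show thesis
  proof (rule that[OF L])
    fix w :: "real^'n \<Rightarrow> ennreal" and a :: "real^'n" and h :: real
    assume w [measurable]: "w \<in> borel_measurable lebesgue" and w1: "mdl s w \<le> 1" and h: "0 < h"
    define \<Psi> where "\<Psi> n i x \<longleftrightarrow> ennreal (lev n) < infcell w a h i x" for n i x
    have \<Psi>: "cell_inv a h (\<Psi> n)" for n unfolding \<Psi>_def[abs_def] by (rule cell_inv_infcell)
    define \<Omega> where "\<Omega> n k = stop_set b a h c (\<Psi> n) k" for n k
    have \<Omega> [measurable]: "\<Omega> n k \<in> sets lebesgue" for n k unfolding \<Omega>_def by (rule stop_set_sets[OF h \<Psi>])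
    define H where "H k x = (\<Sum>n. ennreal (lev n) * indicator (\<Omega> n k) x)" for k x
    define G where "G k x = (\<Sum>n. ennreal (lev n) * indicator (\<Omega> n k - \<Omega> n (Suc k)) x)" for k x
    have Hm [measurable]: "H k \<in> borel_measurable lebesgue" for k unfolding H_def[abs_def] by measurable
    have Gm [measurable]: "G k \<in> borel_measurable lebesgue" for k unfolding G_def[abs_def] by measurable
    have HG: "H k x = H (Suc k) x + G k x" for k x
    proof -
      have "indicator (\<Omega> n k) x = indicator (\<Omega> n (Suc k)) x + (indicator (\<Omega> n k - \<Omega> n (Suc k)) x :: ennreal)" for n
        using stop_set_Suc[of c b a h "\<Psi> n" k] c by (auto simp: \<Omega>_def indicator_def)
      then show ?thesis
        unfolding H_def G_def by (subst suminf_add) (auto simp: distrib_left[symmetric])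
    qed
    have HM: "H k x \<le> 4 * MX (G k) x" for k x
      unfolding H_def G_def[abs_def]
    proof (rule levels_le_4MX[OF h, where a = a])
      fix n assume "x \<in> \<Omega> n k"
      then obtain i where "stop_at b a h c (\<Psi> n) k i x" by (auto simp: \<Omega>_def stop_set_def)
      then obtain i where i: "first_at (stop_at b a h c (\<Psi> n) k) i x" using first_at_exists by metis
      have "cell a h i x \<subseteq> \<Omega> n k"
      proof
        fix y assume "y \<in> cell a h i x"
        then have "stop_at b a h c (\<Psi> n) k i y" using i cell_invD[OF stop_at_inv[OF \<Psi>]] by (auto simp: first_at_def)
        then show "y \<in> \<Omega> n k" by (auto simp: \<Omega>_def stop_set_def)
      qed
      then show "\<exists>i. cell a h i x \<subseteq> \<Omega> n k \<and>
          2 * emeasure lebesgue (cell a h i x \<inter> \<Omega> n (Suc k)) \<le> emeasure lebesgue (cell a h i x)"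
        using stop_set_half[OF b h \<Psi> c_def i] by (auto simp: \<Omega>_def)
    qed measurable
    have H0: "H 0 x \<le> 2 * w x" for x
      unfolding H_def
    proof (rule suminf_lev_le)
      fix n assume "x \<in> \<Omega> n 0"
      then obtain i where "\<Psi> n i x" by (auto simp: \<Omega>_def stop_set_def stop_at_def first_at_def)
      then show "ennreal (lev n) \<le> w x"
        using infcell_le[of w a h i x] by (auto simp: \<Psi>_def)
    qed
    define F where "F k x = ennreal (1 / (2 * \<theta> ^ k)) * H k x" for k x
    have Fm [measurable]: "F k \<in> borel_measurable lebesgue" for k unfolding F_def[abs_def] by measurable
    have s0: "0 \<le> s x" for x using s(2)[of x] by simp
    have F1: "mdl s (F k) \<le> 1" for k
    proof (induction k)
      case 0
      have half: "ennreal (1/2) * ennreal 2 = 1" by (subst ennreal_mult[symmetric]) auto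
      have "F 0 x \<le> w x" for x
      proof -
        have "F 0 x \<le> ennreal (1/2) * (ennreal 2 * w x)"
          unfolding F_def using H0[of x] by (simp add: mult_left_mono)
        also have "\<dots> = w x" by (simp only: mult.assoc[symmetric] half mult_1)
        finally show ?thesis .
      qed
      then have "mdl s (F 0) \<le> mdl s w" by (intro mdl_mono s0)
      then show ?case using w1 by simp
    next
      case (Suc k)
      define q where "q = ennreal (1 / (2 * \<theta> ^ k))"
      have "mdl s (\<lambda>x. ennreal (1 / \<theta>) * (q * H (Suc k) x)) \<le> 1"
      proof (rule dec[where H = "F k" and G = "\<lambda>x. q * G k x"])
        show "F k x = q * H (Suc k) x + q * G k x" for x
          by (simp add: F_def q_def HG[of k] distrib_left)
        show "F k x \<le> 4 * MX (\<lambda>x. q * G k x) x" for x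
          using mult_left_mono[OF HM[of k x], of q] unfolding MX_cmult[OF Gm] by (simp add: F_def q_def mult_ac)
      qed (use Suc in auto)
      moreover have "ennreal (1 / \<theta>) * (q * H (Suc k) x) = F (Suc k) x" for x
      proof -
        have "ennreal (1 / \<theta>) * q = ennreal (1 / (2 * \<theta> ^ Suc k))"
          unfolding q_def using \<theta> by (subst ennreal_mult[symmetric]) (auto simp: field_simps)
        then show ?thesis by (simp only: F_def mult.assoc[symmetric])
      qed
      ultimately show ?case by (simp add: F_def[abs_def])
    qed
    define l where "l k = ennreal (\<mu> k / L)" for k
    define Y where "Y x = (\<Sum>k. l k * F k x)" for x
    have lsum: "(\<Sum>k. l k) \<le> 1"
    proof -
      have "(\<lambda>k. \<mu> k / L) sums (L / L)" unfolding L_def by (intro sums_divide summable_sums \<mu>_sum)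
      then have "(\<Sum>k. l k) = ennreal (L / L)"
        unfolding l_def using \<mu>_pos L by (intro suminf_ennreal_eq) (auto intro: less_imp_le)
      then show ?thesis using L by simp
    qed
    have Ym: "Y \<in> borel_measurable lebesgue" unfolding Y_def[abs_def] l_def by measurable
    have Y1: "mdl s Y \<le> 1" unfolding Y_def[abs_def] by (rule mdl_jensen[OF s(1,2) lsum Fm F1])
    have LY: "ennreal L * Y x = (\<Sum>k. 2 * (ennreal ((2 * (real k + 1) * c) powr r) * H k x))" for x
    proof -
      have "ennreal L * Y x = (\<Sum>k. ennreal L * (l k * F k x))" by (simp add: Y_def ennreal_suminf_cmult)
      also have "\<dots> = (\<Sum>k. 2 * (ennreal ((2 * (real k + 1) * c) powr r) * H k x))"
      proof (rule suminf_cong)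
        fix k
        have "ennreal L * (l k * F k x) = ennreal (L * (\<mu> k / L) * (1 / (2 * \<theta> ^ k))) * H k x"
        proof -
          have p: "0 \<le> L" "0 \<le> \<mu> k / L" "0 \<le> 1 / (2 * \<theta> ^ k)" "0 \<le> L * (\<mu> k / L)"
            using L \<mu>_pos[of k] \<theta> by (auto intro: less_imp_le)
          show ?thesis
            unfolding l_def F_def ennreal_mult[OF p(4,3)] ennreal_mult[OF p(1,2)] by (simp only: mult.assoc)
        qed
        also have "L * (\<mu> k / L) * (1 / (2 * \<theta> ^ k)) = 2 * (2 * (real k + 1) * c) powr r"
          using L \<theta> by (simp add: \<mu>_def)
        also have "ennreal \<dots> * H k x = 2 * (ennreal ((2 * (real k + 1) * c) powr r) * H k x)"
          by (subst ennreal_mult) (auto simp: mult.assoc)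
        finally show "ennreal L * (l k * F k x) = 2 * (ennreal ((2 * (real k + 1) * c) powr r) * H k x)" .
      qed
      finally show ?thesis .
    qed
    have "AE x in lebesgue. \<forall>i. ennreal (\<bar>b x - cavg (ccell a h i x) b\<bar> powr r) * infcell w a h i x \<le> ennreal L * Y x"
      using cavg_frequently_gt[OF h loc, of a] cavg_frequently_lt[OF h loc, of a] mdl_finite_AE[OF s(1) w w1]
    proof eventually_elim
      case (elim x)
      show ?case
      proof
        fix i
        define m where "m = infcell w a h i x"
        show "ennreal (\<bar>b x - cavg (ccell a h i x) b\<bar> powr r) * infcell w a h i x \<le> ennreal L * Y x"
        proof (cases "m = 0")
          case False
          \<comment> \<open>Almost everywhere \<open>w x\<close> is finite, and then so is the
            infimum over a cell of \<open>x\<close>. The level \<open>lev n\<close> just below it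
            selects the stopping family to use.\<close>
          have "m \<noteq> top" using elim(3) infcell_le[of w a h i x] by (auto simp: m_def top_unique)
          with False obtain n where n: "ennreal (lev n) < m" "m \<le> ennreal (2 * lev n)" by (rule lev_bracket)
          then have "\<Psi> n i x" by (simp add: \<Psi>_def m_def)
          then obtain i0 where i0: "i0 \<le> i" "first_at (\<Psi> n) i0 x" using first_at_exists by metis
          have "ennreal (\<bar>b x - cavg (ccell a h i x) b\<bar> powr r) * m
              \<le> ennreal (\<bar>b x - cavg (ccell a h i x) b\<bar> powr r) * ennreal (2 * lev n)"
            by (intro mult_left_mono n) simp
          also have "\<dots> \<le> (\<Sum>k. ennreal ((2 * (real k + 1) * c) powr r) * indicator (\<Omega> n k) x * ennreal (2 * lev n))"
            unfolding \<Omega>_def by (rule stop_at_sum[OF elim(1,2) i0(2,1) c r])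
          also have "\<dots> \<le> ennreal L * Y x"
            unfolding LY
          proof (intro suminf_le allI)
            fix k
            have "indicator (\<Omega> n k) x * ennreal (lev n) \<le> H k x"
              unfolding H_def using ennreal_term_le_suminf[of "\<lambda>n. ennreal (lev n) * indicator (\<Omega> n k) x" n]
              by (simp only: mult.commute)
            then have "ennreal ((2 * (real k + 1) * c) powr r) * (indicator (\<Omega> n k) x * ennreal (lev n))
                \<le> ennreal ((2 * (real k + 1) * c) powr r) * H k x" by (rule mult_left_mono) simp
            then have "2 * (ennreal ((2 * (real k + 1) * c) powr r) * (indicator (\<Omega> n k) x * ennreal (lev n)))
                \<le> 2 * (ennreal ((2 * (real k + 1) * c) powr r) * H k x)" by (rule mult_left_mono) simp
            moreover have "ennreal (2 * lev n) = 2 * ennreal (lev n)" by (subst ennreal_mult) (auto intro: less_imp_le)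
            ultimately show "ennreal ((2 * (real k + 1) * c) powr r) * indicator (\<Omega> n k) x * ennreal (2 * lev n)
                \<le> 2 * (ennreal ((2 * (real k + 1) * c) powr r) * H k x)" by (simp only: mult_ac)
          qed auto
          finally show ?thesis by (simp add: m_def)
        qed (simp add: m_def[symmetric])
      qed
    qed
    then show "\<exists>Y\<in>borel_measurable lebesgue. mdl s Y \<le> 1 \<and> (AE x in lebesgue. \<forall>i.
        ennreal (\<bar>b x - cavg (ccell a h i x) b\<bar> powr r) * infcell w a h i x \<le> ennreal L * Y x)"
      using Ym Y1 by blast
  qed
qed

section \<open>The maximal commutator\<close>

lemma powr_add_le:
  fixes u v r :: real
  assumes "0 \<le> u" "0 \<le> v" "0 \<le> r"
  shows "(u + v) powr r \<le> 2 powr r * (u powr r + v powr r)"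
proof -
  have "(u + v) powr r \<le> (2 * max u v) powr r" using assms by (intro powr_mono2) auto
  also have "\<dots> = 2 powr r * max u v powr r" by (rule powr_mult)
  also have "max u v powr r \<le> u powr r + v powr r" by (cases "u \<le> v") (auto simp: max_def)
  finally show ?thesis by (simp add: mult_left_mono)
qed

lemma powr_add3_le:
  fixes u v k r :: real
  assumes "0 \<le> u" "0 \<le> v" "0 \<le> k" "0 \<le> r"
  shows "(u + (v + k)) powr r \<le> 4 powr r * (u powr r + (v powr r + k powr r))"
proof -
  have one: "1 \<le> 2 powr r" using assms by (intro ge_one_powr_ge_zero) auto
  have "(u + (v + k)) powr r \<le> 2 powr r * (u powr r + (v + k) powr r)"
    using assms by (intro powr_add_le) auto
  also have "\<dots> \<le> 2 powr r * (2 powr r * u powr r + 2 powr r * (v powr r + k powr r))"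
    using assms one powr_add_le[of v k r] by (intro mult_left_mono add_mono) (auto simp: mult_le_cancel_right1)
  also have "\<dots> = (2 * 2) powr r * (u powr r + (v powr r + k powr r))"
    unfolding powr_mult by (simp add: algebra_simps)
  finally show ?thesis by simp
qed

lemma mdl_combine:
  assumes s: "s \<in> borel_measurable lebesgue" "\<And>x. 1 \<le> s x"
    and F: "F \<in> borel_measurable lebesgue" "mdl s F \<le> 1" and G: "G \<in> borel_measurable lebesgue" "mdl s G \<le> 1"
  obtains Z where "Z \<in> borel_measurable lebesgue" "mdl s Z \<le> 1" "\<And>x. F x \<le> 4 * Z x" "\<And>x. G x \<le> 4 * Z x"
proof -
  \<comment> \<open>The series puts weight \<open>1/2\<close> on \<open>F\<close> and
    \<open>1/4\<close> on the first copy of \<open>G\<close>, hence the factor 4.\<close>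
  define X where "X k = (if k = (0::nat) then F else G)" for k
  define l where "l k = ennreal ((1/2) ^ Suc k)" for k
  have X: "X k \<in> borel_measurable lebesgue" "mdl s (X k) \<le> 1" for k using F G by (auto simp: X_def)
  have "(\<lambda>k. (1/2) ^ Suc k :: real) sums 1" by (rule power_half_series)
  then have "(\<Sum>k. l k) = ennreal 1" unfolding l_def by (intro suminf_ennreal_eq) auto
  then have lsum: "(\<Sum>k. l k) \<le> 1" by simp
  define Z where "Z x = (\<Sum>k. l k * X k x)" for x
  have "Z \<in> borel_measurable lebesgue" unfolding Z_def[abs_def] l_def using X(1) by measurable
  moreover have "mdl s Z \<le> 1" unfolding Z_def[abs_def] by (rule mdl_jensen[OF s lsum X])
  moreover have "X k x \<le> 4 * Z x" if "k \<le> 1" for k x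
  proof -
    have "1 \<le> 4 * (1/2::real) ^ Suc k" using that by (cases k) auto
    then have "1 \<le> ennreal (4 * (1/2) ^ Suc k)" by (simp only: ennreal_ge_1)
    also have "\<dots> = 4 * l k" unfolding l_def by (subst ennreal_mult) auto
    finally have "1 * X k x \<le> 4 * l k * X k x" by (rule mult_right_mono) simp
    also have "\<dots> = 4 * (l k * X k x)" by (simp add: mult.assoc)
    also have "\<dots> \<le> 4 * Z x"
      unfolding Z_def by (intro mult_left_mono ennreal_term_le_suminf[of "\<lambda>k. l k * X k x"]) simp
    finally show ?thesis by simp
  qed
  from this[of 0] this[of 1] have "F x \<le> 4 * Z x" "G x \<le> 4 * Z x" for x by (auto simp: X_def)
  ultimately show thesis by (rule that)
qed

text \<open>The level \<open>i\<close> is chosen so that \<open>h / 2 ^ i\<close> lies between the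
  side of \<open>Q\<close> and twice that side, and \<open>P\<close> is the threefold enlargement of
  the cell of \<open>x\<close>; hence the factors 3 and \<open>6 = 3 * 2\<close>. The size condition
  on \<open>Q\<close> guarantees that the grid has so coarse a level.\<close>

lemma cube_cover_cell:
  fixes x :: "real^'n"
  assumes "cube Q" "x \<in> Q" "0 < h" "measure lebesgue Q \<le> h ^ CARD('n)"
  obtains i P where "cube P" "Q \<subseteq> P" "ccell a h i x \<subseteq> P"
    "measure lebesgue P \<le> 3 ^ CARD('n) * measure lebesgue (ccell a h i x)"
    "measure lebesgue P \<le> 6 ^ CARD('n) * measure lebesgue Q"
proof -
  obtain q l where l: "0 < l" "Q = cbox q (q + l *\<^sub>R One)" "measure lebesgue Q = l ^ CARD('n)"
    using cubeE[OF assms(1)] by metis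
  have "l \<le> h" using assms(3,4) l power_mono_iff[of l h "CARD('n)"] by simp
  obtain m where "(1/2) ^ m < l / h" using real_arch_pow_inv[of "l / h" "1/2"] l assms(3) by auto
  then have "h / 2 ^ m < l" using assms(3) by (simp add: power_one_over field_simps)
  define j where "j = (LEAST j. h / 2 ^ j < l)"
  have j: "h / 2 ^ j < l" unfolding j_def by (rule LeastI) fact
  have "j \<noteq> 0" using j \<open>l \<le> h\<close> by (intro notI) simp
  then obtain i where i: "j = Suc i" by (cases j) auto
  then have "\<not> h / 2 ^ i < l" unfolding j_def by (metis lessI not_less_Least)
  define d where "d = h / 2 ^ i"
  have d: "0 < d" "l \<le> d" "d < 2 * l" using \<open>\<not> h / 2 ^ i < l\<close> j i assms(3) by (auto simp: d_def field_simps)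
  define P where "P = cbox (corner a h i x - d *\<^sub>R One) ((corner a h i x - d *\<^sub>R One) + (3 * d) *\<^sub>R One)"
  have xc: "corner a h i x $ k \<le> x $ k" "x $ k < corner a h i x $ k + d" for k
    using cell_self[of x a h i] unfolding mem_cell_iff[OF assms(3)] d_def by auto
  have mP: "measure lebesgue P = (3 * d) ^ CARD('n)"
    unfolding P_def using d by (simp add: measure_def emeasure_cube)
  show thesis
  proof
    show "cube P" unfolding P_def using d by (intro cube_cbox) simp
    show "Q \<subseteq> P"
    proof
      fix y assume "y \<in> Q"
      then have y: "q $ k \<le> y $ k" "y $ k \<le> q $ k + l" for k unfolding l(2) mem_cube_iff by auto
      have x: "q $ k \<le> x $ k" "x $ k \<le> q $ k + l" for k using assms(2) unfolding l(2) mem_cube_iff by auto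
      have "corner a h i x $ k - d \<le> y $ k \<and> y $ k \<le> corner a h i x $ k - d + 3 * d" for k
        using x[of k] y[of k] xc[of k] d by linarith
      then show "y \<in> P" unfolding P_def mem_cube_iff by simp
    qed
    show "ccell a h i x \<subseteq> P"
    proof
      fix y assume "y \<in> ccell a h i x"
      then have "corner a h i x $ k \<le> y $ k" "y $ k \<le> corner a h i x $ k + d" for k
        unfolding ccell_def mem_cube_iff d_def by auto
      then have "corner a h i x $ k - d \<le> y $ k \<and> y $ k \<le> corner a h i x $ k - d + 3 * d" for k
        using d(1) by (smt (verit))
      then show "y \<in> P" unfolding P_def mem_cube_iff by simp
    qed
    show "measure lebesgue P \<le> 3 ^ CARD('n) * measure lebesgue (ccell a h i x)"
      unfolding mP measure_ccell[OF assms(3)] d_def power_mult_distrib by simp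
    have "(3 * d) ^ CARD('n) \<le> (6 * l) ^ CARD('n)" using d by (intro power_mono) auto
    then show "measure lebesgue P \<le> 6 ^ CARD('n) * measure lebesgue Q"
      unfolding mP l(3) power_mult_distrib .
  qed
qed

text \<open>Compare \<open>b x\<close> with \<open>b y\<close> through the means over the cell of
  \<open>x\<close> and over \<open>Q\<close>. The first difference does not depend on
  \<open>y\<close> and meets the infimum of \<open>w\<close> over the cell, which controls the mean
  of \<open>w\<close> over \<open>Q\<close> by the maximal bound on the common enlargement
  \<open>P\<close>. The oscillation over \<open>Q\<close> is absorbed by \<open>C2\<close>, and the
  two means differ by a constant.\<close>

lemma maximal_commutator_local:
  fixes b :: "real^'n \<Rightarrow> real" and w :: "real^'n \<Rightarrow> ennreal"
  assumes b: "bmo_bd b B" and r: "0 \<le> r" and w: "w \<in> borel_measurable lebesgue"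
    and A: "\<And>x. MX w x \<le> ennreal A * w x" "0 < A"
    and C2: "(\<integral>\<^sup>+y\<in>Q. ennreal (\<bar>b y - cavg Q b\<bar> powr r) * w y \<partial>lebesgue) \<le> ennreal C2 * (\<integral>\<^sup>+y\<in>Q. w y \<partial>lebesgue)" "0 < C2"
    and Q: "cube Q" "x \<in> Q" "0 < h" "measure lebesgue Q \<le> h ^ CARD('n)"
  shows "\<exists>i. (\<integral>\<^sup>+y\<in>Q. ennreal ((\<bar>b x - b y\<bar> + 1) powr r) * w y \<partial>lebesgue) \<le>
    ennreal (4 powr r * 6 ^ CARD('n) * A) * (ennreal (\<bar>b x - cavg (ccell a h i x) b\<bar> powr r) * infcell w a h i x +
       ennreal (C2 + ((6 ^ CARD('n) + 3 ^ CARD('n)) * B + 1) powr r) * w x) * emeasure lebesgue Q"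
proof -
  have loc: "loc_integrable b" and B: "0 < B" using b by (auto simp: bmo_bd_def)
  note [measurable] = loc_integrable_measurable[OF loc] w cube_sets[OF Q(1)]
  obtain i P where P: "cube P" "Q \<subseteq> P" "ccell a h i x \<subseteq> P"
    "measure lebesgue P \<le> 3 ^ CARD('n) * measure lebesgue (ccell a h i x)"
    "measure lebesgue P \<le> 6 ^ CARD('n) * measure lebesgue Q"
    using cube_cover_cell[OF Q] by metis
  define \<beta> where "\<beta> = cavg (ccell a h i x) b"
  define m where "m = infcell w a h i x"
  define J where "J = (\<integral>\<^sup>+y\<in>Q. w y \<partial>lebesgue)"
  \<comment> \<open>Bounds the distance between the means over \<open>Q\<close> and over the cell,
    both compared with the mean over \<open>P\<close>, plus the 1 of the kernel.\<close>
  define k where "k = (6 ^ CARD('n) + 3 ^ CARD('n)) * B + 1"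
  define u where "u = \<bar>b x - \<beta>\<bar>"
  define E where "E = ennreal (6 ^ CARD('n) * A)"
  have k: "0 < k" unfolding k_def using B by (intro add_nonneg_pos mult_nonneg_nonneg) auto
  have avg: "\<bar>cavg Q b - \<beta>\<bar> + 1 \<le> k"
    using cavg_nested[OF b Q(1) P(1,2,5)] cavg_nested[OF b ccell_cube[OF Q(3)] P(1,3,4)]
    unfolding k_def \<beta>_def by (simp add: distrib_right)
  have J: "J \<le> E * m * emeasure lebesgue Q"
  proof -
    have nz: "E * emeasure lebesgue Q \<noteq> 0" "E * emeasure lebesgue Q \<noteq> top"
      using A(2) cube_emeasure[OF Q(1)] by (auto simp: E_def ennreal_mult_eq_top_iff ennreal_eq_0_iff not_le)
    have "J / (E * emeasure lebesgue Q) \<le> w z" if z: "z \<in> cell a h i x" for z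
    proof -
      have zP: "z \<in> P" using z cell_subset_ccell[OF Q(3)] P(3) by blast
      have "J \<le> (\<integral>\<^sup>+y\<in>P. w y \<partial>lebesgue)"
        unfolding J_def using P(2) by (intro nn_integral_mono mult_left_mono) (auto simp: indicator_def)
      also have "\<dots> \<le> MX w z * emeasure lebesgue P" by (rule MX_upper[OF P(1) zP])
      also have "\<dots> \<le> (ennreal A * w z) * (ennreal (6 ^ CARD('n)) * emeasure lebesgue Q)"
      proof (intro mult_mono A)
        show "emeasure lebesgue P \<le> ennreal (6 ^ CARD('n)) * emeasure lebesgue Q"
          unfolding cube_emeasure(1)[OF P(1)] cube_emeasure(1)[OF Q(1)]
          using P(5) by (subst ennreal_mult[symmetric]) (auto intro: ennreal_leI)
      qed auto
      also have "\<dots> = w z * (E * emeasure lebesgue Q)"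
        unfolding E_def using A(2) by (simp add: ennreal_mult mult_ac)
      finally show ?thesis by (rule ennreal_divide_le_iff_mult[OF nz, THEN iffD2])
    qed
    then have "J / (E * emeasure lebesgue Q) \<le> m" unfolding m_def infcell_def by (rule INF_greatest)
    then have "J \<le> m * (E * emeasure lebesgue Q)" by (rule ennreal_divide_le_iff_mult[OF nz, THEN iffD1])
    then show ?thesis by (simp only: mult_ac)
  qed
  have "(\<integral>\<^sup>+y\<in>Q. ennreal ((\<bar>b x - b y\<bar> + 1) powr r) * w y \<partial>lebesgue) \<le>
    (\<integral>\<^sup>+y. ennreal (4 powr r) * (ennreal (u powr r) * (w y * indicator Q y) +
      (ennreal (\<bar>b y - cavg Q b\<bar> powr r) * w y * indicator Q y + ennreal (k powr r) * (w y * indicator Q y))) \<partial>lebesgue)"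
  proof (intro nn_integral_mono)
    fix y
    have "\<bar>b x - b y\<bar> + 1 \<le> u + (\<bar>b y - cavg Q b\<bar> + k)"
      using avg unfolding u_def by linarith
    then have "(\<bar>b x - b y\<bar> + 1) powr r \<le> (u + (\<bar>b y - cavg Q b\<bar> + k)) powr r"
      using r by (intro powr_mono2) auto
    also have "\<dots> \<le> 4 powr r * (u powr r + (\<bar>b y - cavg Q b\<bar> powr r + k powr r))"
      using r k by (intro powr_add3_le) (auto simp: u_def)
    finally have "ennreal ((\<bar>b x - b y\<bar> + 1) powr r) \<le>
        ennreal (4 powr r) * (ennreal (u powr r) + (ennreal (\<bar>b y - cavg Q b\<bar> powr r) + ennreal (k powr r)))"
      by (simp add: ennreal_leI flip: ennreal_mult ennreal_plus)
    then have "ennreal ((\<bar>b x - b y\<bar> + 1) powr r) * (w y * indicator Q y) \<le>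
        ennreal (4 powr r) * (ennreal (u powr r) + (ennreal (\<bar>b y - cavg Q b\<bar> powr r) + ennreal (k powr r))) * (w y * indicator Q y)"
      by (rule mult_right_mono) simp
    then show "ennreal ((\<bar>b x - b y\<bar> + 1) powr r) * w y * indicator Q y \<le>
      ennreal (4 powr r) * (ennreal (u powr r) * (w y * indicator Q y) +
      (ennreal (\<bar>b y - cavg Q b\<bar> powr r) * w y * indicator Q y + ennreal (k powr r) * (w y * indicator Q y)))"
      by (simp only: distrib_left distrib_right mult.assoc)
  qed
  also have "\<dots> = ennreal (4 powr r) * (ennreal (u powr r) * J +
      ((\<integral>\<^sup>+y\<in>Q. ennreal (\<bar>b y - cavg Q b\<bar> powr r) * w y \<partial>lebesgue) + ennreal (k powr r) * J))"
    unfolding J_def by (simp add: nn_integral_add nn_integral_cmult)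
  also have "\<dots> \<le> ennreal (4 powr r) * (ennreal (u powr r) * J + (ennreal C2 * J + ennreal (k powr r) * J))"
    using C2(1) by (intro mult_left_mono add_mono order_refl) (auto simp: J_def)
  also have "\<dots> = ennreal (4 powr r) * ((ennreal (u powr r) + ennreal (C2 + k powr r)) * J)"
    using C2(2) by (simp add: distrib_right ennreal_plus)
  also have "\<dots> \<le> ennreal (4 powr r) * ((ennreal (u powr r) + ennreal (C2 + k powr r)) * (E * m * emeasure lebesgue Q))"
    by (intro mult_left_mono J) auto
  also have "\<dots> = (ennreal (4 powr r) * E) * (ennreal (u powr r) * m + ennreal (C2 + k powr r) * m) * emeasure lebesgue Q"
    by (simp only: distrib_left distrib_right mult_ac)
  also have "\<dots> \<le> (ennreal (4 powr r) * E) * (ennreal (u powr r) * m + ennreal (C2 + k powr r) * w x) * emeasure lebesgue Q"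
    by (intro mult_right_mono mult_left_mono add_mono order_refl) (auto simp: m_def intro: infcell_le)
  also have "ennreal (4 powr r) * E = ennreal (4 powr r * 6 ^ CARD('n) * A)"
    unfolding E_def using A(2) by (subst ennreal_mult[symmetric]) (auto simp: mult.assoc)
  finally show ?thesis unfolding u_def \<beta>_def m_def k_def by blast
qed

text \<open>The exceptional set must not depend on the uncountably many \<open>Q\<close>; it arises
  from the countably many grids of side \<open>2 ^ k\<close> alone. Each grid handles the cubes up
  to its size with a majorant \<open>Z k\<close> of its own, and by Fatou's lemma the lower limit
  \<open>Y\<close> of the \<open>Z k\<close> stays in the unit ball.\<close>

theorem maximal_commutator:
  fixes b s :: "real^'n \<Rightarrow> real"
  assumes s: "s \<in> borel_measurable lebesgue" "\<And>x. 1 \<le> s x" "AE x in lebesgue. s x \<le> S"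
    and A: "ballbd s A" "0 < A" and b: "bmo_bd b B" and r: "0 \<le> r"
  obtains C where "0 < C"
    "\<And>F. F \<in> borel_measurable lebesgue \<Longrightarrow> mdl s F \<le> 1 \<Longrightarrow>
      \<exists>Y\<in>borel_measurable lebesgue. mdl s Y \<le> 1 \<and> (AE x in lebesgue. \<forall>Q. cube Q \<longrightarrow> x \<in> Q \<longrightarrow>
        (\<integral>\<^sup>+y\<in>Q. ennreal ((\<bar>b x - b y\<bar> + 1) powr r) * F y \<partial>lebesgue) \<le> ennreal C * Y x * emeasure lebesgue Q)"
proof -
  have loc: "loc_integrable b" and B: "0 < B" using b by (auto simp: bmo_bd_def)
  obtain C1 where C1: "0 < C1"
    and dy: "\<And>w a h. w \<in> borel_measurable lebesgue \<Longrightarrow> mdl s w \<le> 1 \<Longrightarrow> 0 < h \<Longrightarrow>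
      \<exists>Y\<in>borel_measurable lebesgue. mdl s Y \<le> 1 \<and> (AE x in lebesgue. \<forall>i.
        ennreal (\<bar>b x - cavg (ccell a h i x) b\<bar> powr r) * infcell w a h i x \<le> ennreal C1 * Y x)"
    using dyadic_oscillation[OF s A b r] by blast
  obtain C2 where C2: "0 < C2"
    and osc: "\<And>w Q. w \<in> borel_measurable lebesgue \<Longrightarrow> (\<And>x. MX w x \<le> ennreal (2 * A) * w x) \<Longrightarrow> cube Q \<Longrightarrow>
      (\<integral>\<^sup>+y\<in>Q. ennreal (\<bar>b y - cavg Q b\<bar> powr r) * w y \<partial>lebesgue) \<le> ennreal C2 * (\<integral>\<^sup>+y\<in>Q. w y \<partial>lebesgue)"
    using A1_oscillation[OF b r, of "2 * A"] by blast
  define E where "E = 4 powr r * 6 ^ CARD('n) * (2 * A)"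
  define K where "K = C2 + ((6 ^ CARD('n) + 3 ^ CARD('n)) * B + 1) powr r"
  \<comment> \<open>The 2 comes from \<open>F \<le> 2 * w\<close>, and each 4 from replacing
    \<open>w\<close> and the dyadic majorant by the common \<open>Z k\<close>.\<close>
  define C where "C = 2 * (E * (4 * C1 + 4 * K))"
  have E: "0 < E" using A(2) by (simp add: E_def)
  have K: "0 < K" using C2 by (simp add: K_def add_pos_nonneg)
  have C: "0 < C" using E K C1 by (simp add: C_def)
  show thesis
  proof (rule that[OF C])
    fix F :: "real^'n \<Rightarrow> ennreal"
    assume F [measurable]: "F \<in> borel_measurable lebesgue" and F1: "mdl s F \<le> 1"
    obtain w where w [measurable]: "w \<in> borel_measurable lebesgue" and w1: "mdl s w \<le> 1"
      and Fw: "\<And>x. F x \<le> 2 * w x" and Mw: "\<And>x. MX w x \<le> ennreal (2 * A) * w x"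
      using A1_majorant[OF s(1,2) A(2,1) F F1] by blast
    define good where "good k Z \<longleftrightarrow> Z \<in> borel_measurable lebesgue \<and> mdl s Z \<le> 1 \<and> (\<forall>x. w x \<le> 4 * Z x) \<and>
       (AE x in lebesgue. \<forall>i. ennreal (\<bar>b x - cavg (ccell 0 (2 ^ k) i x) b\<bar> powr r) * infcell w 0 (2 ^ k) i x \<le> ennreal C1 * (4 * Z x))"
      for k :: nat and Z
    have "\<exists>Z. good k Z" for k
    proof -
      obtain Y where Y: "Y \<in> borel_measurable lebesgue" "mdl s Y \<le> 1"
        "AE x in lebesgue. \<forall>i. ennreal (\<bar>b x - cavg (ccell 0 (2 ^ k) i x) b\<bar> powr r) * infcell w 0 (2 ^ k) i x \<le> ennreal C1 * Y x"
        using dy[OF w w1, of "2 ^ k" 0] by auto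
      obtain Z where Z: "Z \<in> borel_measurable lebesgue" "mdl s Z \<le> 1" "\<And>x. w x \<le> 4 * Z x" "\<And>x. Y x \<le> 4 * Z x"
        using mdl_combine[OF s(1,2) w w1 Y(1,2)] by blast
      have "AE x in lebesgue. \<forall>i. ennreal (\<bar>b x - cavg (ccell 0 (2 ^ k) i x) b\<bar> powr r) * infcell w 0 (2 ^ k) i x \<le> ennreal C1 * (4 * Z x)"
        using Y(3)
      proof (rule AE_mp, intro AE_I2 impI allI)
        fix x i assume "\<forall>i. ennreal (\<bar>b x - cavg (ccell 0 (2 ^ k) i x) b\<bar> powr r) * infcell w 0 (2 ^ k) i x \<le> ennreal C1 * Y x"
        then have "ennreal (\<bar>b x - cavg (ccell 0 (2 ^ k) i x) b\<bar> powr r) * infcell w 0 (2 ^ k) i x \<le> ennreal C1 * Y x" ..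
        also have "\<dots> \<le> ennreal C1 * (4 * Z x)" by (intro mult_left_mono Z) simp
        finally show "ennreal (\<bar>b x - cavg (ccell 0 (2 ^ k) i x) b\<bar> powr r) * infcell w 0 (2 ^ k) i x \<le> ennreal C1 * (4 * Z x)" .
      qed
      then show ?thesis using Z unfolding good_def by blast
    qed
    then obtain Z where "\<And>k. good k (Z k)" by metis
    then have Z [measurable]: "\<And>k::nat. Z k \<in> borel_measurable lebesgue" and Z1: "\<And>k. mdl s (Z k) \<le> 1"
      and wZ: "\<And>k x. w x \<le> 4 * Z k x"
      and ZAE: "\<And>k. AE x in lebesgue. \<forall>i. ennreal (\<bar>b x - cavg (ccell 0 (2 ^ k) i x) b\<bar> powr r) * infcell w 0 (2 ^ k) i x \<le> ennreal C1 * (4 * Z k x)"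
      by (auto simp: good_def)
    define Y where "Y x = liminf (\<lambda>k. Z k x)" for x
    have Ym: "Y \<in> borel_measurable lebesgue" unfolding Y_def[abs_def] by measurable
    have Y1: "mdl s Y \<le> 1" unfolding Y_def[abs_def] by (rule mdl_liminf[OF s(1,2) Z Z1])
    have "AE x in lebesgue. \<forall>k i. ennreal (\<bar>b x - cavg (ccell 0 (2 ^ k) i x) b\<bar> powr r) * infcell w 0 (2 ^ k) i x \<le> ennreal C1 * (4 * Z k x)"
      by (subst AE_all_countable) (rule allI[OF ZAE])
    then have "AE x in lebesgue. \<forall>Q. cube Q \<longrightarrow> x \<in> Q \<longrightarrow>
        (\<integral>\<^sup>+y\<in>Q. ennreal ((\<bar>b x - b y\<bar> + 1) powr r) * F y \<partial>lebesgue) \<le> ennreal C * Y x * emeasure lebesgue Q"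
    proof (rule AE_mp, intro AE_I2 impI allI)
      fix x Q assume *: "\<forall>k i. ennreal (\<bar>b x - cavg (ccell 0 (2 ^ k) i x) b\<bar> powr r) * infcell w 0 (2 ^ k) i x \<le> ennreal C1 * (4 * Z k x)"
        and Q: "cube Q" "x \<in> Q"
      note [measurable] = loc_integrable_measurable[OF loc] cube_sets[OF Q(1)]
      define I where "I = (\<integral>\<^sup>+y\<in>Q. ennreal ((\<bar>b x - b y\<bar> + 1) powr r) * F y \<partial>lebesgue)"
      obtain l where l: "0 < l" "measure lebesgue Q = l ^ CARD('n)" using cubeE[OF Q(1)] by metis
      obtain k0 :: nat where k0: "l < 2 ^ k0" using real_arch_pow[of 2 l] by auto
      have nz: "ennreal C * emeasure lebesgue Q \<noteq> 0" "ennreal C * emeasure lebesgue Q \<noteq> top"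
        using C cube_emeasure[OF Q(1)] by (auto simp: ennreal_mult_eq_top_iff ennreal_eq_0_iff not_le)
      \<comment> \<open>All but finitely many of the grids have top cells at least as large as
        \<open>Q\<close>, so the bound survives in the lower limit.\<close>
      have ZI: "I / (ennreal C * emeasure lebesgue Q) \<le> Z k x" if "k0 \<le> k" for k
      proof -
        have "(2::real) ^ k0 \<le> 2 ^ k" using that by (intro power_increasing) auto
        then have small: "measure lebesgue Q \<le> (2 ^ k) ^ CARD('n)"
          unfolding l(2) using k0 l(1) by (intro power_mono) linarith+
        obtain i where i: "(\<integral>\<^sup>+y\<in>Q. ennreal ((\<bar>b x - b y\<bar> + 1) powr r) * w y \<partial>lebesgue) \<le>
            ennreal E * (ennreal (\<bar>b x - cavg (ccell 0 (2 ^ k) i x) b\<bar> powr r) * infcell w 0 (2 ^ k) i x + ennreal K * w x) * emeasure lebesgue Q"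
          using maximal_commutator_local[OF b r w Mw _ osc[OF w Mw Q(1)] C2 Q _ small, of 0] A(2)
          by (auto simp: E_def K_def)
        have "I \<le> (\<integral>\<^sup>+y. 2 * (ennreal ((\<bar>b x - b y\<bar> + 1) powr r) * w y * indicator Q y) \<partial>lebesgue)"
          unfolding I_def
        proof (intro nn_integral_mono)
          fix y
          have "ennreal ((\<bar>b x - b y\<bar> + 1) powr r) * F y * indicator Q y \<le> ennreal ((\<bar>b x - b y\<bar> + 1) powr r) * (2 * w y) * indicator Q y"
            by (intro mult_right_mono mult_left_mono Fw) auto
          then show "ennreal ((\<bar>b x - b y\<bar> + 1) powr r) * F y * indicator Q y \<le> 2 * (ennreal ((\<bar>b x - b y\<bar> + 1) powr r) * w y * indicator Q y)"
            by (simp only: mult_ac)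
        qed
        also have "\<dots> = 2 * (\<integral>\<^sup>+y\<in>Q. ennreal ((\<bar>b x - b y\<bar> + 1) powr r) * w y \<partial>lebesgue)"
          by (intro nn_integral_cmult) measurable
        also have "\<dots> \<le> 2 * (ennreal E * (ennreal C1 * (4 * Z k x) + ennreal K * (4 * Z k x)) * emeasure lebesgue Q)"
        proof (intro mult_left_mono[of _ _ 2])
          have "ennreal E * (ennreal (\<bar>b x - cavg (ccell 0 (2 ^ k) i x) b\<bar> powr r) * infcell w 0 (2 ^ k) i x + ennreal K * w x) * emeasure lebesgue Q
              \<le> ennreal E * (ennreal C1 * (4 * Z k x) + ennreal K * (4 * Z k x)) * emeasure lebesgue Q"
            by (intro mult_right_mono mult_left_mono add_mono *[rule_format] wZ) auto
          with i show "(\<integral>\<^sup>+y\<in>Q. ennreal ((\<bar>b x - b y\<bar> + 1) powr r) * w y \<partial>lebesgue)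
              \<le> ennreal E * (ennreal C1 * (4 * Z k x) + ennreal K * (4 * Z k x)) * emeasure lebesgue Q"
            by (rule order_trans)
        qed simp
        also have "\<dots> = Z k x * (ennreal C * emeasure lebesgue Q)"
        proof -
          have "ennreal C = 2 * (ennreal E * (4 * ennreal C1 + 4 * ennreal K))"
            unfolding C_def using E C1 K by (simp add: ennreal_mult ennreal_plus)
          then show ?thesis by (simp only: distrib_left distrib_right mult_ac)
        qed
        finally show ?thesis by (rule ennreal_divide_le_iff_mult[OF nz, THEN iffD2])
      qed
      have "I / (ennreal C * emeasure lebesgue Q) \<le> Y x"
        unfolding Y_def by (rule Liminf_bounded) (use ZI in \<open>auto simp: eventually_sequentially\<close>)
      then have "I \<le> Y x * (ennreal C * emeasure lebesgue Q)" by (rule ennreal_divide_le_iff_mult[OF nz, THEN iffD1])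
      then show "I \<le> ennreal C * Y x * emeasure lebesgue Q" by (simp only: mult_ac)
    qed
    then show "\<exists>Y\<in>borel_measurable lebesgue. mdl s Y \<le> 1 \<and> (AE x in lebesgue. \<forall>Q. cube Q \<longrightarrow> x \<in> Q \<longrightarrow>
        (\<integral>\<^sup>+y\<in>Q. ennreal ((\<bar>b x - b y\<bar> + 1) powr r) * F y \<partial>lebesgue) \<le> ennreal C * Y x * emeasure lebesgue Q)"
      using Ym Y1 by blast
  qed
qed

section \<open>The maximal theorem for the constant exponent 2\<close>

text \<open>Vitali's lemma concerns balls. With \<open>N\<close> the dimension, a cube of side
  \<open>l\<close> lies in the ball of radius \<open>N * l\<close> about its corner, and the
  fivefold enlargement of that ball lies in a cube of side \<open>10 * N * l\<close>.\<close>

lemma weak_type_MX: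
  fixes F :: "real^'n \<Rightarrow> ennreal"
  assumes F [measurable]: "F \<in> borel_measurable lebesgue" and t: "0 < t"
  shows "ennreal t * emeasure lebesgue {x. ennreal t < MX F x} \<le>
    ennreal ((10 * real CARD('n)) ^ CARD('n)) * (\<integral>\<^sup>+x. F x \<partial>lebesgue)"
proof (cases "(\<integral>\<^sup>+x. F x \<partial>lebesgue) = top")
  case True
  then show ?thesis by (simp add: ennreal_mult_top)
next
  case False
  define N where "N = real CARD('n)"
  have N: "1 \<le> N" unfolding N_def by (simp add: Suc_leI)
  obtain I where I: "(\<integral>\<^sup>+x. F x \<partial>lebesgue) = ennreal I" "0 \<le> I"
    using False by (cases "\<integral>\<^sup>+x. F x \<partial>lebesgue") auto
  define U where "U = {x. ennreal t < MX F x}"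
  define qb where "qb = (\<lambda>(a, l). cbox a (a + l *\<^sub>R (One::real^'n)))"
  define K where "K = {(a :: real^'n, l). 0 < l \<and> ennreal t * emeasure lebesgue (qb (a, l)) < (\<integral>\<^sup>+y\<in>qb (a, l). F y \<partial>lebesgue)}"
  have qb_ball: "qb i \<subseteq> cball (fst i) (N * snd i)" if "i \<in> K" for i
  proof
    fix y assume "y \<in> qb i"
    then have in_box: "fst i $ k \<le> y $ k \<and> y $ k \<le> fst i $ k + snd i" for k
      unfolding qb_def by (simp add: case_prod_beta mem_cube_iff)
    have "0 < snd i" using that unfolding K_def case_prod_beta mem_Collect_eq by (rule conjunct1)
    then have le: "\<bar>(y - fst i) $ k\<bar> \<le> snd i" for k
      using in_box[of k] unfolding vector_minus_component by linarith
    have "norm (y - fst i) \<le> (\<Sum>k\<in>UNIV. \<bar>(y - fst i) $ k\<bar>)" by (rule norm_le_l1_cart)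
    also have "\<dots> \<le> N * snd i" unfolding N_def by (rule sum_bounded_above[OF le])
    finally show "y \<in> cball (fst i) (N * snd i)" by (simp add: dist_norm norm_minus_commute)
  qed
  have "U \<subseteq> (\<Union>i\<in>K. cball (fst i) (N * snd i))"
  proof
    fix x assume "x \<in> U"
    then obtain Q where Q: "cube Q" "x \<in> Q" "ennreal t < (\<integral>\<^sup>+y\<in>Q. F y \<partial>lebesgue) / emeasure lebesgue Q"
      by (auto simp: U_def MX_def less_SUP_iff)
    then have "ennreal t * emeasure lebesgue Q < (\<integral>\<^sup>+y\<in>Q. F y \<partial>lebesgue)"
      using ennreal_divide_le_iff_mult[OF cube_emeasure(3,4)[OF Q(1)]] by (simp add: not_le[symmetric])
    moreover obtain a l where "0 < l" "Q = cbox a (a + l *\<^sub>R One)" using cubeE[OF Q(1)] by metis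
    moreover from this have "Q = qb (a, l)" by (simp add: qb_def)
    ultimately have "(a, l) \<in> K" "x \<in> qb (a, l)" using Q(2) by (auto simp: K_def)
    then show "x \<in> (\<Union>i\<in>K. cball (fst i) (N * snd i))" using qb_ball by blast
  qed
  \<comment> \<open>The covering lemma needs bounded radii; the finite integral of \<open>F\<close>
    provides the bound.\<close>
  moreover have "0 < N * snd i \<and> N * snd i \<le> N * max 1 (I / t)" if iK: "i \<in> K" for i
  proof -
    obtain a l where i: "i = (a, l)" by force
    have l: "0 < l" and "ennreal t * emeasure lebesgue (qb (a, l)) < (\<integral>\<^sup>+y\<in>qb (a, l). F y \<partial>lebesgue)"
      using iK by (auto simp: K_def i)
    then have "ennreal t * ennreal (l ^ CARD('n)) < (\<integral>\<^sup>+y\<in>qb (a, l). F y \<partial>lebesgue)"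
      by (simp add: qb_def emeasure_cube)
    also have "\<dots> \<le> (\<integral>\<^sup>+y. F y \<partial>lebesgue)" by (intro nn_integral_mono) (auto simp: indicator_def)
    finally have "t * l ^ CARD('n) < I"
      using t l by (simp add: I ennreal_mult[symmetric] ennreal_less_iff)
    then have lI: "l ^ CARD('n) < I / t" using t by (simp add: field_simps)
    have "l \<le> max 1 (I / t)"
    proof (cases "l \<le> 1")
      case False
      then have "l ^ 1 \<le> l ^ CARD('n)" by (intro power_increasing) (auto simp: Suc_leI)
      then show ?thesis using lI by simp
    qed simp
    then show ?thesis using l N by (simp add: i)
  qed
  ultimately obtain C where C: "countable C" "C \<subseteq> K"
    "pairwise (\<lambda>i j. disjnt (cball (fst i) (N * snd i)) (cball (fst j) (N * snd j))) C"
    "U \<subseteq> (\<Union>i\<in>C. cball (fst i) (5 * (N * snd i)))"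
    by (rule Vitali_covering_lemma_cballs)
  define X where "X i = cball (fst i) (5 * (N * snd i))" for i :: "(real^'n) \<times> real"
  define c where "c = (10 * N) ^ CARD('n)"
  have XK: "ennreal t * emeasure lebesgue (X i) \<le> ennreal c * (\<integral>\<^sup>+y\<in>qb i. F y \<partial>lebesgue)" if "i \<in> C" for i
  proof -
    obtain a l where i: "i = (a, l)" by force
    have l: "0 < l" and lt: "ennreal t * emeasure lebesgue (qb (a, l)) < (\<integral>\<^sup>+y\<in>qb (a, l). F y \<partial>lebesgue)"
      using that C(2) by (auto simp: K_def i)
    have "X i \<subseteq> cbox (a - (5 * N * l) *\<^sub>R One) ((a - (5 * N * l) *\<^sub>R One) + (10 * N * l) *\<^sub>R One)"
    proof
      fix y assume "y \<in> X i"
      then have "norm (y - a) \<le> 5 * N * l" by (simp add: X_def i dist_norm norm_minus_commute)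
      then have le: "\<bar>y $ k - a $ k\<bar> \<le> 5 * N * l" for k
        using component_le_norm_cart[of "y - a" k] by simp
      have "a $ k - 5 * N * l \<le> y $ k \<and> y $ k \<le> a $ k - 5 * N * l + 10 * N * l" for k
        using le[of k] unfolding abs_le_iff by (simp add: algebra_simps)
      then show "y \<in> cbox (a - (5 * N * l) *\<^sub>R One) ((a - (5 * N * l) *\<^sub>R One) + (10 * N * l) *\<^sub>R One)"
        unfolding mem_cube_iff by simp
    qed
    then have "emeasure lebesgue (X i) \<le> emeasure lebesgue (cbox (a - (5 * N * l) *\<^sub>R One) ((a - (5 * N * l) *\<^sub>R One) + (10 * N * l) *\<^sub>R One))"
      by (intro emeasure_mono) auto
    also have "\<dots> = ennreal ((10 * N * l) ^ CARD('n))" using N l by (intro emeasure_cube) auto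
    also have "\<dots> = ennreal c * emeasure lebesgue (qb i)"
      using l N by (simp add: i qb_def emeasure_cube c_def power_mult_distrib ennreal_mult[symmetric])
    finally have "ennreal t * emeasure lebesgue (X i) \<le> ennreal t * (ennreal c * emeasure lebesgue (qb i))"
      by (rule mult_left_mono) simp
    also have "\<dots> = ennreal c * (ennreal t * emeasure lebesgue (qb i))" by (simp only: mult_ac)
    also have "\<dots> \<le> ennreal c * (\<integral>\<^sup>+y\<in>qb i. F y \<partial>lebesgue)"
      using lt by (intro mult_left_mono) (auto simp: i)
    finally show ?thesis .
  qed
  have disj: "disjoint_family_on qb C"
    unfolding disjoint_family_on_def
  proof (intro ballI impI)
    fix i j assume ij: "i \<in> C" "j \<in> C" "i \<noteq> j"
    then have "disjnt (cball (fst i) (N * snd i)) (cball (fst j) (N * snd j))"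
      using C(3) by (auto simp: pairwise_def)
    then show "qb i \<inter> qb j = {}" using qb_ball[of i] qb_ball[of j] ij C(2) by (auto simp: disjnt_def)
  qed
  have qs: "qb i \<in> sets lebesgue" for i by (auto simp: qb_def split: prod.splits)
  have Xs: "X i \<in> sets lebesgue" for i by (auto simp: X_def)
  have Um: "U \<in> sets lebesgue" using MX_open[of "ennreal t" F] by (auto simp: U_def)
  have "emeasure lebesgue U \<le> emeasure lebesgue (\<Union>i\<in>C. X i)"
    using C(1,4) Xs by (intro emeasure_mono) (auto simp: X_def)
  also have "\<dots> \<le> (\<integral>\<^sup>+i. emeasure lebesgue (X i) \<partial>count_space C)"
  proof -
    have ind: "indicator (\<Union>i\<in>C. X i) x \<le> (\<integral>\<^sup>+i. indicator (X i) x \<partial>count_space C)" for x :: "real^'n"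
    proof (cases "x \<in> (\<Union>i\<in>C. X i)")
      case True
      then obtain j where j: "j \<in> C" "x \<in> X j" by blast
      have "indicator (\<Union>i\<in>C. X i) x = (\<integral>\<^sup>+i. indicator {j} i \<partial>count_space C)"
        using j True by (simp add: nn_integral_count_space_indicator[symmetric] one_ennreal_def[symmetric])
      also have "\<dots> \<le> (\<integral>\<^sup>+i. indicator (X i) x \<partial>count_space C)"
        using j by (intro nn_integral_mono) (auto simp: indicator_def)
      finally show ?thesis .
    qed simp
    have "emeasure lebesgue (\<Union>i\<in>C. X i) = (\<integral>\<^sup>+x. indicator (\<Union>i\<in>C. X i) x \<partial>lebesgue)"
      using C(1) Xs by (intro nn_integral_indicator[symmetric] sets.countable_UN') auto
    also have "\<dots> \<le> (\<integral>\<^sup>+x. (\<integral>\<^sup>+i. indicator (X i) x \<partial>count_space C) \<partial>lebesgue)"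
      by (intro nn_integral_mono ind)
    also have "\<dots> = (\<integral>\<^sup>+i. (\<integral>\<^sup>+x. indicator (X i) x \<partial>lebesgue) \<partial>count_space C)"
      using C(1) Xs by (subst nn_integral_count_space_nn_integral) auto
    also have "\<dots> = (\<integral>\<^sup>+i. emeasure lebesgue (X i) \<partial>count_space C)" using Xs by simp
    finally show ?thesis .
  qed
  finally have "ennreal t * emeasure lebesgue U \<le> ennreal t * (\<integral>\<^sup>+i. emeasure lebesgue (X i) \<partial>count_space C)"
    by (rule mult_left_mono) simp
  also have "\<dots> = (\<integral>\<^sup>+i. ennreal t * emeasure lebesgue (X i) \<partial>count_space C)"
    by (subst nn_integral_cmult) auto
  also have "\<dots> \<le> (\<integral>\<^sup>+i. ennreal c * emeasure (density lebesgue F) (qb i) \<partial>count_space C)"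
    using XK qs by (intro nn_integral_mono) (auto simp: emeasure_density)
  also have "\<dots> = ennreal c * emeasure (density lebesgue F) (\<Union>i\<in>C. qb i)"
    using qs C(1) disj by (subst emeasure_UN_countable) (auto simp: nn_integral_cmult)
  also have "\<dots> \<le> ennreal c * emeasure (density lebesgue F) (space (density lebesgue F))"
    by (intro mult_left_mono emeasure_space) simp
  also have "\<dots> = ennreal c * (\<integral>\<^sup>+x. F x \<partial>lebesgue)" by (simp add: emeasure_density)
  finally show ?thesis by (simp add: U_def c_def N_def)
qed

lemma MX_level_sets: "{x. t < MX F x} \<in> sets lebesgue"
  using MX_open[of t F] by auto

lemma epow_2: "epow a 2 = a * a"
  by (cases a) (auto simp: power2_eq_square ennreal_mult)

text \<open>A dyadic layer-cake bound: the level just below \<open>v\<close> alone contributes at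
  least \<open>v * v / 4\<close>, and for infinite \<open>v\<close> the terms are unbounded.\<close>

lemma sum_lev_square_ge:
  fixes v :: ennreal
  shows "v * v \<le> 4 * (\<Sum>n. ennreal (lev n * lev n) * of_bool (ennreal (lev n) < v))"
    (is "_ \<le> 4 * (\<Sum>n. ?f n)")
proof (cases "v = 0")
  case nz: False
  show ?thesis
  proof (cases "v = top")
    case False
    obtain n where n: "ennreal (lev n) < v" "v \<le> ennreal (2 * lev n)" by (rule lev_bracket[OF nz False])
    have "v * v \<le> ennreal (2 * lev n) * ennreal (2 * lev n)" by (intro mult_mono n) auto
    also have "\<dots> = 4 * ennreal (lev n * lev n)"
      by (simp add: ennreal_mult[symmetric] less_imp_le flip: ennreal_numeral)
    also have "\<dots> = 4 * ?f n" using n by simp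
    also have "\<dots> \<le> 4 * (\<Sum>n. ?f n)" by (intro mult_left_mono ennreal_term_le_suminf) simp
    finally show ?thesis .
  next
    case True
    have "(\<Sum>n. ?f n) = top"
    proof (rule ccontr)
      assume "(\<Sum>n. ?f n) \<noteq> top"
      then obtain S where S: "(\<Sum>n. ?f n) = ennreal S" "0 \<le> S" by (cases "\<Sum>n. ?f n") auto
      obtain k where k: "S < 2 ^ k" using real_arch_pow[of 2 S] by auto
      have lk: "lev (int_encode (int k)) = 2 ^ k" by (simp add: lev_def)
      have "ennreal (lev (int_encode (int k)) * lev (int_encode (int k))) \<le> ennreal S"
        using ennreal_term_le_suminf[of ?f "int_encode (int k)"] True S by simp
      then have "(2::real) ^ k * 2 ^ k \<le> S" using S(2) unfolding lk by (subst (asm) ennreal_le_iff) auto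
      moreover have "(2::real) ^ k * 1 \<le> 2 ^ k * 2 ^ k" by (intro mult_left_mono) auto
      ultimately show False using k by simp
    qed
    then show ?thesis by (simp add: ennreal_mult_top)
  qed
qed simp

text \<open>Marcinkiewicz interpolation between the weak bound and the trivial bound for bounded
  functions: at height \<open>t\<close> only the part of \<open>F\<close> above \<open>t / 2\<close>
  matters, and the sum over dyadic heights is again geometric. The constant
  \<open>32 = 4 * 2 * 4\<close> collects the layer-cake bound, the use of height
  \<open>t / 2\<close>, and the sum of the heights below \<open>2 * F\<close>.\<close>

theorem ballbd_2:
  obtains A where "0 < A" "ballbd (\<lambda>x :: real^'n. 2) A"
proof -
  define c where "c = (10 * real CARD('n)) ^ CARD('n)"
  have "1 \<le> real CARD('n)" by (simp add: Suc_leI)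
  then have c: "1 \<le> c" unfolding c_def by (intro one_le_power) linarith
  have main: "(\<integral>\<^sup>+x. MX F x * MX F x \<partial>lebesgue) \<le> ennreal (32 * c) * (\<integral>\<^sup>+x. F x * F x \<partial>lebesgue)"
    if F [measurable]: "F \<in> borel_measurable lebesgue" for F :: "real^'n \<Rightarrow> ennreal"
  proof -
    have lev: "ennreal (lev n * lev n) * emeasure lebesgue {x. ennreal (lev n) < MX F x} \<le>
        (\<integral>\<^sup>+x. ennreal (2 * c) * (F x * (ennreal (lev n) * indicator {x. ennreal (lev n) < 2 * F x} x)) \<partial>lebesgue)" for n
    proof -
      define t where "t = lev n"
      have t: "0 < t" by (simp add: t_def)
      have t2: "ennreal t = 2 * ennreal (t / 2)" using t by (simp add: ennreal_mult[symmetric] flip: ennreal_numeral)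
      define F1 where "F1 x = F x * indicator {x. ennreal t < 2 * F x} x" for x
      have F1 [measurable]: "F1 \<in> borel_measurable lebesgue"
      proof -
        have "{x \<in> space lebesgue. ennreal t < 2 * F x} \<in> sets lebesgue" by measurable
        then have [measurable]: "{x. ennreal t < 2 * F x} \<in> sets lebesgue" by simp
        show ?thesis unfolding F1_def[abs_def] by measurable
      qed
      have MF: "MX F x \<le> MX F1 x + ennreal (t / 2)" for x
        unfolding MX_le_iff
      proof (intro allI impI)
        fix Q :: "(real^'n) set" assume Q: "cube Q" "x \<in> Q"
        note [measurable] = cube_sets[OF Q(1)]
        have "(\<integral>\<^sup>+y\<in>Q. F y \<partial>lebesgue) \<le> (\<integral>\<^sup>+y. F1 y * indicator Q y + ennreal (t / 2) * indicator Q y \<partial>lebesgue)"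
        proof (intro nn_integral_mono)
          fix y
          have "F y \<le> F1 y + ennreal (t / 2)"
          proof (cases "ennreal t < 2 * F y")
            case False
            then have "2 * F y \<le> 2 * ennreal (t / 2)" using t2 by simp
            then have "F y \<le> ennreal (t / 2)" by (subst (asm) ennreal_mult_le_mult_iff) auto
            then show ?thesis by (simp add: add_increasing)
          qed (simp add: F1_def)
          then show "F y * indicator Q y \<le> F1 y * indicator Q y + ennreal (t / 2) * indicator Q y"
            by (auto simp: indicator_def)
        qed
        also have "\<dots> = (\<integral>\<^sup>+y\<in>Q. F1 y \<partial>lebesgue) + ennreal (t / 2) * emeasure lebesgue Q"
          by (simp add: nn_integral_add nn_integral_cmult_indicator)
        also have "\<dots> \<le> MX F1 x * emeasure lebesgue Q + ennreal (t / 2) * emeasure lebesgue Q"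
          by (intro add_mono MX_upper Q) auto
        finally show "(\<integral>\<^sup>+y\<in>Q. F y \<partial>lebesgue) \<le> (MX F1 x + ennreal (t / 2)) * emeasure lebesgue Q"
          by (simp add: distrib_right)
      qed
      have sub: "{x. ennreal t < MX F x} \<subseteq> {x. ennreal (t / 2) < MX F1 x}"
      proof (clarsimp simp: not_le[symmetric])
        fix x assume "\<not> MX F x \<le> ennreal t" and le: "MX F1 x \<le> ennreal (t / 2)"
        have "MX F x \<le> ennreal (t / 2) + ennreal (t / 2)" by (rule order_trans[OF MF add_right_mono[OF le]])
        then have "MX F x \<le> ennreal t" using t2 by (simp only: mult_2)
        then show False using \<open>\<not> MX F x \<le> ennreal t\<close> by simp
      qed
      have [measurable]: "{x. ennreal (t / 2) < MX F1 x} \<in> sets lebesgue" by (rule MX_level_sets)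
      have "ennreal (t * t) * emeasure lebesgue {x. ennreal t < MX F x} \<le> ennreal (t * t) * emeasure lebesgue {x. ennreal (t / 2) < MX F1 x}"
        by (intro mult_left_mono emeasure_mono sub) auto
      also have "\<dots> = ennreal (2 * t) * (ennreal (t / 2) * emeasure lebesgue {x. ennreal (t / 2) < MX F1 x})"
      proof -
        have tt: "ennreal (t * t) = ennreal (2 * t) * ennreal (t / 2)" using t by (simp add: ennreal_mult[symmetric])
        show ?thesis unfolding tt by (simp only: mult.assoc)
      qed
      also have "\<dots> \<le> ennreal (2 * t) * (ennreal c * (\<integral>\<^sup>+x. F1 x \<partial>lebesgue))"
        unfolding c_def using t by (intro mult_left_mono weak_type_MX F1) auto
      also have "\<dots> = (\<integral>\<^sup>+x. ennreal (2 * t) * (ennreal c * F1 x) \<partial>lebesgue)" by (simp add: nn_integral_cmult)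
      also have "\<dots> = (\<integral>\<^sup>+x. ennreal (2 * c) * (F x * (ennreal t * indicator {x. ennreal t < 2 * F x} x)) \<partial>lebesgue)"
      proof (intro nn_integral_cong)
        fix x
        have "ennreal (2 * t) * ennreal c = ennreal (2 * c) * ennreal t"
          using t c by (simp add: ennreal_mult[symmetric] mult_ac)
        then have "(ennreal (2 * t) * ennreal c) * F1 x = (ennreal (2 * c) * ennreal t) * F1 x" by (simp only:)
        then show "ennreal (2 * t) * (ennreal c * F1 x) = ennreal (2 * c) * (F x * (ennreal t * indicator {x. ennreal t < 2 * F x} x))"
          unfolding F1_def by (simp only: mult_ac)
      qed
      finally show ?thesis by (simp only: t_def)
    qed
    have m1 [measurable]: "{x. ennreal (lev n) < MX F x} \<in> sets lebesgue" for n by (rule MX_level_sets)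
    have "{x \<in> space lebesgue. ennreal (lev n) < 2 * F x} \<in> sets lebesgue" for n by measurable
    then have m2 [measurable]: "{x. ennreal (lev n) < 2 * F x} \<in> sets lebesgue" for n by simp
    have "(\<integral>\<^sup>+x. MX F x * MX F x \<partial>lebesgue) \<le> (\<integral>\<^sup>+x. 4 * (\<Sum>n. ennreal (lev n * lev n) * indicator {x. ennreal (lev n) < MX F x} x) \<partial>lebesgue)"
      unfolding indicator_def mem_Collect_eq by (intro nn_integral_mono sum_lev_square_ge)
    also have "\<dots> = 4 * (\<Sum>n. ennreal (lev n * lev n) * emeasure lebesgue {x. ennreal (lev n) < MX F x})"
      by (simp add: nn_integral_cmult nn_integral_suminf nn_integral_cmult_indicator)
    also have "\<dots> \<le> 4 * (\<Sum>n. \<integral>\<^sup>+x. ennreal (2 * c) * (F x * (ennreal (lev n) * indicator {x. ennreal (lev n) < 2 * F x} x)) \<partial>lebesgue)"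
      by (intro mult_left_mono suminf_le allI lev) auto
    also have "\<dots> = 4 * (\<integral>\<^sup>+x. ennreal (2 * c) * (F x * (\<Sum>n. ennreal (lev n) * indicator {x. ennreal (lev n) < 2 * F x} x)) \<partial>lebesgue)"
      by (subst nn_integral_suminf[symmetric]) (auto simp: ennreal_suminf_cmult)
    also have "\<dots> \<le> 4 * (\<integral>\<^sup>+x. ennreal (2 * c) * (F x * (2 * (2 * F x))) \<partial>lebesgue)"
    proof (intro mult_left_mono nn_integral_mono)
      fix x show "(\<Sum>n. ennreal (lev n) * indicator {x. ennreal (lev n) < 2 * F x} x) \<le> 2 * (2 * F x)"
        by (rule suminf_lev_le) auto
    qed auto
    also have "\<dots> = (\<integral>\<^sup>+x. ennreal (32 * c) * (F x * F x) \<partial>lebesgue)"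
    proof (subst nn_integral_cmult[symmetric], measurable, intro nn_integral_cong)
      fix x
      have "ennreal (32 * c) = 4 * (ennreal (2 * c) * (2 * 2))"
        using c by (simp add: ennreal_mult[symmetric] flip: ennreal_numeral)
      then show "4 * (ennreal (2 * c) * (F x * (2 * (2 * F x)))) = ennreal (32 * c) * (F x * F x)"
        by (simp only: mult_ac)
    qed
    also have "\<dots> = ennreal (32 * c) * (\<integral>\<^sup>+x. F x * F x \<partial>lebesgue)" by (intro nn_integral_cmult) measurable
    finally show ?thesis .
  qed
  show thesis
  proof (rule that[of "32 * c"])
    show "0 < 32 * c" using c by simp
    show "ballbd (\<lambda>x :: real^'n. 2) (32 * c)"
      unfolding ballbd_def mdl_def epow_2
    proof (intro ballI impI)
      fix F :: "real^'n \<Rightarrow> ennreal" assume F [measurable]: "F \<in> borel_measurable lebesgue"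
        and F1: "(\<integral>\<^sup>+x. F x * F x \<partial>lebesgue) \<le> 1"
      define k where "k = ennreal (1 / (32 * c))"
      have "(\<integral>\<^sup>+x. MX F x / ennreal (32 * c) * (MX F x / ennreal (32 * c)) \<partial>lebesgue) = (\<integral>\<^sup>+x. (k * k) * (MX F x * MX F x) \<partial>lebesgue)"
        using c by (intro nn_integral_cong) (simp add: ennreal_div_const k_def mult_ac)
      also have "\<dots> = (k * k) * (\<integral>\<^sup>+x. MX F x * MX F x \<partial>lebesgue)" by (intro nn_integral_cmult) measurable
      also have "\<dots> \<le> (k * k) * (ennreal (32 * c) * 1)"
        using order_trans[OF main[OF F] mult_left_mono[OF F1]] by (intro mult_left_mono) auto
      also have "\<dots> = ennreal (1 / (32 * c))" using c by (simp add: k_def ennreal_mult[symmetric])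
      also have "\<dots> \<le> 1" using c by simp
      finally show "(\<integral>\<^sup>+x. MX F x / ennreal (32 * c) * (MX F x / ennreal (32 * c)) \<partial>lebesgue) \<le> 1" .
    qed
  qed
qed

section \<open>Luxemburg norms\<close>

definition eabs :: "ereal \<Rightarrow> ennreal" where
  "eabs u = e2ennreal \<bar>u\<bar>"

lemma eabs_ereal [simp]: "eabs (ereal r) = ennreal \<bar>r\<bar>"
  by (simp add: eabs_def)

lemma eabs_infty [simp]: "eabs \<infinity> = top" "eabs (- \<infinity>) = top"
  by (simp_all add: eabs_def)

lemma eabs_zero [simp]: "eabs 0 = 0"
  using eabs_ereal[of 0] by (simp only: zero_ereal_def[symmetric] abs_zero ennreal_0)

lemma eabs_enn2ereal [simp]: "eabs (enn2ereal a) = a"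
  by (simp add: eabs_def)

text \<open>The passage to the unit-ball formulation: \<open>epow\<close> sends \<open>top\<close>
  to \<open>top\<close> for every exponent, which matches the infinite branch of
  \<open>vmodular\<close>.\<close>

lemma vmodular_eq:
  fixes f :: "real^'n \<Rightarrow> ereal"
  assumes "0 < t"
  shows "vmodular p f t = mdl p (\<lambda>x. ennreal (1 / t) * eabs (f x))"
  unfolding vmodular_def mdl_def
proof (intro nn_integral_cong)
  fix x :: "real^'n"
  show "(if \<bar>f x\<bar> = \<infinity> then \<infinity> else ennreal ((real_of_ereal \<bar>f x\<bar> / t) powr p x)) =
      epow (ennreal (1 / t) * eabs (f x)) (p x)"
  proof (cases "f x")
    case (real r)
    then show ?thesis using assms by (simp add: ennreal_mult[symmetric])
  qed (use assms in \<open>auto simp: ennreal_mult_top infinity_ennreal_def ennreal_eq_0_iff\<close>)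
qed

lemma vnorm_le: "0 < t \<Longrightarrow> vmodular p f t \<le> 1 \<Longrightarrow> vnorm p f \<le> ennreal t"
  unfolding vnorm_def by (rule INF_lower) simp

text \<open>Any number strictly above the norm is admissible, by monotonicity in the dilation. This
  avoids the question whether the infimum is attained.\<close>

lemma vnorm_less:
  assumes "vnorm p f < ennreal a" "\<And>x. 0 \<le> p x"
  shows "0 < a" "vmodular p f a \<le> 1"
proof -
  obtain t where t: "0 < t" "vmodular p f t \<le> 1" "ennreal t < ennreal a"
    using assms(1) by (auto simp: vnorm_def INF_less_iff)
  then have "t < a" by (simp add: ennreal_less_iff)
  then show a: "0 < a" using t by simp
  have "mdl p (\<lambda>x. ennreal (1 / a) * eabs (f x)) \<le> mdl p (\<lambda>x. ennreal (1 / t) * eabs (f x))"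
    using \<open>t < a\<close> t(1) by (intro mdl_mono assms(2) mult_right_mono ennreal_leI frac_le) auto
  then show "vmodular p f a \<le> 1" using t a by (simp add: vmodular_eq)
qed

text \<open>Lets a norm inequality be proved for one admissible dilation \<open>t\<close> at a time;
  dividing by \<open>C\<close> turns the claim into a lower bound of an infimum.\<close>

lemma vnorm_transfer:
  assumes "0 < C" "\<And>t. 0 < t \<Longrightarrow> vmodular p f t \<le> 1 \<Longrightarrow> vnorm q g \<le> ennreal (C * t)"
  shows "vnorm q g \<le> ennreal C * vnorm p f"
proof -
  have nz: "ennreal C \<noteq> 0" "ennreal C \<noteq> top" using assms(1) by (auto simp: ennreal_eq_0_iff)
  have "vnorm q g / ennreal C \<le> vnorm p f"
    unfolding vnorm_def[of p f]
  proof (rule INF_greatest)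
    fix t assume "t \<in> {t. 0 < t \<and> vmodular p f t \<le> 1}"
    then have "vnorm q g \<le> ennreal t * ennreal C"
      using assms(2)[of t] assms(1) by (simp add: ennreal_mult mult.commute)
    then show "vnorm q g / ennreal C \<le> ennreal t" by (rule ennreal_divide_le_iff_mult[OF nz, THEN iffD2])
  qed
  then have "vnorm q g \<le> vnorm p f * ennreal C" by (rule ennreal_divide_le_iff_mult[OF nz, THEN iffD1])
  then show ?thesis by (simp only: mult.commute)
qed

lemma vnorm_scale_mono:
  assumes "0 < k" "\<And>x. ennreal k * eabs (g x) \<le> eabs (f x)" "\<And>x. 0 \<le> p x"
  shows "ennreal k * vnorm p g \<le> vnorm p f"
proof -
  have "vnorm p g \<le> ennreal (1 / k) * vnorm p f"
  proof (rule vnorm_transfer)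
    fix t assume t: "0 < t" "vmodular p f t \<le> 1"
    have "vmodular p g (1 / k * t) \<le> vmodular p f t"
    proof -
      have "mdl p (\<lambda>x. ennreal (1 / (1 / k * t)) * eabs (g x)) \<le> mdl p (\<lambda>x. ennreal (1 / t) * eabs (f x))"
      proof (intro mdl_mono assms(3))
        fix x
        have "ennreal (1 / (1 / k * t)) = ennreal (1 / t) * ennreal k"
          using assms(1) t by (simp add: ennreal_mult[symmetric])
        then show "ennreal (1 / (1 / k * t)) * eabs (g x) \<le> ennreal (1 / t) * eabs (f x)"
          using mult_left_mono[OF assms(2)[of x], of "ennreal (1 / t)"] by (simp add: mult.assoc)
      qed
      then show ?thesis using assms(1) t by (simp add: vmodular_eq)
    qed
    then show "vnorm p g \<le> ennreal (1 / k * t)" using t assms(1) by (intro vnorm_le) auto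
  qed (use assms in auto)
  then have "ennreal k * vnorm p g \<le> ennreal k * (ennreal (1 / k) * vnorm p f)" by (rule mult_left_mono) simp
  also have "\<dots> = (ennreal k * ennreal (1 / k)) * vnorm p f" by (simp only: mult.assoc)
  also have "ennreal k * ennreal (1 / k) = 1" using assms(1) by (simp add: ennreal_mult[symmetric])
  finally show ?thesis by simp
qed

lemma bounded_opI:
  assumes "0 < C" "\<And>f t. f \<in> borel_measurable lebesgue \<Longrightarrow> 0 < t \<Longrightarrow> mdl p (\<lambda>x. ennreal (1 / t) * ennreal \<bar>f x\<bar>) \<le> 1 \<Longrightarrow>
    mdl q (\<lambda>x. ennreal (1 / (C * t)) * eabs (T f x)) \<le> 1"
  shows "bounded_op p q T"
  unfolding bounded_op_def
proof (intro exI[of _ C] allI impI vnorm_transfer assms(1))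
  fix f t assume f: "in_Lvar p f" and t: "0 < t" "vmodular p (\<lambda>x. ereal (f x)) t \<le> 1"
  have "mdl q (\<lambda>x. ennreal (1 / (C * t)) * eabs (T f x)) \<le> 1"
    using f t by (intro assms(2)) (auto simp: in_Lvar_def vmodular_eq)
  then show "vnorm q (T f) \<le> ennreal (C * t)"
    using assms(1) t by (intro vnorm_le) (simp_all add: vmodular_eq)
qed

lemma bounded_opE:
  assumes "bounded_op p q T"
  obtains C where "0 < C" "\<And>f. in_Lvar p f \<Longrightarrow> vnorm q (T f) \<le> ennreal C * vnorm p (\<lambda>x. ereal (f x))"
proof -
  obtain C where C: "\<And>f. in_Lvar p f \<Longrightarrow> vnorm q (T f) \<le> ennreal C * vnorm p (\<lambda>x. ereal (f x))"
    using assms unfolding bounded_op_def by blast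
  show thesis
  proof (rule that[of "max C 1"])
    fix f assume "in_Lvar p f"
    then have "vnorm q (T f) \<le> ennreal C * vnorm p (\<lambda>x. ereal (f x))" by (rule C)
    also have "\<dots> \<le> ennreal (max C 1) * vnorm p (\<lambda>x. ereal (f x))" by (intro mult_right_mono ennreal_leI) auto
    finally show "vnorm q (T f) \<le> ennreal (max C 1) * vnorm p (\<lambda>x. ereal (f x))" .
  qed simp
qed

section \<open>Boundedness of the maximal operator in norm form and in unit-ball form\<close>

lemma Mfrac_0: "Mfrac 0 f x = MX (\<lambda>y. ennreal \<bar>f y\<bar>) x"
proof -
  have "ennreal (measure lebesgue Q powr (0 / real CARD('a) - 1)) * I = I / emeasure lebesgue Q"
    if "cube (Q :: (real^'a) set)" for Q I
    using cube_emeasure(1,2)[OF that]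
    by (simp add: ennreal_div_const powr_minus powr_one inverse_eq_divide)
  then show ?thesis unfolding Mfrac_def MX_def by (intro SUP_cong) auto
qed

lemma PexpD:
  assumes "p \<in> Pexp"
  shows "p \<in> borel_measurable lebesgue" "\<And>x. 1 \<le> p x" "\<exists>S. AE x in lebesgue. p x \<le> S"
  using assms by (auto simp: Pexp_def)

lemma Bexp_ballbd:
  fixes s :: "real^'n \<Rightarrow> real"
  assumes "s \<in> Bexp"
  shows "\<exists>A>0. ballbd s A"
proof -
  have sP: "s \<in> Pexp" and bo: "bounded_op s s (\<lambda>f x. enn2ereal (Mfrac 0 f x))" using assms by (auto simp: Bexp_def)
  note s = PexpD(1,2)[OF sP]
  have s0: "0 \<le> s x" for x using s(2)[of x] by simp
  obtain C where C: "0 < C" "\<And>f. in_Lvar s f \<Longrightarrow> vnorm s (\<lambda>x. enn2ereal (Mfrac 0 f x)) \<le> ennreal C * vnorm s (\<lambda>x. ereal (f x))"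
    using bounded_opE[OF bo] by metis
  \<comment> \<open>One more than \<open>C\<close>, since only a strict inequality between the norm
    and a number yields a modular at most 1.\<close>
  have "ballbd s (C + 1)"
    unfolding ballbd_def
  proof (intro ballI impI)
    fix F assume F [measurable]: "F \<in> borel_measurable lebesgue" and F1: "mdl s F \<le> 1"
    define f where "f x = enn2real (F x)" for x
    have f [measurable]: "f \<in> borel_measurable lebesgue" unfolding f_def[abs_def] by measurable
    have eq: "AE x in lebesgue. ennreal \<bar>f x\<bar> = F x"
      using mdl_finite_AE[OF s(1) F F1] by eventually_elim (simp add: f_def)
    have vm: "vmodular s (\<lambda>x. ereal (f x)) 1 \<le> 1"
    proof -
      have "mdl s (\<lambda>x. ennreal \<bar>f x\<bar>) \<le> mdl s F"
        by (rule mdl_mono_AE[OF _ s0]) (use eq in \<open>auto elim: AE_mp\<close>)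
      then show ?thesis using F1 by (simp add: vmodular_eq)
    qed
    have "vmodular s (\<lambda>x. ereal (f x)) 1 < \<infinity>" using le_less_trans[OF vm] by (simp add: infinity_ennreal_def less_top)
    then have "in_Lvar s f" unfolding in_Lvar_def using f by (auto intro!: exI[of _ 1])
    from C(2)[OF this] have "vnorm s (\<lambda>x. enn2ereal (Mfrac 0 f x)) \<le> ennreal C * ennreal 1"
      using mult_left_mono[OF vnorm_le[OF _ vm], of "ennreal C"] by (simp add: order_trans)
    also have "\<dots> < ennreal (C + 1)" using C(1) by (simp add: ennreal_less_iff)
    finally have "vmodular s (\<lambda>x. enn2ereal (Mfrac 0 f x)) (C + 1) \<le> 1" by (rule vnorm_less(2)[OF _ s0])
    moreover have "MX (\<lambda>y. ennreal \<bar>f y\<bar>) x = MX F x" for x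
    proof -
      have "(\<integral>\<^sup>+y\<in>Q. ennreal \<bar>f y\<bar> \<partial>lebesgue) = (\<integral>\<^sup>+y\<in>Q. F y \<partial>lebesgue)" for Q
        using eq by (intro nn_integral_cong_AE) (auto elim: AE_mp)
      then show ?thesis unfolding MX_def by simp
    qed
    moreover have D: "0 < C + 1" using C(1) by simp
    ultimately have "mdl s (\<lambda>x. ennreal (1 / (C + 1)) * MX F x) \<le> 1"
      by (simp add: vmodular_eq Mfrac_0)
    then show "mdl s (\<lambda>x. MX F x / ennreal (C + 1)) \<le> 1"
      unfolding ennreal_div_const[OF D] .
  qed
  then show ?thesis using C(1) by (intro exI[of _ "C + 1"]) auto
qed

lemma ballbd_Bexp:
  assumes "s \<in> Pexp" "ballbd s A" "0 < A"
  shows "s \<in> Bexp"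
proof -
  note s = PexpD(1,2)[OF assms(1)]
  have "bounded_op s s (\<lambda>f x. enn2ereal (Mfrac 0 f x))"
  proof (rule bounded_opI[OF assms(3)])
    fix f :: "real^'a \<Rightarrow> real" and t :: real
    assume f [measurable]: "f \<in> borel_measurable lebesgue" and t: "0 < t"
      and le: "mdl s (\<lambda>x. ennreal (1 / t) * ennreal \<bar>f x\<bar>) \<le> 1"
    have "mdl s (\<lambda>x. ennreal (1 / A) * MX (\<lambda>x. ennreal (1 / t) * ennreal \<bar>f x\<bar>) x) \<le> 1"
      by (rule ballbdD[OF assms(2,3) _ le]) measurable
    moreover have "ennreal (1 / A) * MX (\<lambda>x. ennreal (1 / t) * ennreal \<bar>f x\<bar>) x = ennreal (1 / (A * t)) * Mfrac 0 f x" for x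
    proof -
      have "ennreal (1 / (A * t)) = ennreal (1 / A) * ennreal (1 / t)" using t assms(3) by (simp add: ennreal_mult[symmetric])
      then show ?thesis by (simp add: MX_cmult Mfrac_0 mult.assoc)
    qed
    ultimately show "mdl s (\<lambda>x. ennreal (1 / (A * t)) * eabs (enn2ereal (Mfrac 0 f x))) \<le> 1" by simp
  qed
  then show ?thesis using assms(1) by (simp add: Bexp_def)
qed

text \<open>Shows the class inhabited, so that the statements about all exponents imply those about
  some exponent.\<close>

lemma const2_Bexp: "(\<lambda>x :: real^'n. 2) \<in> Bexp"
proof -
  obtain A where "0 < A" "ballbd (\<lambda>x :: real^'n. 2) A" by (rule ballbd_2)
  moreover have "(\<lambda>x :: real^'n. 2 :: real) \<in> Pexp"
    unfolding Pexp_def by (auto intro!: exI[of _ 2])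
  ultimately show ?thesis using ballbd_Bexp by blast
qed

text \<open>Take the tangent to the power \<open>r\<close> at a height \<open>l\<close> whose power
  dominates the maximal function of \<open>epow F r\<close>. Letting \<open>l\<close> decrease to
  \<open>m powr (1 / r)\<close>, rather than equal it, avoids a tangent at 0 when
  \<open>m = 0\<close>.\<close>

lemma MX_jensen:
  fixes F :: "real^'n \<Rightarrow> ennreal"
  assumes F [measurable]: "F \<in> borel_measurable lebesgue" and r: "1 \<le> r"
  shows "MX F x \<le> epow (MX (\<lambda>y. epow (F y) r) x) (1 / r)"
proof (cases "MX (\<lambda>y. epow (F y) r) x")
  case (real m)
  have le: "MX F x \<le> ennreal l" if l: "0 < l" "m \<le> l powr r" for l
    unfolding MX_le_iff
  proof (intro allI impI)
    fix Q :: "(real^'n) set" assume Q: "cube Q" "x \<in> Q"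
    note [measurable] = cube_sets[OF Q(1)]
    define I where "I = (\<integral>\<^sup>+y\<in>Q. F y \<partial>lebesgue)"
    have k: "0 < r * l powr (r - 1)" using l r by simp
    have "ennreal (r * l powr (r - 1)) * I = (\<integral>\<^sup>+y. ennreal (r * l powr (r - 1)) * F y * indicator Q y \<partial>lebesgue)"
      unfolding I_def by (simp add: nn_integral_cmult mult.assoc)
    also have "\<dots> \<le> (\<integral>\<^sup>+y. epow (F y) r * indicator Q y + ennreal ((r - 1) * l powr r) * indicator Q y \<partial>lebesgue)"
      using tangent_epow[OF l(1) r] by (intro nn_integral_mono) (auto simp: indicator_def)
    also have "\<dots> = (\<integral>\<^sup>+y\<in>Q. epow (F y) r \<partial>lebesgue) + ennreal ((r - 1) * l powr r) * emeasure lebesgue Q"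
      by (simp add: nn_integral_add nn_integral_cmult_indicator)
    also have "\<dots> \<le> ennreal m * emeasure lebesgue Q + ennreal ((r - 1) * l powr r) * emeasure lebesgue Q"
      using MX_upper[OF Q, of "\<lambda>y. epow (F y) r"] real by (intro add_mono) auto
    also have "\<dots> \<le> ennreal (l powr r) * emeasure lebesgue Q + ennreal ((r - 1) * l powr r) * emeasure lebesgue Q"
      by (intro add_mono mult_right_mono ennreal_leI l) auto
    also have "\<dots> = ennreal (l powr r + (r - 1) * l powr r) * emeasure lebesgue Q"
      using r by (simp add: distrib_right ennreal_plus)
    also have "l powr r + (r - 1) * l powr r = (r * l powr (r - 1)) * l"
    proof -
      have "l powr (r - 1) * l powr 1 = l powr r" by (subst powr_add[symmetric]) simp
      then show ?thesis using l by (simp add: algebra_simps)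
    qed
    also have "ennreal ((r * l powr (r - 1)) * l) * emeasure lebesgue Q = ennreal (r * l powr (r - 1)) * (ennreal l * emeasure lebesgue Q)"
      using l k by (subst ennreal_mult) (auto simp: mult.assoc)
    finally show "I \<le> ennreal l * emeasure lebesgue Q"
      using k by (subst (asm) ennreal_mult_le_mult_iff) (auto simp: ennreal_eq_0_iff)
  qed
  have eps: "MX F x \<le> ennreal (m powr (1 / r)) + ennreal e" if e: "0 < e" for e
  proof -
    have "m = (m powr (1 / r)) powr r" using real r by (simp add: powr_powr)
    also have "\<dots> \<le> (m powr (1 / r) + e) powr r" using r e by (intro powr_mono2) auto
    finally have "MX F x \<le> ennreal (m powr (1 / r) + e)" using e by (intro le) (auto intro: add_nonneg_pos)
    then show ?thesis using e by (simp add: ennreal_plus)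
  qed
  have "MX F x \<le> ennreal (m powr (1 / r))" by (rule ennreal_le_epsilon) (rule eps)
  then show ?thesis using real by simp
qed simp

text \<open>Raising a function to the power \<open>r\<close> turns its modular for
  \<open>r * s\<close> into one for \<open>s\<close>, and Jensen's inequality commutes this with the
  maximal operator. With \<open>r = 1 / (1 - \<alpha> / n)\<close> it carries boundedness from
  \<open>s\<close> to \<open>q\<close>.\<close>

lemma ballbd_power:
  fixes s :: "real^'n \<Rightarrow> real"
  assumes A: "ballbd s A" "0 < A" and r: "1 \<le> r" and s: "\<And>x. 1 \<le> s x"
  shows "ballbd (\<lambda>x. r * s x) (A powr (1 / r))"
  unfolding ballbd_def
proof (intro ballI impI)
  fix F :: "real^'n \<Rightarrow> ennreal" assume F [measurable]: "F \<in> borel_measurable lebesgue" and F1: "mdl (\<lambda>x. r * s x) F \<le> 1"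
  define G where "G x = epow (F x) r" for x
  have G [measurable]: "G \<in> borel_measurable lebesgue" unfolding G_def[abs_def] by measurable
  have "mdl s G \<le> 1" using F1 by (simp add: mdl_def G_def epow_epow)
  then have "mdl s (\<lambda>x. ennreal (1 / A) * MX G x) \<le> 1" by (rule ballbdD[OF A G])
  have rs: "0 \<le> r * s x" for x using r s[of x] by simp
  have "mdl (\<lambda>x. r * s x) (\<lambda>x. MX F x / ennreal (A powr (1 / r))) \<le> mdl (\<lambda>x. r * s x) (\<lambda>x. epow (ennreal (1 / A) * MX G x) (1 / r))"
  proof (intro mdl_mono rs)
    fix x
    have "MX F x / ennreal (A powr (1 / r)) = ennreal ((1 / A) powr (1 / r)) * MX F x"
      using A by (simp add: ennreal_div_const powr_divide)
    also have "\<dots> \<le> ennreal ((1 / A) powr (1 / r)) * epow (MX G x) (1 / r)"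
      unfolding G_def by (intro mult_left_mono MX_jensen r F) simp
    also have "\<dots> = epow (ennreal (1 / A) * MX G x) (1 / r)"
      using A r by (simp add: epow_mult)
    finally show "MX F x / ennreal (A powr (1 / r)) \<le> epow (ennreal (1 / A) * MX G x) (1 / r)" .
  qed
  also have "\<dots> = mdl s (\<lambda>x. ennreal (1 / A) * MX G x)"
    using r by (simp add: mdl_def epow_epow)
  finally show "mdl (\<lambda>x. r * s x) (\<lambda>x. MX F x / ennreal (A powr (1 / r))) \<le> 1"
    using \<open>mdl s (\<lambda>x. ennreal (1 / A) * MX G x) \<le> 1\<close> by simp
qed

section \<open>Norms of indicators and means over cubes\<close>

abbreviation chi :: "(real^'n) set \<Rightarrow> real^'n \<Rightarrow> ereal" where
  "chi Q \<equiv> (\<lambda>x. ereal (indicator Q x))"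

text \<open>Positivity and finiteness are what allow the norm of an indicator to be cancelled. Since
  \<open>s \<ge> 1\<close>, explicit bounds in terms of the volume \<open>V\<close> are
  \<open>min 1 V / 2\<close> and \<open>max 1 V\<close>.\<close>

lemma vnorm_chi:
  fixes s :: "real^'n \<Rightarrow> real"
  assumes "cube Q" "\<And>x. 1 \<le> s x"
  shows "0 < vnorm s (chi Q)" "vnorm s (chi Q) < top"
proof -
  define V where "V = measure lebesgue Q"
  have V: "0 < V" "emeasure lebesgue Q = ennreal V" using cube_emeasure[OF assms(1)] by (auto simp: V_def)
  note [measurable] = cube_sets[OF assms(1)]
  have s0: "0 \<le> s x" for x using assms(2)[of x] by simp
  have I: "vmodular s (chi Q) t = (\<integral>\<^sup>+x\<in>Q. ennreal ((1 / t) powr s x) \<partial>lebesgue)" if "0 < t" for t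
  proof -
    have "epow (ennreal (1 / t) * eabs (ereal (indicator Q x))) (s x) = ennreal ((1 / t) powr s x) * indicator Q x" for x
      using that by (cases "x \<in> Q") auto
    then show ?thesis using that by (simp add: vmodular_eq mdl_def)
  qed
  have "vnorm s (chi Q) \<le> ennreal (max 1 V)"
  proof (rule vnorm_le)
    have "vmodular s (chi Q) (max 1 V) \<le> (\<integral>\<^sup>+x\<in>Q. ennreal (1 / max 1 V) \<partial>lebesgue)"
      unfolding I[OF less_le_trans[OF zero_less_one max.cobounded1]]
    proof (intro nn_integral_mono mult_right_mono ennreal_leI)
      fix x show "(1 / max 1 V) powr s x \<le> 1 / max 1 V"
        using powr_mono'[of 1 "s x" "1 / max 1 V"] assms(2)[of x] by simp
    qed simp
    also have "\<dots> = ennreal (1 / max 1 V * V)" using V by (simp add: nn_integral_cmult_indicator ennreal_mult[symmetric])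
    also have "\<dots> \<le> 1" using V by (simp add: max_def)
    finally show "vmodular s (chi Q) (max 1 V) \<le> 1" .
  qed simp
  then show "vnorm s (chi Q) < top" by (rule le_less_trans) simp
  have "ennreal (min 1 V / 2) \<le> vnorm s (chi Q)"
  proof (rule ccontr)
    assume "\<not> ?thesis"
    then have le: "vmodular s (chi Q) (min 1 V / 2) \<le> 1" by (intro vnorm_less(2) s0) simp
    define t where "t = min 1 V / 2"
    have t: "0 < t" "t \<le> 1" "t < V" using V by (auto simp: t_def)
    have "ennreal (1 / t * V) = (\<integral>\<^sup>+x\<in>Q. ennreal (1 / t) \<partial>lebesgue)"
      using V t by (simp add: nn_integral_cmult_indicator ennreal_mult[symmetric])
    also have "\<dots> \<le> vmodular s (chi Q) t"
      unfolding I[OF t(1)]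
    proof (intro nn_integral_mono mult_right_mono ennreal_leI)
      fix x show "1 / t \<le> (1 / t) powr s x"
        using powr_mono[of 1 "s x" "1 / t"] assms(2)[of x] t by simp
    qed simp
    also have "vmodular s (chi Q) t \<le> 1" using le by (simp only: t_def)
    finally have "ennreal (1 / t * V) \<le> 1" .
    then have "1 / t * V \<le> 1" by simp
    then show False using t by (simp add: field_simps)
  qed
  moreover have "0 < ennreal (min 1 V / 2)" using V by simp
  ultimately show "0 < vnorm s (chi Q)" by (rule less_le_trans[rotated])
qed

text \<open>On \<open>Q\<close> the maximal function of \<open>g\<close> is at least the mean of
  \<open>g\<close>, so that mean times the norm of the indicator is at most \<open>A\<close> times
  the norm of \<open>g\<close>. By hypothesis the latter is at most \<open>C\<close> times the norm
  of the indicator, which cancels.\<close>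

lemma cube_average_le:
  fixes s :: "real^'n \<Rightarrow> real"
  assumes A: "ballbd s A" "0 < A" and s: "\<And>x. 1 \<le> s x" and Q: "cube Q"
    and g: "g \<in> borel_measurable lebesgue" "\<And>x. 0 \<le> g x" "\<And>x. x \<notin> Q \<Longrightarrow> g x = 0"
    and C: "0 < C" "vnorm s (\<lambda>x. ereal (g x)) \<le> ennreal C * vnorm s (chi Q)"
    and fin: "(\<integral>\<^sup>+x\<in>Q. ennreal (g x) \<partial>lebesgue) \<noteq> top"
  shows "(\<integral>\<^sup>+x\<in>Q. ennreal (g x) \<partial>lebesgue) \<le> ennreal (A * C) * emeasure lebesgue Q"
proof -
  define V where "V = measure lebesgue Q"
  have V: "0 < V" "emeasure lebesgue Q = ennreal V" using cube_emeasure[OF Q] by (auto simp: V_def)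
  note [measurable] = g(1) cube_sets[OF Q]
  have s0: "0 \<le> s x" for x using s[of x] by simp
  obtain i where i: "(\<integral>\<^sup>+x\<in>Q. ennreal (g x) \<partial>lebesgue) = ennreal i" "0 \<le> i"
    using fin by (cases "\<integral>\<^sup>+x\<in>Q. ennreal (g x) \<partial>lebesgue") auto
  show ?thesis
  proof (cases "i = 0")
    case False
    then have i0: "0 < i" using i by simp
    have "vnorm s (chi Q) \<le> ennreal (A * V / i) * vnorm s (\<lambda>x. ereal (g x))"
    proof (rule vnorm_transfer)
      fix t assume t: "0 < t" "vmodular s (\<lambda>x. ereal (g x)) t \<le> 1"
      have le: "mdl s (\<lambda>x. ennreal (1 / A) * MX (\<lambda>x. ennreal (1 / t) * ennreal (g x)) x) \<le> 1"
        using t g(2) by (intro ballbdD[OF A]) (auto simp: vmodular_eq)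
      have "vmodular s (chi Q) (A * V / i * t) \<le> mdl s (\<lambda>x. ennreal (1 / A) * MX (\<lambda>x. ennreal (1 / t) * ennreal (g x)) x)"
      proof -
        have "mdl s (\<lambda>x. ennreal (1 / (A * V / i * t)) * eabs (ereal (indicator Q x))) \<le> mdl s (\<lambda>x. ennreal (1 / A) * MX (\<lambda>x. ennreal (1 / t) * ennreal (g x)) x)"
        proof (intro mdl_mono s0)
          fix x
          show "ennreal (1 / (A * V / i * t)) * eabs (ereal (indicator Q x)) \<le> ennreal (1 / A) * MX (\<lambda>x. ennreal (1 / t) * ennreal (g x)) x"
          proof (cases "x \<in> Q")
            case True
            have "ennreal (i / V) * emeasure lebesgue Q = ennreal i"
              unfolding V(2) using V(1) i0 by (subst ennreal_mult[symmetric]) auto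
            then have "ennreal (i / V) \<le> MX (\<lambda>x. ennreal (g x)) x"
              using MX_upper[OF Q True, of "\<lambda>x. ennreal (g x)"] ennreal_divide_le_iff_mult[OF cube_emeasure(3,4)[OF Q]]
              unfolding i(1) by (metis cube_emeasure(3,4)[OF Q] ennreal_mult_divide_eq)
            then have "ennreal (1 / A) * (ennreal (1 / t) * ennreal (i / V)) \<le> ennreal (1 / A) * MX (\<lambda>x. ennreal (1 / t) * ennreal (g x)) x"
              by (simp add: MX_cmult mult_left_mono)
            moreover have "ennreal (1 / A) * (ennreal (1 / t) * ennreal (i / V)) = ennreal (1 / (A * V / i * t))"
              using A(2) t(1) V(1) i0 by (simp add: ennreal_mult[symmetric] mult_ac)
            ultimately show ?thesis using True by simp
          qed simp
        qed
        then show ?thesis using A(2) V(1) i0 t(1) by (simp add: vmodular_eq)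
      qed
      then show "vnorm s (chi Q) \<le> ennreal (A * V / i * t)"
        using le A(2) V(1) i0 t(1) by (intro vnorm_le) auto
    qed (use A V i0 in auto)
    also have "\<dots> \<le> ennreal (A * V / i) * (ennreal C * vnorm s (chi Q))" by (intro mult_left_mono C) simp
    also have "\<dots> = ennreal (A * V / i * C) * vnorm s (chi Q)"
      using A V i0 C by (subst ennreal_mult) (auto simp: mult.assoc)
    finally have "1 * vnorm s (chi Q) \<le> ennreal (A * V / i * C) * vnorm s (chi Q)" by simp
    then have "1 \<le> ennreal (A * V / i * C)"
      using vnorm_chi[where s = s, OF Q s] by (subst (asm) mult.commute, subst (asm) (2) mult.commute, subst (asm) ennreal_mult_le_mult_iff) auto
    then have "1 \<le> A * V / i * C" by simp
    then have "i \<le> A * C * V" using i0 by (simp add: field_simps)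
    then show ?thesis unfolding i(1) V(2) using A C V by (simp add: ennreal_mult[symmetric] ennreal_leI)
  qed (use i in simp)
qed

text \<open>The mean of \<open>|b|\<close> dominates that of \<open>b\<close>, so the hypothesis
  controls the part of \<open>b\<close> below its mean, whose mass equals that of the part above.
  Where \<open>b < 0\<close> the excess is at least \<open>|b|\<close>; hence the negative part has
  means at most \<open>C\<close> on every cube, and differentiation makes this a pointwise
  bound.\<close>

lemma bmo_if_excess_bounded:
  fixes b :: "real^'n \<Rightarrow> real"
  assumes b: "loc_integrable b" and C: "0 < C"
    and le: "\<And>Q. cube Q \<Longrightarrow> (\<integral>\<^sup>+y\<in>Q. ennreal (cavg Q (\<lambda>y. \<bar>b y\<bar>) - b y) \<partial>lebesgue) \<le> ennreal C * emeasure lebesgue Q"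
  shows "b \<in> BMO" "negpart b \<in> Linfty"
proof -
  note [measurable] = loc_integrable_measurable[OF b]
  have babs: "loc_integrable (\<lambda>y. \<bar>b y\<bar>)"
    using b by (auto simp: loc_integrable_def intro!: set_integrable_abs)
  have c: "\<bar>cavg Q b\<bar> \<le> cavg Q (\<lambda>y. \<bar>b y\<bar>)" if Q: "cube Q" for Q
  proof -
    have "\<bar>LINT y:Q|lebesgue. b y\<bar> \<le> (LINT y:Q|lebesgue. \<bar>b y\<bar>)"
      using integral_abs_bound[of lebesgue "\<lambda>y. indicator Q y * b y"] by (simp add: set_lebesgue_integral_def abs_mult)
    then show ?thesis using cube_emeasure(2)[OF Q] by (simp add: cavg_def abs_divide divide_right_mono)
  qed
  have "bmo_bd b (2 * C)"
    unfolding bmo_bd_def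
  proof (intro conjI allI impI b)
    fix Q :: "(real^'n) set" assume Q: "cube Q"
    note [measurable] = cube_sets[OF Q]
    have lo: "(\<integral>\<^sup>+y\<in>Q. ennreal (cavg Q b - b y) \<partial>lebesgue) \<le> ennreal C * emeasure lebesgue Q"
    proof (rule order_trans[OF _ le[OF Q]])
      show "(\<integral>\<^sup>+y\<in>Q. ennreal (cavg Q b - b y) \<partial>lebesgue) \<le> (\<integral>\<^sup>+y\<in>Q. ennreal (cavg Q (\<lambda>y. \<bar>b y\<bar>) - b y) \<partial>lebesgue)"
        using c[OF Q] by (intro nn_integral_mono mult_right_mono ennreal_leI) auto
    qed
    have "(\<integral>\<^sup>+y\<in>Q. ennreal \<bar>b y - cavg Q b\<bar> \<partial>lebesgue) =
        (\<integral>\<^sup>+y. ennreal (b y - cavg Q b) * indicator Q y + ennreal (cavg Q b - b y) * indicator Q y \<partial>lebesgue)"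
    proof (intro nn_integral_cong)
      fix y
      have "ennreal \<bar>b y - cavg Q b\<bar> = ennreal (b y - cavg Q b) + ennreal (cavg Q b - b y)"
        by (cases "b y \<le> cavg Q b") (auto simp: ennreal_neg)
      then show "ennreal \<bar>b y - cavg Q b\<bar> * indicator Q y = ennreal (b y - cavg Q b) * indicator Q y + ennreal (cavg Q b - b y) * indicator Q y"
        by (simp add: distrib_right)
    qed
    also have "\<dots> = (\<integral>\<^sup>+y\<in>Q. ennreal (b y - cavg Q b) \<partial>lebesgue) + (\<integral>\<^sup>+y\<in>Q. ennreal (cavg Q b - b y) \<partial>lebesgue)"
      by (intro nn_integral_add) measurable
    also have "\<dots> \<le> ennreal C * emeasure lebesgue Q + ennreal C * emeasure lebesgue Q"
      using cavg_le_parts[OF b Q order_refl] lo by (intro add_mono) (auto intro: order_trans)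
    also have "\<dots> = ennreal (2 * C) * emeasure lebesgue Q"
      using C by (simp add: ennreal_mult mult_2[symmetric] mult.assoc)
    finally show "(\<integral>\<^sup>+y\<in>Q. ennreal \<bar>b y - cavg Q b\<bar> \<partial>lebesgue) \<le> ennreal (2 * C) * emeasure lebesgue Q" .
  qed (use C in auto)
  then show "b \<in> BMO" using BMO_iff by blast
  have neg: "loc_integrable (negpart b)"
    unfolding loc_integrable_def
  proof (intro allI impI)
    fix K :: "(real^'n) set" assume K: "compact K"
    have "set_integrable lebesgue K (\<lambda>y. (\<bar>b y\<bar> - b y) / 2)"
      using b babs K unfolding loc_integrable_def by (intro set_integrable_divide set_integral_diff) auto
    moreover have "(\<lambda>y. (\<bar>b y\<bar> - b y) / 2) = negpart b" by (auto simp: negpart_def)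
    ultimately show "set_integrable lebesgue K (negpart b)" by simp
  qed
  have nC: "cavg Q (negpart b) \<le> C" if Q: "cube Q" for Q
  proof -
    have "ennreal \<bar>cavg Q (negpart b) - 0\<bar> * emeasure lebesgue Q \<le> (\<integral>\<^sup>+y\<in>Q. ennreal \<bar>negpart b y - 0\<bar> \<partial>lebesgue)"
      by (rule cavg_dev[OF neg Q])
    also have "\<dots> \<le> (\<integral>\<^sup>+y\<in>Q. ennreal (cavg Q (\<lambda>y. \<bar>b y\<bar>) - b y) \<partial>lebesgue)"
    proof (intro nn_integral_mono mult_right_mono)
      fix y
      have "0 \<le> cavg Q (\<lambda>y. \<bar>b y\<bar>)" using c[OF Q] by linarith
      then show "ennreal \<bar>negpart b y - 0\<bar> \<le> ennreal (cavg Q (\<lambda>y. \<bar>b y\<bar>) - b y)"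
        by (cases "b y < 0") (auto simp: negpart_def intro!: ennreal_leI)
    qed simp
    also have "\<dots> \<le> ennreal C * emeasure lebesgue Q" by (rule le[OF Q])
    finally have "\<bar>cavg Q (negpart b)\<bar> * measure lebesgue Q \<le> C * measure lebesgue Q"
      unfolding cube_emeasure(1)[OF Q] using C by (simp add: ennreal_mult[symmetric])
    then show ?thesis using cube_emeasure(2)[OF Q] by simp
  qed
  have "AE x in lebesgue. \<bar>negpart b x\<bar> \<le> C"
    using cavg_frequently_gt[OF zero_less_one neg, of 0]
  proof (rule AE_mp, intro AE_I2 impI)
    fix x assume *: "\<forall>i0. \<forall>e>0. \<exists>i\<ge>i0. negpart b x - e < cavg (ccell 0 1 i x) (negpart b)"
    have "negpart b x \<le> C + e" if "0 < e" for e
    proof -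
      obtain i where "negpart b x - e < cavg (ccell 0 1 i x) (negpart b)" using * \<open>0 < e\<close> by blast
      then show ?thesis using nC[OF ccell_cube[OF zero_less_one], of 0 i x] by linarith
    qed
    then have "negpart b x \<le> C" by (rule field_le_epsilon)
    then show "\<bar>negpart b x\<bar> \<le> C" by (simp add: negpart_def split: if_splits)
  qed
  then show "negpart b \<in> Linfty" using loc_integrable_measurable[OF neg] by (auto simp: Linfty_def)
qed

section \<open>Fractional averages and the pointwise bound of the commutator\<close>

lemma young_split:
  fixes k u \<theta> e c d :: real
  assumes "0 \<le> k" "0 \<le> u" "0 < \<theta>" "\<theta> < 1" "0 < e" "c * (1 - \<theta>) + d * \<theta> = 1"
  shows "k * u \<le> e * (k powr (1 / (1 - \<theta>)) * u powr c) + e powr (- (1 - \<theta>) / \<theta>) * u powr d"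
proof (cases "k = 0 \<or> u = 0")
  case True
  then have "k * u = 0" by auto
  moreover have "0 \<le> e * (k powr (1 / (1 - \<theta>)) * u powr c) + e powr (- (1 - \<theta>) / \<theta>) * u powr d"
    using assms by (intro add_nonneg_nonneg mult_nonneg_nonneg) auto
  ultimately show ?thesis by (simp only:)
next
  case False
  then have pos: "0 < k" "0 < u" using assms by auto
  define A where "A = e * (k powr (1 / (1 - \<theta>)) * u powr c)"
  define D where "D = e powr (- (1 - \<theta>) / \<theta>) * u powr d"
  have AD: "0 < A" "0 < D" using pos assms by (auto simp: A_def D_def)
  have A1: "A powr (1 - \<theta>) = e powr (1 - \<theta>) * (k * u powr (c * (1 - \<theta>)))"
    using pos assms by (simp add: A_def powr_mult powr_powr)
  have D1: "D powr \<theta> = e powr (- (1 - \<theta>)) * u powr (d * \<theta>)"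
    using pos assms by (simp add: D_def powr_mult powr_powr)
  have "A powr (1 - \<theta>) * D powr \<theta> = (e powr (1 - \<theta>) * e powr (- (1 - \<theta>))) * (k * (u powr (c * (1 - \<theta>)) * u powr (d * \<theta>)))"
    unfolding A1 D1 by (simp only: mult_ac)
  also have "e powr (1 - \<theta>) * e powr (- (1 - \<theta>)) = 1" using assms by (simp flip: powr_add)
  also have "u powr (c * (1 - \<theta>)) * u powr (d * \<theta>) = u" using assms pos by (simp flip: powr_add)
  finally have "k * u = A powr (1 - \<theta>) * D powr \<theta>" by simp
  also have "\<dots> \<le> (1 - \<theta>) * A + \<theta> * D"
    using AD assms by (intro Youngs_inequality_0) auto
  also have "\<dots> \<le> A + D"
    using AD assms by (intro add_mono) (auto simp: mult_le_cancel_right1)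
  finally show ?thesis by (simp add: A_def D_def)
qed

text \<open>Hoelder's inequality with exponents \<open>1 / (1 - \<theta>)\<close> and
  \<open>1 / \<theta>\<close>, except that the powers of \<open>u\<close> vary with
  \<open>y\<close>. It is obtained by integrating Young's inequality with a free parameter
  \<open>e\<close>, hence the factor 2.\<close>

lemma fractional_average_le:
  fixes Q :: "(real^'n) set" and k u c d :: "real^'n \<Rightarrow> real"
  assumes Q: "cube Q" and \<theta>: "0 < \<theta>" "\<theta> < 1"
    and [measurable]: "k \<in> borel_measurable lebesgue" "u \<in> borel_measurable lebesgue"
      "c \<in> borel_measurable lebesgue" "d \<in> borel_measurable lebesgue"
    and nn: "\<And>y. 0 \<le> k y" "\<And>y. 0 \<le> u y" and cd: "\<And>y. c y * (1 - \<theta>) + d y * \<theta> = 1"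
    and h: "(\<integral>\<^sup>+y. ennreal (u y powr d y) \<partial>lebesgue) \<le> 1"
    and X: "(\<integral>\<^sup>+y\<in>Q. ennreal (k y powr (1 / (1 - \<theta>))) * ennreal (u y powr c y) \<partial>lebesgue) \<le> W * emeasure lebesgue Q"
  shows "ennreal (measure lebesgue Q powr (\<theta> - 1)) * (\<integral>\<^sup>+y\<in>Q. ennreal (k y * u y) \<partial>lebesgue) \<le> 2 * epow W (1 - \<theta>)"
proof (cases W)
  case (real w)
  define V where "V = measure lebesgue Q"
  have V: "0 < V" "emeasure lebesgue Q = ennreal V" using cube_emeasure[OF Q] by (auto simp: V_def)
  note [measurable] = cube_sets[OF Q]
  let ?I = "\<integral>\<^sup>+y\<in>Q. ennreal (k y * u y) \<partial>lebesgue"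
  have main: "?I \<le> ennreal (2 * \<xi> powr (1 - \<theta>))" if \<xi>: "0 < \<xi>" "w * V \<le> \<xi>" for \<xi>
  proof -
    \<comment> \<open>Balances the two terms of Young's inequality: both become
      \<open>\<xi> powr (1 - \<theta>)\<close>.\<close>
    define e where "e = \<xi> powr (- \<theta>)"
    have e: "0 < e" using \<xi> by (simp add: e_def)
    have e1: "e * \<xi> = \<xi> powr (1 - \<theta>)"
    proof -
      have "\<xi> powr (1 - \<theta>) = \<xi> powr (- \<theta>) * \<xi> powr 1" by (subst powr_add[symmetric]) simp
      then show ?thesis using \<xi> by (simp add: e_def)
    qed
    have e2: "e powr (- (1 - \<theta>) / \<theta>) = \<xi> powr (1 - \<theta>)"
      using \<theta> unfolding e_def powr_powr by simp
    have "?I \<le> (\<integral>\<^sup>+y. ennreal e * (ennreal (k y powr (1 / (1 - \<theta>))) * ennreal (u y powr c y) * indicator Q y) +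
        ennreal (e powr (- (1 - \<theta>) / \<theta>)) * ennreal (u y powr d y) \<partial>lebesgue)"
    proof (intro nn_integral_mono)
      fix y
      have "ennreal (k y * u y) \<le> ennreal (e * (k y powr (1 / (1 - \<theta>)) * u y powr c y) + e powr (- (1 - \<theta>) / \<theta>) * u y powr d y)"
        by (intro ennreal_leI young_split nn \<theta> e cd)
      also have "\<dots> = ennreal e * (ennreal (k y powr (1 / (1 - \<theta>))) * ennreal (u y powr c y)) + ennreal (e powr (- (1 - \<theta>) / \<theta>)) * ennreal (u y powr d y)"
        using e by (simp add: ennreal_plus ennreal_mult)
      finally show "ennreal (k y * u y) * indicator Q y \<le> ennreal e * (ennreal (k y powr (1 / (1 - \<theta>))) * ennreal (u y powr c y) * indicator Q y) +
        ennreal (e powr (- (1 - \<theta>) / \<theta>)) * ennreal (u y powr d y)"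
        by (auto simp: indicator_def)
    qed
    also have "\<dots> = ennreal e * (\<integral>\<^sup>+y\<in>Q. ennreal (k y powr (1 / (1 - \<theta>))) * ennreal (u y powr c y) \<partial>lebesgue) +
        ennreal (e powr (- (1 - \<theta>) / \<theta>)) * (\<integral>\<^sup>+y. ennreal (u y powr d y) \<partial>lebesgue)"
      by (simp add: nn_integral_add nn_integral_cmult)
    also have "\<dots> \<le> ennreal e * ennreal \<xi> + ennreal (e powr (- (1 - \<theta>) / \<theta>)) * 1"
    proof (intro add_mono mult_left_mono h)
      have "W * emeasure lebesgue Q = ennreal (w * V)" using real V by (simp add: ennreal_mult)
      also have "\<dots> \<le> ennreal \<xi>" by (intro ennreal_leI \<xi>)
      finally show "(\<integral>\<^sup>+y\<in>Q. ennreal (k y powr (1 / (1 - \<theta>))) * ennreal (u y powr c y) \<partial>lebesgue) \<le> ennreal \<xi>"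
        using X by (rule order_trans[rotated])
    qed auto
    also have "\<dots> = ennreal (2 * \<xi> powr (1 - \<theta>))"
      unfolding e2 using e \<xi> e1 by (simp flip: ennreal_mult ennreal_plus)
    finally show ?thesis .
  qed
  have eps: "ennreal (V powr (\<theta> - 1)) * ?I \<le> 2 * epow W (1 - \<theta>) + ennreal \<epsilon>" if \<epsilon>: "0 < \<epsilon>" for \<epsilon>
  proof -
    \<comment> \<open>The slack \<open>\<epsilon> / 2\<close> keeps \<open>l\<close>, and with it
      the value of \<open>\<xi>\<close> built from it, positive when \<open>w = 0\<close>.\<close>
    define l where "l = w powr (1 - \<theta>) + \<epsilon> / 2"
    have l: "0 < l" using \<epsilon> by (auto simp: l_def intro: add_nonneg_pos)
    have "w = (w powr (1 - \<theta>)) powr (1 / (1 - \<theta>))" using real \<theta> by (simp add: powr_powr)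
    also have "\<dots> \<le> l powr (1 / (1 - \<theta>))" using \<epsilon> \<theta> by (intro powr_mono2) (auto simp: l_def)
    finally have "w * V \<le> l powr (1 / (1 - \<theta>)) * V" using V by (intro mult_right_mono) auto
    then have "?I \<le> ennreal (2 * (l powr (1 / (1 - \<theta>)) * V) powr (1 - \<theta>))" using l V by (intro main) auto
    also have "(l powr (1 / (1 - \<theta>)) * V) powr (1 - \<theta>) = l * V powr (1 - \<theta>)"
      using l \<theta> by (simp add: powr_mult powr_powr)
    finally have "ennreal (V powr (\<theta> - 1)) * ?I \<le> ennreal (V powr (\<theta> - 1)) * ennreal (2 * (l * V powr (1 - \<theta>)))"
      by (rule mult_left_mono) simp
    also have "\<dots> = ennreal (2 * l * (V powr (\<theta> - 1) * V powr (1 - \<theta>)))"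
      by (subst ennreal_mult'[symmetric]) (auto simp: mult_ac)
    also have "V powr (\<theta> - 1) * V powr (1 - \<theta>) = 1" using V by (simp flip: powr_add)
    also have "ennreal (2 * l * 1) = 2 * epow W (1 - \<theta>) + ennreal \<epsilon>"
      using real \<epsilon> by (simp add: l_def distrib_left ennreal_plus ennreal_mult)
    finally show ?thesis .
  qed
  then show ?thesis unfolding V_def by (rule ennreal_le_epsilon)
qed (simp add: ennreal_mult_top)

text \<open>Because of the summand 1 in the kernel, \<open>V\<close> also bounds
  \<open>Mfrac \<alpha> f x\<close>; for finite \<open>V\<close> both maximal functions are then
  finite and the difference may be formed in the reals. The triangle inequality compares the second
  maximal function with \<open>|b x|\<close> times the first, so a negative \<open>b x\<close> costs
  at most \<open>2 * N\<close> times the first one, whence \<open>1 + 2 * N\<close>.\<close>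

lemma comm_le:
  fixes b f :: "real^'n \<Rightarrow> real"
  assumes [measurable]: "b \<in> borel_measurable lebesgue" "f \<in> borel_measurable lebesgue"
    and N: "negpart b x \<le> N" "0 \<le> N"
    and V: "\<And>Q. cube Q \<Longrightarrow> x \<in> Q \<Longrightarrow> ennreal (measure lebesgue Q powr (\<alpha> / real CARD('n) - 1)) *
      (\<integral>\<^sup>+y\<in>Q. ennreal ((\<bar>b x - b y\<bar> + 1) * \<bar>f y\<bar>) \<partial>lebesgue) \<le> V"
  shows "eabs (comm \<alpha> b f x) \<le> ennreal (1 + 2 * N) * V"
proof (cases V)
  case (real v)
  define \<kappa> where "\<kappa> Q = ennreal (measure lebesgue Q powr (\<alpha> / real CARD('n) - 1))" for Q :: "(real^'n) set"
  define U1 where "U1 = Mfrac \<alpha> f x"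
  define U2 where "U2 = Mfrac \<alpha> (\<lambda>y. b y * f y) x"
  have U1_up: "\<kappa> Q * (\<integral>\<^sup>+y\<in>Q. ennreal \<bar>f y\<bar> \<partial>lebesgue) \<le> U1" if "cube Q" "x \<in> Q" for Q
    unfolding U1_def Mfrac_def \<kappa>_def using that by (intro SUP_upper) auto
  have U2_up: "\<kappa> Q * (\<integral>\<^sup>+y\<in>Q. ennreal \<bar>b y * f y\<bar> \<partial>lebesgue) \<le> U2" if "cube Q" "x \<in> Q" for Q
    unfolding U2_def Mfrac_def \<kappa>_def using that by (intro SUP_upper) auto
  have "U1 \<le> V"
    unfolding U1_def Mfrac_def
  proof (rule SUP_least)
    fix Q assume "Q \<in> {Q. cube Q \<and> x \<in> Q}"
    then have Q: "cube Q" "x \<in> Q" by auto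
    have "(\<integral>\<^sup>+y\<in>Q. ennreal \<bar>f y\<bar> \<partial>lebesgue) \<le> (\<integral>\<^sup>+y\<in>Q. ennreal ((\<bar>b x - b y\<bar> + 1) * \<bar>f y\<bar>) \<partial>lebesgue)"
      by (intro nn_integral_mono mult_right_mono ennreal_leI) (auto simp: mult_le_cancel_right1)
    then show "ennreal (measure lebesgue Q powr (\<alpha> / real CARD('n) - 1)) * (\<integral>\<^sup>+y\<in>Q. ennreal \<bar>f y\<bar> \<partial>lebesgue) \<le> V"
      using order_trans[OF mult_left_mono V[OF Q]] by simp
  qed
  then obtain u1 where u1: "U1 = ennreal u1" "0 \<le> u1" "u1 \<le> v" using real by (cases U1) (auto simp: top_unique)
  have tri: "\<kappa> Q * (\<integral>\<^sup>+y\<in>Q. ennreal (g1 y) \<partial>lebesgue) \<le> V + \<kappa> Q * (\<integral>\<^sup>+y\<in>Q. ennreal (g2 y) \<partial>lebesgue)"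
    if Q: "cube Q" "x \<in> Q" and [measurable]: "g1 \<in> borel_measurable lebesgue" "g2 \<in> borel_measurable lebesgue"
      and g: "\<And>y. g1 y \<le> (\<bar>b x - b y\<bar> + 1) * \<bar>f y\<bar> + g2 y" "\<And>y. 0 \<le> g2 y" for Q g1 g2
  proof -
    note [measurable] = cube_sets[OF Q(1)]
    have "(\<integral>\<^sup>+y\<in>Q. ennreal (g1 y) \<partial>lebesgue) \<le> (\<integral>\<^sup>+y. ennreal ((\<bar>b x - b y\<bar> + 1) * \<bar>f y\<bar>) * indicator Q y + ennreal (g2 y) * indicator Q y \<partial>lebesgue)"
    proof (intro nn_integral_mono)
      fix y
      have "ennreal (g1 y) \<le> ennreal ((\<bar>b x - b y\<bar> + 1) * \<bar>f y\<bar> + g2 y)" by (intro ennreal_leI g)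
      also have "\<dots> = ennreal ((\<bar>b x - b y\<bar> + 1) * \<bar>f y\<bar>) + ennreal (g2 y)" using g(2) by (intro ennreal_plus) auto
      finally show "ennreal (g1 y) * indicator Q y \<le> ennreal ((\<bar>b x - b y\<bar> + 1) * \<bar>f y\<bar>) * indicator Q y + ennreal (g2 y) * indicator Q y"
        by (auto simp: indicator_def)
    qed
    also have "\<dots> = (\<integral>\<^sup>+y\<in>Q. ennreal ((\<bar>b x - b y\<bar> + 1) * \<bar>f y\<bar>) \<partial>lebesgue) + (\<integral>\<^sup>+y\<in>Q. ennreal (g2 y) \<partial>lebesgue)"
      by (intro nn_integral_add) measurable
    finally have "\<kappa> Q * (\<integral>\<^sup>+y\<in>Q. ennreal (g1 y) \<partial>lebesgue) \<le>
        \<kappa> Q * ((\<integral>\<^sup>+y\<in>Q. ennreal ((\<bar>b x - b y\<bar> + 1) * \<bar>f y\<bar>) \<partial>lebesgue) + (\<integral>\<^sup>+y\<in>Q. ennreal (g2 y) \<partial>lebesgue))"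
      by (rule mult_left_mono) simp
    also have "\<dots> = \<kappa> Q * (\<integral>\<^sup>+y\<in>Q. ennreal ((\<bar>b x - b y\<bar> + 1) * \<bar>f y\<bar>) \<partial>lebesgue) + \<kappa> Q * (\<integral>\<^sup>+y\<in>Q. ennreal (g2 y) \<partial>lebesgue)"
      by (rule distrib_left)
    also have "\<dots> \<le> V + \<kappa> Q * (\<integral>\<^sup>+y\<in>Q. ennreal (g2 y) \<partial>lebesgue)"
      unfolding \<kappa>_def by (intro add_right_mono V Q)
    finally show ?thesis .
  qed
  have cst: "\<kappa> Q * (\<integral>\<^sup>+y\<in>Q. ennreal (\<bar>b x\<bar> * \<bar>f y\<bar>) \<partial>lebesgue) = ennreal \<bar>b x\<bar> * (\<kappa> Q * (\<integral>\<^sup>+y\<in>Q. ennreal \<bar>f y\<bar> \<partial>lebesgue))"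
    if Q: "cube Q" for Q
  proof -
    note [measurable] = cube_sets[OF Q]
    have "(\<integral>\<^sup>+y\<in>Q. ennreal (\<bar>b x\<bar> * \<bar>f y\<bar>) \<partial>lebesgue) = (\<integral>\<^sup>+y. ennreal \<bar>b x\<bar> * (ennreal \<bar>f y\<bar> * indicator Q y) \<partial>lebesgue)"
      by (intro nn_integral_cong) (simp add: ennreal_mult mult.assoc)
    also have "\<dots> = ennreal \<bar>b x\<bar> * (\<integral>\<^sup>+y\<in>Q. ennreal \<bar>f y\<bar> \<partial>lebesgue)" by (intro nn_integral_cmult) measurable
    finally show ?thesis by (simp only: mult.left_commute)
  qed
  have 1: "U2 \<le> V + ennreal \<bar>b x\<bar> * U1"
    unfolding U2_def Mfrac_def
  proof (rule SUP_least)
    fix Q assume "Q \<in> {Q. cube Q \<and> x \<in> Q}"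
    then have Q: "cube Q" "x \<in> Q" by auto
    have "\<kappa> Q * (\<integral>\<^sup>+y\<in>Q. ennreal \<bar>b y * f y\<bar> \<partial>lebesgue) \<le> V + \<kappa> Q * (\<integral>\<^sup>+y\<in>Q. ennreal (\<bar>b x\<bar> * \<bar>f y\<bar>) \<partial>lebesgue)"
    proof (rule tri[OF Q])
      fix y
      have "\<bar>b y\<bar> * \<bar>f y\<bar> \<le> (\<bar>b x - b y\<bar> + 1 + \<bar>b x\<bar>) * \<bar>f y\<bar>" by (intro mult_right_mono) auto
      then show "\<bar>b y * f y\<bar> \<le> (\<bar>b x - b y\<bar> + 1) * \<bar>f y\<bar> + \<bar>b x\<bar> * \<bar>f y\<bar>" by (simp add: abs_mult distrib_right)
    qed simp_all
    also have "\<dots> \<le> V + ennreal \<bar>b x\<bar> * U1"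
      unfolding cst[OF Q(1)] by (intro add_left_mono mult_left_mono U1_up Q) simp
    finally show "ennreal (measure lebesgue Q powr (\<alpha> / real CARD('n) - 1)) * (\<integral>\<^sup>+y\<in>Q. ennreal \<bar>b y * f y\<bar> \<partial>lebesgue) \<le> V + ennreal \<bar>b x\<bar> * U1"
      by (simp only: \<kappa>_def)
  qed
  then have "U2 \<noteq> top" using real u1 by (auto simp: top_unique ennreal_mult_eq_top_iff)
  then obtain u2 where u2: "U2 = ennreal u2" "0 \<le> u2" by (cases U2) auto
  have 2: "ennreal \<bar>b x\<bar> * U1 \<le> V + U2"
  proof -
    have "ennreal \<bar>b x\<bar> * U1 = (SUP Q\<in>{Q. cube Q \<and> x \<in> Q}. ennreal \<bar>b x\<bar> * (\<kappa> Q * (\<integral>\<^sup>+y\<in>Q. ennreal \<bar>f y\<bar> \<partial>lebesgue)))"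
      unfolding U1_def Mfrac_def \<kappa>_def by (rule SUP_mult_left_ennreal)
    also have "\<dots> \<le> V + U2"
    proof (rule SUP_least)
      fix Q assume "Q \<in> {Q. cube Q \<and> x \<in> Q}"
      then have Q: "cube Q" "x \<in> Q" by auto
      have "\<kappa> Q * (\<integral>\<^sup>+y\<in>Q. ennreal (\<bar>b x\<bar> * \<bar>f y\<bar>) \<partial>lebesgue) \<le> V + \<kappa> Q * (\<integral>\<^sup>+y\<in>Q. ennreal \<bar>b y * f y\<bar> \<partial>lebesgue)"
      proof (rule tri[OF Q])
        fix y
        have "\<bar>b x\<bar> * \<bar>f y\<bar> \<le> (\<bar>b x - b y\<bar> + 1 + \<bar>b y\<bar>) * \<bar>f y\<bar>" by (intro mult_right_mono) auto
        then show "\<bar>b x\<bar> * \<bar>f y\<bar> \<le> (\<bar>b x - b y\<bar> + 1) * \<bar>f y\<bar> + \<bar>b y * f y\<bar>" by (simp add: abs_mult distrib_right)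
      qed simp_all
      also have "\<dots> \<le> V + U2" by (intro add_left_mono U2_up Q)
      finally show "ennreal \<bar>b x\<bar> * (\<kappa> Q * (\<integral>\<^sup>+y\<in>Q. ennreal \<bar>f y\<bar> \<partial>lebesgue)) \<le> V + U2"
        by (simp only: cst[OF Q(1)])
    qed
    finally show ?thesis .
  qed
  have r1: "u2 \<le> v + \<bar>b x\<bar> * u1"
    using 1 real u1 u2 by (simp add: ennreal_mult[symmetric] ennreal_plus[symmetric] del: ennreal_plus)
  have r2: "\<bar>b x\<bar> * u1 \<le> v + u2"
    using 2 real u1 u2 by (simp add: ennreal_mult[symmetric] ennreal_plus[symmetric] del: ennreal_plus)
  have "comm \<alpha> b f x = ereal (b x * u1 - u2)"
    unfolding comm_def U1_def[symmetric] U2_def[symmetric] u1(1) u2(1) using u1 u2 by (simp add: enn2ereal_ennreal)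
  then have "eabs (comm \<alpha> b f x) = ennreal \<bar>b x * u1 - u2\<bar>" by simp
  also have "\<bar>b x * u1 - u2\<bar> \<le> (1 + 2 * N) * v"
  proof (cases "b x < 0")
    case True
    then have "\<bar>b x\<bar> * u1 \<le> N * v" using N u1 by (intro mult_mono) (auto simp: negpart_def)
    moreover have "\<bar>b x * u1 - u2\<bar> = \<bar>b x\<bar> * u1 + u2" using True u1 u2 mult_nonpos_nonneg[of "b x" u1] by simp
    ultimately show ?thesis using r1 by (simp add: distrib_right)
  next
    case False
    then have "\<bar>b x * u1 - u2\<bar> \<le> v" using r1 r2 by simp
    also have "\<dots> \<le> (1 + 2 * N) * v" using N(2) u1 by (simp add: distrib_right)
    finally show ?thesis .
  qed
  finally have "eabs (comm \<alpha> b f x) \<le> ennreal ((1 + 2 * N) * v)" by (simp add: ennreal_leI)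
  also have "\<dots> = ennreal (1 + 2 * N) * V" using real N(2) by (subst ennreal_mult) auto
  finally show ?thesis .
next
  case top
  then show ?thesis using N(2) by (simp add: ennreal_mult_top ennreal_eq_0_iff)
qed

section \<open>The equivalences\<close>

text \<open>The last identity is \<open>1 / q = 1 / p - \<theta>\<close> in the form of the exponent
  balance that \<open>fractional_average_le\<close> asks for.\<close>

lemma Bgam_facts:
  fixes p q :: "real^'n \<Rightarrow> real"
  assumes "Bgam \<alpha> p q" "0 < \<alpha>" "\<alpha> < real CARD('n)"
  defines "\<theta> \<equiv> \<alpha> / real CARD('n)"
  defines "s \<equiv> (\<lambda>x. q x * (real CARD('n) - \<alpha>) / real CARD('n))"
  shows "0 < \<theta>" "\<theta> < 1" "s \<in> Bexp" "p \<in> Pexp" "\<And>x. s x = q x * (1 - \<theta>)" "\<And>x. 1 \<le> q x"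
    "\<And>x. p x / s x * (1 - \<theta>) + p x * \<theta> = 1"
proof -
  have n: "0 < real CARD('n)" by simp
  show \<theta>: "0 < \<theta>" "\<theta> < 1" using assms(2,3) n by (auto simp: \<theta>_def)
  show sB: "s \<in> Bexp" and pP: "p \<in> Pexp" using assms(1) by (auto simp: Bgam_def s_def)
  show sq: "s x = q x * (1 - \<theta>)" for x using n by (simp add: s_def \<theta>_def field_simps)
  have s1: "1 \<le> s x" for x using sB PexpD(2) by (auto simp: Bexp_def)
  have q: "1 / (1 - \<theta>) \<le> q x" for x using s1[of x] \<theta> unfolding sq by (simp add: pos_divide_le_eq)
  have "1 \<le> 1 / (1 - \<theta>)" using \<theta> by simp
  then show q1: "1 \<le> q x" for x using q[of x] by linarith
  show "p x / s x * (1 - \<theta>) + p x * \<theta> = 1" for x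
  proof -
    have p0: "1 \<le> p x" by (rule PexpD(2)[OF pP])
    have "1 / q x = 1 / p x - \<theta>" using assms(1) by (auto simp: Bgam_def \<theta>_def)
    have "p x / s x * (1 - \<theta>) = p x * (1 / q x)" using \<theta> q1[of x] by (simp add: sq)
    also have "\<dots> = 1 - p x * \<theta>" unfolding \<open>1 / q x = 1 / p x - \<theta>\<close> using p0 by (simp add: right_diff_distrib)
    finally show ?thesis by simp
  qed
qed

text \<open>With \<open>u = |f| / t\<close>, the function \<open>u powr (p / s)\<close> has for
  \<open>s\<close> the modular that \<open>u\<close> has for \<open>p\<close>, so it can be fed to
  the maximal commutator with power \<open>1 / (1 - \<theta>)\<close>. On the way back,
  \<open>epow Y (1 - \<theta>)\<close> has for \<open>q\<close> the modular that \<open>Y\<close>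
  has for \<open>s\<close>, because \<open>s = q * (1 - \<theta>)\<close>.\<close>

lemma commutator_bounded_if_bmo:
  fixes b p q :: "real^'n \<Rightarrow> real"
  assumes b: "bmo_bd b B" and N: "AE x in lebesgue. negpart b x \<le> N" "0 \<le> N"
    and \<alpha>: "0 < \<alpha>" "\<alpha> < real CARD('n)" and pq: "Bgam \<alpha> p q"
  shows "bounded_op p q (comm \<alpha> b)"
proof -
  define \<theta> where "\<theta> = \<alpha> / real CARD('n)"
  define s where "s x = q x * (real CARD('n) - \<alpha>) / real CARD('n)" for x
  note facts = Bgam_facts[OF pq \<alpha>, folded \<theta>_def s_def]
  have sP: "s \<in> Pexp" using facts(3) by (simp add: Bexp_def)
  note s = PexpD(1,2)[OF sP] and p = PexpD(1,2)[OF facts(4)]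
  obtain S where S: "AE x in lebesgue. s x \<le> S" using PexpD(3)[OF sP] by blast
  obtain A where A: "0 < A" "ballbd s A" using Bexp_ballbd[OF facts(3)] by blast
  have loc: "loc_integrable b" using b by (simp add: bmo_bd_def)
  note [measurable] = loc_integrable_measurable[OF loc] s(1) p(1)
  have r: "0 \<le> 1 / (1 - \<theta>)" using facts(2) by simp
  obtain C where C: "0 < C" and mc: "\<And>F. F \<in> borel_measurable lebesgue \<Longrightarrow> mdl s F \<le> 1 \<Longrightarrow>
      \<exists>Y\<in>borel_measurable lebesgue. mdl s Y \<le> 1 \<and> (AE x in lebesgue. \<forall>Q. cube Q \<longrightarrow> x \<in> Q \<longrightarrow>
        (\<integral>\<^sup>+y\<in>Q. ennreal ((\<bar>b x - b y\<bar> + 1) powr (1 / (1 - \<theta>))) * F y \<partial>lebesgue) \<le> ennreal C * Y x * emeasure lebesgue Q)"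
    using maximal_commutator[OF s S A(2,1) b r] by blast
  define D where "D = (1 + 2 * N) * 2 * C powr (1 - \<theta>)"
  have D: "0 < D" using N(2) C by (simp add: D_def add_pos_nonneg)
  show ?thesis
  proof (rule bounded_opI[OF D])
    fix f :: "real^'n \<Rightarrow> real" and t :: real
    assume f [measurable]: "f \<in> borel_measurable lebesgue" and t: "0 < t"
      and f1: "mdl p (\<lambda>x. ennreal (1 / t) * ennreal \<bar>f x\<bar>) \<le> 1"
    define u where "u y = \<bar>f y\<bar> / t" for y
    have u: "0 \<le> u y" for y using t by (simp add: u_def)
    have um [measurable]: "u \<in> borel_measurable lebesgue" unfolding u_def[abs_def] by measurable
    have f1': "(\<integral>\<^sup>+y. ennreal (u y powr p y) \<partial>lebesgue) \<le> 1"
    proof -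
      have "ennreal (1 / t) * ennreal \<bar>f x\<bar> = ennreal (u x)" for x
        using t by (simp add: u_def ennreal_mult[symmetric])
      then show ?thesis using f1 u by (simp add: mdl_def)
    qed
    define G where "G y = ennreal (u y powr (p y / s y))" for y
    have Gm: "G \<in> borel_measurable lebesgue" unfolding G_def[abs_def] by measurable
    have "mdl s G = (\<integral>\<^sup>+y. ennreal (u y powr p y) \<partial>lebesgue)"
      unfolding mdl_def G_def
    proof (intro nn_integral_cong)
      fix x show "epow (ennreal (u x powr (p x / s x))) (s x) = ennreal (u x powr p x)"
        using s(2)[of x] by (simp add: powr_powr)
    qed
    then have "mdl s G \<le> 1" using f1' by simp
    from mc[OF Gm this] obtain Y where Y: "Y \<in> borel_measurable lebesgue" "mdl s Y \<le> 1"
      and YAE: "AE x in lebesgue. \<forall>Q. cube Q \<longrightarrow> x \<in> Q \<longrightarrow>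
        (\<integral>\<^sup>+y\<in>Q. ennreal ((\<bar>b x - b y\<bar> + 1) powr (1 / (1 - \<theta>))) * G y \<partial>lebesgue) \<le> ennreal C * Y x * emeasure lebesgue Q"
      by blast
    have q0: "0 \<le> q x" for x using facts(6)[of x] by simp
    have "AE x in lebesgue. ennreal (1 / (D * t)) * eabs (comm \<alpha> b f x) \<le> epow (Y x) (1 - \<theta>)"
      using YAE N(1)
    proof eventually_elim
      case (elim x)
      have "eabs (comm \<alpha> b f x) \<le> ennreal (1 + 2 * N) * (ennreal t * (2 * epow (ennreal C * Y x) (1 - \<theta>)))"
      proof (rule comm_le[OF _ f elim(2) N(2)])
        fix Q :: "(real^'n) set" assume Q: "cube Q" "x \<in> Q"
        note [measurable] = cube_sets[OF Q(1)]
        have "ennreal (measure lebesgue Q powr (\<theta> - 1)) * (\<integral>\<^sup>+y\<in>Q. ennreal ((\<bar>b x - b y\<bar> + 1) * u y) \<partial>lebesgue) \<le> 2 * epow (ennreal C * Y x) (1 - \<theta>)"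
          by (rule fractional_average_le[OF Q(1) facts(1,2), where c = "\<lambda>y. p y / s y" and d = p])
             (use elim(1) Q f1' u facts(7) in \<open>auto simp: G_def\<close>)
        then have "ennreal t * (ennreal (measure lebesgue Q powr (\<theta> - 1)) * (\<integral>\<^sup>+y\<in>Q. ennreal ((\<bar>b x - b y\<bar> + 1) * u y) \<partial>lebesgue)) \<le> ennreal t * (2 * epow (ennreal C * Y x) (1 - \<theta>))"
          by (rule mult_left_mono) simp
        moreover have "(\<integral>\<^sup>+y\<in>Q. ennreal ((\<bar>b x - b y\<bar> + 1) * \<bar>f y\<bar>) \<partial>lebesgue) = ennreal t * (\<integral>\<^sup>+y\<in>Q. ennreal ((\<bar>b x - b y\<bar> + 1) * u y) \<partial>lebesgue)"
        proof -
          have "(\<integral>\<^sup>+y\<in>Q. ennreal ((\<bar>b x - b y\<bar> + 1) * \<bar>f y\<bar>) \<partial>lebesgue) = (\<integral>\<^sup>+y. ennreal t * (ennreal ((\<bar>b x - b y\<bar> + 1) * u y) * indicator Q y) \<partial>lebesgue)"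
          proof (intro nn_integral_cong)
            fix y
            have "(\<bar>b x - b y\<bar> + 1) * \<bar>f y\<bar> = t * ((\<bar>b x - b y\<bar> + 1) * u y)" using t by (simp add: u_def)
            then have "ennreal ((\<bar>b x - b y\<bar> + 1) * \<bar>f y\<bar>) = ennreal t * ennreal ((\<bar>b x - b y\<bar> + 1) * u y)"
              using t u[of y] by (simp only: ennreal_mult'[OF less_imp_le])
            then show "ennreal ((\<bar>b x - b y\<bar> + 1) * \<bar>f y\<bar>) * indicator Q y = ennreal t * (ennreal ((\<bar>b x - b y\<bar> + 1) * u y) * indicator Q y)"
              by (simp only: mult.assoc)
          qed
          also have "\<dots> = ennreal t * (\<integral>\<^sup>+y\<in>Q. ennreal ((\<bar>b x - b y\<bar> + 1) * u y) \<partial>lebesgue)"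
            by (intro nn_integral_cmult) measurable
          finally show ?thesis .
        qed
        ultimately show "ennreal (measure lebesgue Q powr (\<alpha> / real CARD('n) - 1)) * (\<integral>\<^sup>+y\<in>Q. ennreal ((\<bar>b x - b y\<bar> + 1) * \<bar>f y\<bar>) \<partial>lebesgue) \<le> ennreal t * (2 * epow (ennreal C * Y x) (1 - \<theta>))"
          unfolding \<theta>_def by (simp only: mult.left_commute)
      qed measurable
      then have "ennreal (1 / (D * t)) * eabs (comm \<alpha> b f x) \<le> ennreal (1 / (D * t)) * (ennreal (1 + 2 * N) * (ennreal t * (2 * epow (ennreal C * Y x) (1 - \<theta>))))"
        by (rule mult_left_mono) simp
      also have "\<dots> = (ennreal (1 / (D * t)) * ennreal (1 + 2 * N) * ennreal t * ennreal 2 * ennreal (C powr (1 - \<theta>))) * epow (Y x) (1 - \<theta>)"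
        using C facts(2) by (simp add: epow_mult mult.assoc)
      also have "ennreal (1 / (D * t)) * ennreal (1 + 2 * N) * ennreal t * ennreal 2 * ennreal (C powr (1 - \<theta>)) =
          ennreal (1 / (D * t) * (1 + 2 * N) * t * 2 * C powr (1 - \<theta>))"
        using D t N(2) by (simp only: ennreal_mult' ennreal_mult'' zero_le_numeral less_imp_le zero_le_mult_iff powr_ge_zero)
      also have "1 / (D * t) * (1 + 2 * N) * t * 2 * C powr (1 - \<theta>) = 1"
      proof -
        have "D * t \<noteq> 0" using D t by simp
        have "1 / (D * t) * (1 + 2 * N) * t * 2 * C powr (1 - \<theta>) = 1 / (D * t) * (((1 + 2 * N) * 2 * C powr (1 - \<theta>)) * t)" by (simp only: mult_ac)
        also have "\<dots> = 1 / (D * t) * (D * t)" by (simp only: D_def)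
        also have "\<dots> = 1" by (simp only: times_divide_eq_left mult_1 divide_self[OF \<open>D * t \<noteq> 0\<close>])
        finally show ?thesis .
      qed
      finally show ?case by simp
    qed
    then have "mdl q (\<lambda>x. ennreal (1 / (D * t)) * eabs (comm \<alpha> b f x)) \<le> mdl q (\<lambda>x. epow (Y x) (1 - \<theta>))"
      by (rule mdl_mono_AE[OF _ q0])
    also have "\<dots> = mdl s Y" unfolding mdl_def epow_epow facts(5) by (simp only: mult.commute)
    finally show "mdl q (\<lambda>x. ennreal (1 / (D * t)) * eabs (comm \<alpha> b f x)) \<le> 1" using Y(2) by simp
  qed
qed

text \<open>The cube \<open>Q\<close> itself gives the lower bound. Over a subcube \<open>P\<close>
  the mean of \<open>|b|\<close> may exceed that over \<open>Q\<close> by an amount that grows as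
  \<open>P\<close> shrinks, but the factor \<open>(|P| / |Q|) powr \<theta>\<close> absorbs this
  growth, since the mean of \<open>|b - cavg Q b| powr (1 / \<theta>)\<close> over \<open>Q\<close>
  is bounded.\<close>

lemma Mloc_bounds:
  fixes b :: "real^'n \<Rightarrow> real"
  assumes b: "bmo_bd b B" and \<alpha>: "0 < \<alpha>" "\<alpha> < real CARD('n)"
  obtains K where "0 < K" "\<And>Q x. cube Q \<Longrightarrow> x \<in> Q \<Longrightarrow> \<exists>z. \<bar>cavg Q b\<bar> \<le> z \<and> z \<le> \<bar>cavg Q b\<bar> + K \<and>
    ennreal (measure lebesgue Q powr (- \<alpha> / real CARD('n))) * Mloc \<alpha> Q b x = ennreal z"
proof -
  define \<theta> where "\<theta> = \<alpha> / real CARD('n)"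
  have \<theta>: "0 < \<theta>" "\<theta> < 1" using \<alpha> by (auto simp: \<theta>_def)
  have loc: "loc_integrable b" using b by (simp add: bmo_bd_def)
  note [measurable] = loc_integrable_measurable[OF loc]
  obtain C where C: "0 < C"
    and osc: "\<And>w Q. w \<in> borel_measurable lebesgue \<Longrightarrow> (\<And>x. MX w x \<le> ennreal 1 * w x) \<Longrightarrow> cube Q \<Longrightarrow>
      (\<integral>\<^sup>+y\<in>Q. ennreal (\<bar>b y - cavg Q b\<bar> powr (1 / \<theta>)) * w y \<partial>lebesgue) \<le> ennreal C * (\<integral>\<^sup>+y\<in>Q. w y \<partial>lebesgue)"
    using A1_oscillation[OF b, of "1 / \<theta>" 1] \<theta> by auto
  show thesis
  proof (rule that[of "1 + C"])
    show "0 < 1 + C" using C by simp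
    fix Q :: "(real^'n) set" and x assume Q: "cube Q" "x \<in> Q"
    define V where "V = measure lebesgue Q"
    define \<beta> where "\<beta> = cavg Q b"
    have V: "0 < V" "emeasure lebesgue Q = ennreal V" using cube_emeasure[OF Q(1)] by (auto simp: V_def)
    note [measurable] = cube_sets[OF Q(1)]
    have m: "(\<integral>\<^sup>+y\<in>Q. ennreal (\<bar>b y - \<beta>\<bar> powr (1 / \<theta>)) \<partial>lebesgue) \<le> ennreal (C * V)"
    proof -
      \<comment> \<open>The constant weight 1 is admissible in \<open>osc\<close> with constant 1,
        which yields the unweighted John-Nirenberg bound in the mean.\<close>
      have "MX (\<lambda>x. 1) x \<le> ennreal 1 * 1" for x :: "real^'n" by (auto simp: MX_le_iff cube_sets)
      from osc[OF _ this Q(1)] show ?thesis using V C by (simp add: \<beta>_def ennreal_mult)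
    qed
    have up: "ennreal (measure lebesgue P powr (\<theta> - 1)) * (\<integral>\<^sup>+y\<in>P. ennreal \<bar>b y\<bar> \<partial>lebesgue) \<le> ennreal (V powr \<theta> * (\<bar>\<beta>\<bar> + (1 + C)))"
      if P: "cube P" "P \<subseteq> Q" for P
    proof -
      define U where "U = measure lebesgue P"
      have U: "0 < U" "emeasure lebesgue P = ennreal U" using cube_emeasure[OF P(1)] by (auto simp: U_def)
      have "emeasure lebesgue P \<le> emeasure lebesgue Q" using P(2) by (intro emeasure_mono) auto
      then have UV: "U \<le> V" using U V by simp
      note [measurable] = cube_sets[OF P(1)]
      \<comment> \<open>A truncation height: deviations up to it contribute at most \<open>l\<close>
        to the mean over \<open>P\<close>, larger ones at most \<open>C * l\<close>, and
        \<open>U powr \<theta> * l = V powr \<theta>\<close> removes the dependence on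
        \<open>P\<close>.\<close>
      define l where "l = (V / U) powr \<theta>"
      have l: "1 \<le> l" "0 < l" using UV U \<theta> by (auto simp: l_def intro!: ge_one_powr_ge_zero)
      have l2: "l powr (1 - 1 / \<theta>) * V = l * U"
      proof -
        have "l powr (1 - 1 / \<theta>) = l powr 1 / l powr (1 / \<theta>)" by (rule powr_diff)
        also have "l powr (1 / \<theta>) = V / U" using U V \<theta> by (simp add: l_def powr_powr)
        finally show ?thesis using U V l by simp
      qed
      have pt: "\<bar>b y\<bar> \<le> (\<bar>\<beta>\<bar> + l) + l powr (1 - 1 / \<theta>) * \<bar>b y - \<beta>\<bar> powr (1 / \<theta>)" for y
      proof -
        define v where "v = \<bar>b y - \<beta>\<bar>"
        have "v \<le> l + l powr (1 - 1 / \<theta>) * v powr (1 / \<theta>)"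
        proof (cases "v \<le> l")
          case True
          then show ?thesis by (intro add_increasing2) auto
        next
          case False
          then have v: "0 < v" using l by simp
          have "1 - 1 / \<theta> \<le> 0" using \<theta> by simp
          then have "v powr (1 - 1 / \<theta>) \<le> l powr (1 - 1 / \<theta>)" using False l by (intro powr_mono2') auto
          then have "v powr (1 - 1 / \<theta>) * v powr (1 / \<theta>) \<le> l powr (1 - 1 / \<theta>) * v powr (1 / \<theta>)" by (rule mult_right_mono) simp
          moreover have "v powr (1 - 1 / \<theta>) * v powr (1 / \<theta>) = v" using v by (simp flip: powr_add)
          ultimately show ?thesis using l by simp
        qed
        then show ?thesis unfolding v_def by linarith
      qed
      have "(\<integral>\<^sup>+y\<in>P. ennreal \<bar>b y\<bar> \<partial>lebesgue) \<le>
          (\<integral>\<^sup>+y. ennreal (\<bar>\<beta>\<bar> + l) * indicator P y + ennreal (l powr (1 - 1 / \<theta>)) * (ennreal (\<bar>b y - \<beta>\<bar> powr (1 / \<theta>)) * indicator Q y) \<partial>lebesgue)"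
      proof (intro nn_integral_mono)
        fix y
        have "ennreal \<bar>b y\<bar> \<le> ennreal ((\<bar>\<beta>\<bar> + l) + l powr (1 - 1 / \<theta>) * \<bar>b y - \<beta>\<bar> powr (1 / \<theta>))" by (intro ennreal_leI pt)
        also have "\<dots> = ennreal (\<bar>\<beta>\<bar> + l) + ennreal (l powr (1 - 1 / \<theta>)) * ennreal (\<bar>b y - \<beta>\<bar> powr (1 / \<theta>))"
          using l by (subst ennreal_plus) (auto simp: ennreal_mult)
        finally show "ennreal \<bar>b y\<bar> * indicator P y \<le> ennreal (\<bar>\<beta>\<bar> + l) * indicator P y + ennreal (l powr (1 - 1 / \<theta>)) * (ennreal (\<bar>b y - \<beta>\<bar> powr (1 / \<theta>)) * indicator Q y)"
          using P(2) by (auto simp: indicator_def)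
      qed
      also have "\<dots> = ennreal (\<bar>\<beta>\<bar> + l) * emeasure lebesgue P + ennreal (l powr (1 - 1 / \<theta>)) * (\<integral>\<^sup>+y\<in>Q. ennreal (\<bar>b y - \<beta>\<bar> powr (1 / \<theta>)) \<partial>lebesgue)"
        by (simp add: nn_integral_add nn_integral_cmult nn_integral_cmult_indicator)
      also have "\<dots> \<le> ennreal (\<bar>\<beta>\<bar> + l) * emeasure lebesgue P + ennreal (l powr (1 - 1 / \<theta>)) * ennreal (C * V)"
        by (intro add_left_mono mult_left_mono m) simp
      also have "\<dots> = ennreal ((\<bar>\<beta>\<bar> + l) * U + C * (l powr (1 - 1 / \<theta>) * V))"
      proof -
        have "0 \<le> (\<bar>\<beta>\<bar> + l) * U" "0 \<le> C * (l powr (1 - 1 / \<theta>) * V)" using l U V C by auto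
        then show ?thesis
          using l U V C by (simp add: ennreal_plus ennreal_mult mult_ac)
      qed
      also have "(\<bar>\<beta>\<bar> + l) * U + C * (l powr (1 - 1 / \<theta>) * V) = U * (\<bar>\<beta>\<bar> + l * (1 + C))"
        unfolding l2 by (simp add: algebra_simps)
      finally have "ennreal (U powr (\<theta> - 1)) * (\<integral>\<^sup>+y\<in>P. ennreal \<bar>b y\<bar> \<partial>lebesgue) \<le> ennreal (U powr (\<theta> - 1)) * ennreal (U * (\<bar>\<beta>\<bar> + l * (1 + C)))"
        by (rule mult_left_mono) simp
      also have "\<dots> = ennreal ((U powr (\<theta> - 1) * U) * (\<bar>\<beta>\<bar> + l * (1 + C)))"
        by (subst ennreal_mult'[symmetric]) (auto simp: mult_ac)
      also have "U powr (\<theta> - 1) * U = U powr \<theta>"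
      proof -
        have "U powr \<theta> = U powr (\<theta> - 1) * U powr 1" by (subst powr_add[symmetric]) simp
        then show ?thesis using U by simp
      qed
      also have "ennreal (U powr \<theta> * (\<bar>\<beta>\<bar> + l * (1 + C))) \<le> ennreal (V powr \<theta> * (\<bar>\<beta>\<bar> + (1 + C)))"
      proof (rule ennreal_leI)
        have "U powr \<theta> * l = V powr \<theta>" using U V by (simp add: l_def powr_divide)
        moreover have "U powr \<theta> * \<bar>\<beta>\<bar> \<le> V powr \<theta> * \<bar>\<beta>\<bar>" using UV U \<theta> by (intro mult_right_mono powr_mono2) auto
        ultimately show "U powr \<theta> * (\<bar>\<beta>\<bar> + l * (1 + C)) \<le> V powr \<theta> * (\<bar>\<beta>\<bar> + (1 + C))"
          by (simp add: distrib_left mult.assoc[symmetric])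
      qed
      finally show ?thesis by (simp add: U_def)
    qed
    define M where "M = Mloc \<alpha> Q b x"
    have M_up: "M \<le> ennreal (V powr \<theta> * (\<bar>\<beta>\<bar> + (1 + C)))"
      unfolding M_def Mloc_def \<theta>_def[symmetric] by (rule SUP_least) (use up in auto)
    have M_lo: "ennreal (V powr \<theta> * \<bar>\<beta>\<bar>) \<le> M"
    proof -
      have "ennreal (V powr \<theta> * \<bar>\<beta>\<bar>) = ennreal (V powr (\<theta> - 1)) * (ennreal \<bar>\<beta> - 0\<bar> * emeasure lebesgue Q)"
      proof -
        have "V powr \<theta> = V powr (\<theta> - 1) * V powr 1" by (subst powr_add[symmetric]) simp
        then show ?thesis using V by (simp add: ennreal_mult[symmetric] mult_ac)
      qed
      also have "\<dots> \<le> ennreal (V powr (\<theta> - 1)) * (\<integral>\<^sup>+y\<in>Q. ennreal \<bar>b y - 0\<bar> \<partial>lebesgue)"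
        unfolding \<beta>_def by (intro mult_left_mono cavg_dev loc Q) simp
      also have "\<dots> \<le> M" unfolding M_def Mloc_def V_def \<theta>_def[symmetric] using Q by (intro SUP_upper2[of Q]) auto
      finally show ?thesis .
    qed
    obtain m' where m': "M = ennreal m'" "0 \<le> m'" using M_up by (cases M) (auto simp: top_unique)
    have VV: "V powr (- \<theta>) * V powr \<theta> = 1" using V by (simp flip: powr_add)
    have "V powr (- \<theta>) * (V powr \<theta> * \<bar>\<beta>\<bar>) \<le> V powr (- \<theta>) * m'"
      using M_lo unfolding m'(1) by (intro mult_left_mono) (auto simp: m'(2))
    moreover have "V powr (- \<theta>) * m' \<le> V powr (- \<theta>) * (V powr \<theta> * (\<bar>\<beta>\<bar> + (1 + C)))"
    proof (intro mult_left_mono)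
      have "0 \<le> V powr \<theta> * (\<bar>\<beta>\<bar> + (1 + C))" using C by simp
      then show "m' \<le> V powr \<theta> * (\<bar>\<beta>\<bar> + (1 + C))" using M_up unfolding m'(1) by (simp only: ennreal_le_iff)
    qed simp
    ultimately have "\<bar>\<beta>\<bar> \<le> V powr (- \<theta>) * m' \<and> V powr (- \<theta>) * m' \<le> \<bar>\<beta>\<bar> + (1 + C)"
      unfolding mult.assoc[symmetric] VV by simp
    moreover have "ennreal (V powr (- \<theta>)) * M = ennreal (V powr (- \<theta>) * m')" using m' by (simp add: ennreal_mult)
    ultimately show "\<exists>z. \<bar>cavg Q b\<bar> \<le> z \<and> z \<le> \<bar>cavg Q b\<bar> + (1 + C) \<and>
        ennreal (measure lebesgue Q powr (- \<alpha> / real CARD('n))) * Mloc \<alpha> Q b x = ennreal z"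
      unfolding \<beta>_def M_def V_def \<theta>_def minus_divide_left by blast
  qed
qed

section \<open>The oscillation condition with the local fractional maximal function\<close>

lemma ennreal_mult_right_le_cancel: "c \<noteq> 0 \<Longrightarrow> c \<noteq> top \<Longrightarrow> a * c \<le> b * c \<Longrightarrow> a \<le> (b :: ennreal)"
  by (simp add: mult.commute[of _ c] ennreal_mult_le_mult_iff less_top)

lemma osc_condI:
  fixes b s :: "real^'n \<Rightarrow> real"
  assumes "\<And>Q. cube Q \<Longrightarrow> vnorm s (\<lambda>x. if x \<in> Q then ereal (b x) -
      ereal (measure lebesgue Q powr (- \<alpha> / real CARD('n))) * enn2ereal (Mloc \<alpha> Q b x) else 0)
      \<le> ennreal C * vnorm s (chi Q)" "\<And>x. 1 \<le> s x"
  shows "osc_cond \<alpha> b s"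
proof -
  have "vnorm s (\<lambda>x. if x \<in> Q then ereal (b x) -
      ereal (measure lebesgue Q powr (- \<alpha> / real CARD('n))) * enn2ereal (Mloc \<alpha> Q b x) else 0) / vnorm s (chi Q) \<le> ennreal C"
    if Q: "cube Q" for Q
    using assms(1)[OF Q] vnorm_chi[where s = s, OF Q assms(2)]
    by (intro ennreal_divide_le_iff_mult[THEN iffD2]) auto
  then have "(SUP Q\<in>{Q. cube Q}. vnorm s (\<lambda>x. if x \<in> Q then ereal (b x) -
      ereal (measure lebesgue Q powr (- \<alpha> / real CARD('n))) * enn2ereal (Mloc \<alpha> Q b x) else 0) / vnorm s (chi Q)) \<le> ennreal C"
    by (intro SUP_least) simp
  then show ?thesis unfolding osc_cond_def by (rule le_less_trans) (simp add: infinity_ennreal_def)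
qed

lemma osc_condD:
  fixes b s :: "real^'n \<Rightarrow> real"
  assumes "osc_cond \<alpha> b s" "\<And>x. 1 \<le> s x"
  shows "\<exists>C>0. \<forall>Q. cube Q \<longrightarrow> vnorm s (\<lambda>x. if x \<in> Q then ereal (b x) -
      ereal (measure lebesgue Q powr (- \<alpha> / real CARD('n))) * enn2ereal (Mloc \<alpha> Q b x) else 0)
      \<le> ennreal C * vnorm s (chi Q)"
proof -
  define X where "X Q = vnorm s (\<lambda>x. if x \<in> Q then ereal (b x) -
      ereal (measure lebesgue Q powr (- \<alpha> / real CARD('n))) * enn2ereal (Mloc \<alpha> Q b x) else 0)" for Q
  define T where "T = (SUP Q\<in>{Q. cube Q}. X Q / vnorm s (chi Q))"
  have "T < top" using assms(1) unfolding osc_cond_def X_def T_def infinity_ennreal_def .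
  then obtain c where c: "T = ennreal c" "0 \<le> c" by (cases T) auto
  have "X Q \<le> ennreal (c + 1) * vnorm s (chi Q)" if Q: "cube Q" for Q
  proof -
    have "X Q / vnorm s (chi Q) \<le> ennreal c" unfolding c(1)[symmetric] T_def using Q by (intro SUP_upper) auto
    then have "X Q \<le> ennreal c * vnorm s (chi Q)"
      using vnorm_chi[where s = s, OF Q assms(2)] by (subst (asm) ennreal_divide_le_iff_mult) auto
    also have "\<dots> \<le> ennreal (c + 1) * vnorm s (chi Q)" by (intro mult_right_mono ennreal_leI) auto
    finally show ?thesis .
  qed
  then show ?thesis using c(2) unfolding X_def by (intro exI[of _ "c + 1"]) auto
qed

text \<open>By the two-sided bound on the local maximal function, it may be replaced by
  \<open>|cavg Q b|\<close> at the cost \<open>K\<close>, and \<open>|b x| - b x \<le> 2 * N\<close>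
  removes the absolute value. The remaining oscillation \<open>|b x - cavg Q b|\<close> is at most
  the mean of \<open>|b x - b y|\<close> over \<open>Q\<close>, to which the maximal commutator
  applies with the dilated indicator of \<open>Q\<close> and \<open>r = 1\<close>.\<close>

lemma osc_cond_if_bmo:
  fixes b s :: "real^'n \<Rightarrow> real"
  assumes b: "bmo_bd b B" and N: "AE x in lebesgue. negpart b x \<le> N" "0 \<le> N"
    and \<alpha>: "0 < \<alpha>" "\<alpha> < real CARD('n)" and sB: "s \<in> Bexp"
  shows "osc_cond \<alpha> b s"
proof -
  have sP: "s \<in> Pexp" using sB by (simp add: Bexp_def)
  note s = PexpD(1,2)[OF sP]
  have s0: "0 \<le> s x" for x using s(2)[of x] by simp
  obtain S where S: "AE x in lebesgue. s x \<le> S" using PexpD(3)[OF sP] by blast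
  obtain A where A: "0 < A" "ballbd s A" using Bexp_ballbd[OF sB] by blast
  have loc: "loc_integrable b" using b by (simp add: bmo_bd_def)
  note [measurable] = loc_integrable_measurable[OF loc]
  obtain C where C: "0 < C" and mc: "\<And>F. F \<in> borel_measurable lebesgue \<Longrightarrow> mdl s F \<le> 1 \<Longrightarrow>
      \<exists>Y\<in>borel_measurable lebesgue. mdl s Y \<le> 1 \<and> (AE x in lebesgue. \<forall>Q. cube Q \<longrightarrow> x \<in> Q \<longrightarrow>
        (\<integral>\<^sup>+y\<in>Q. ennreal ((\<bar>b x - b y\<bar> + 1) powr 1) * F y \<partial>lebesgue) \<le> ennreal C * Y x * emeasure lebesgue Q)"
    using maximal_commutator[OF s S A(2,1) b zero_le_one] by blast
  obtain K where K: "0 < K" and Kb: "\<And>Q x. cube Q \<Longrightarrow> x \<in> Q \<Longrightarrow> \<exists>z. \<bar>cavg Q b\<bar> \<le> z \<and> z \<le> \<bar>cavg Q b\<bar> + K \<and>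
    ennreal (measure lebesgue Q powr (- \<alpha> / real CARD('n))) * Mloc \<alpha> Q b x = ennreal z"
    using Mloc_bounds[OF b \<alpha>] by blast
  define D where "D = 1 + K + 2 * N"
  have D: "0 < D" using K N(2) by (simp add: D_def)
  show ?thesis
  proof (rule osc_condI[where C = "D * C"])
    fix Q :: "(real^'n) set" assume Q: "cube Q"
    define V where "V = measure lebesgue Q"
    have V: "0 < V" "emeasure lebesgue Q = ennreal V" using cube_emeasure[OF Q] by (auto simp: V_def)
    note [measurable] = cube_sets[OF Q]
    define f where "f x = (if x \<in> Q then ereal (b x) -
      ereal (measure lebesgue Q powr (- \<alpha> / real CARD('n))) * enn2ereal (Mloc \<alpha> Q b x) else 0)" for x
    have fle: "eabs (f x) \<le> ennreal D * ennreal (\<bar>b x - cavg Q b\<bar> + 1)" if x: "x \<in> Q" "negpart b x \<le> N" for x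
    proof -
      obtain z where z: "\<bar>cavg Q b\<bar> \<le> z" "z \<le> \<bar>cavg Q b\<bar> + K"
        "ennreal (measure lebesgue Q powr (- \<alpha> / real CARD('n))) * Mloc \<alpha> Q b x = ennreal z"
        using Kb[OF Q x(1)] by blast
      have "ereal (measure lebesgue Q powr (- \<alpha> / real CARD('n))) * enn2ereal (Mloc \<alpha> Q b x) =
          enn2ereal (ennreal (measure lebesgue Q powr (- \<alpha> / real CARD('n))) * Mloc \<alpha> Q b x)"
        by (simp add: times_ennreal.rep_eq enn2ereal_ennreal)
      also have "\<dots> = ereal z" unfolding z(3) using z(1) by (simp add: enn2ereal_ennreal)
      finally have "f x = ereal (b x - z)" using x(1) by (simp add: f_def)
      then have "eabs (f x) = ennreal \<bar>b x - z\<bar>" by simp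
      also have "\<bar>b x - z\<bar> \<le> D * (\<bar>b x - cavg Q b\<bar> + 1)"
      proof -
        have "\<bar>b x\<bar> - b x \<le> 2 * N" using x(2) by (auto simp: negpart_def split: if_splits)
        then have "\<bar>b x - z\<bar> \<le> \<bar>b x - cavg Q b\<bar> + (K + 2 * N)" using z(1,2) by linarith
        also have "\<dots> \<le> D * (\<bar>b x - cavg Q b\<bar> + 1)"
        proof -
          have "0 \<le> (K + 2 * N) * \<bar>b x - cavg Q b\<bar>" using K N(2) by simp
          then show ?thesis by (simp add: D_def algebra_simps)
        qed
        finally show ?thesis .
      qed
      finally show ?thesis using D by (simp add: ennreal_mult ennreal_leI)
    qed
    show "vnorm s f \<le> ennreal (D * C) * vnorm s (chi Q)"
    proof (rule vnorm_transfer)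
      show "0 < D * C" using D C by simp
      fix t assume t: "0 < t" "vmodular s (chi Q) t \<le> 1"
      define F where "F x = ennreal (1 / t) * indicator Q x" for x :: "real^'n"
      have Fm: "F \<in> borel_measurable lebesgue" unfolding F_def[abs_def] by measurable
      have "eabs (chi Q x) = indicator Q x" for x by (auto simp: indicator_def)
      then have "mdl s F \<le> 1" using t by (simp add: vmodular_eq F_def[abs_def])
      from mc[OF Fm this] obtain Y where Y: "Y \<in> borel_measurable lebesgue" "mdl s Y \<le> 1"
        and YAE: "AE x in lebesgue. \<forall>Q. cube Q \<longrightarrow> x \<in> Q \<longrightarrow>
          (\<integral>\<^sup>+y\<in>Q. ennreal ((\<bar>b x - b y\<bar> + 1) powr 1) * F y \<partial>lebesgue) \<le> ennreal C * Y x * emeasure lebesgue Q"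
        by blast
      have "AE x in lebesgue. ennreal (1 / (D * C * t)) * eabs (f x) \<le> Y x"
        using YAE N(1)
      proof eventually_elim
        case (elim x)
        show ?case
        proof (cases "x \<in> Q")
          case True
          have "ennreal (\<bar>b x - cavg Q b\<bar> + 1) * emeasure lebesgue Q \<le> (\<integral>\<^sup>+y\<in>Q. ennreal (\<bar>b x - b y\<bar> + 1) \<partial>lebesgue)"
          proof -
            have "ennreal (\<bar>b x - cavg Q b\<bar> + 1) * emeasure lebesgue Q = ennreal \<bar>cavg Q b - b x\<bar> * emeasure lebesgue Q + (\<integral>\<^sup>+y\<in>Q. 1 \<partial>lebesgue)"
              by (simp add: ennreal_plus distrib_right abs_minus_commute)
            also have "\<dots> \<le> (\<integral>\<^sup>+y\<in>Q. ennreal \<bar>b y - b x\<bar> \<partial>lebesgue) + (\<integral>\<^sup>+y\<in>Q. 1 \<partial>lebesgue)"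
              by (intro add_right_mono cavg_dev loc Q)
            also have "\<dots> = (\<integral>\<^sup>+y. ennreal \<bar>b y - b x\<bar> * indicator Q y + 1 * indicator Q y \<partial>lebesgue)"
              by (intro nn_integral_add[symmetric]) measurable
            also have "\<dots> = (\<integral>\<^sup>+y\<in>Q. ennreal (\<bar>b x - b y\<bar> + 1) \<partial>lebesgue)"
              by (intro nn_integral_cong) (auto simp: indicator_def abs_minus_commute ennreal_plus)
            finally show ?thesis .
          qed
          then have "ennreal (1 / t) * (ennreal (\<bar>b x - cavg Q b\<bar> + 1) * emeasure lebesgue Q) \<le> ennreal (1 / t) * (\<integral>\<^sup>+y\<in>Q. ennreal (\<bar>b x - b y\<bar> + 1) \<partial>lebesgue)"
            by (rule mult_left_mono) simp
          also have "\<dots> = (\<integral>\<^sup>+y. ennreal (1 / t) * (ennreal (\<bar>b x - b y\<bar> + 1) * indicator Q y) \<partial>lebesgue)"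
            by (intro nn_integral_cmult[symmetric]) measurable
          also have "\<dots> = (\<integral>\<^sup>+y\<in>Q. ennreal ((\<bar>b x - b y\<bar> + 1) powr 1) * F y \<partial>lebesgue)"
            by (intro nn_integral_cong) (auto simp: indicator_def F_def mult.commute)
          also have "\<dots> \<le> ennreal C * Y x * emeasure lebesgue Q" using elim(1) Q True by blast
          finally have "(ennreal (1 / t) * ennreal (\<bar>b x - cavg Q b\<bar> + 1)) * emeasure lebesgue Q \<le> (ennreal C * Y x) * emeasure lebesgue Q"
            by (simp only: mult.assoc)
          then have le: "ennreal (1 / t) * ennreal (\<bar>b x - cavg Q b\<bar> + 1) \<le> ennreal C * Y x"
            by (rule ennreal_mult_right_le_cancel[OF cube_emeasure(3,4)[OF Q]])
          have split: "ennreal (1 / (D * C * t)) = ennreal (1 / C) * (ennreal (1 / D) * ennreal (1 / t))"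
            using D C t by (simp add: ennreal_mult[symmetric] mult_ac)
          have one: "ennreal (1 / D) * ennreal D = 1" "ennreal (1 / C) * ennreal C = 1"
            using D C by (auto simp: ennreal_mult[symmetric])
          have "ennreal (1 / (D * C * t)) * eabs (f x) \<le> ennreal (1 / (D * C * t)) * (ennreal D * ennreal (\<bar>b x - cavg Q b\<bar> + 1))"
            by (intro mult_left_mono fle True elim) simp
          also have "\<dots> = ennreal (1 / C) * ((ennreal (1 / D) * ennreal D) * (ennreal (1 / t) * ennreal (\<bar>b x - cavg Q b\<bar> + 1)))"
            unfolding split by (simp only: mult_ac)
          also have "\<dots> \<le> ennreal (1 / C) * (ennreal C * Y x)"
            unfolding one(1) mult_1 by (intro mult_left_mono le) simp
          also have "\<dots> = Y x" by (simp only: mult.assoc[symmetric] one(2) mult_1)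
          finally show ?thesis .
        qed (simp add: f_def)
      qed
      then have "mdl s (\<lambda>x. ennreal (1 / (D * C * t)) * eabs (f x)) \<le> mdl s Y" by (rule mdl_mono_AE[OF _ s0])
      then show "vnorm s f \<le> ennreal (D * C * t)"
        using Y(2) D C t by (intro vnorm_le) (auto simp: vmodular_eq intro: order_trans)
    qed
  qed (rule s(2))
qed

lemma bmo_if_excess_vnorm:
  fixes b s :: "real^'n \<Rightarrow> real"
  assumes b: "loc_integrable b" and s: "\<And>x. 1 \<le> s x" and A: "ballbd s A" "0 < A" and C: "0 < C"
    and le: "\<And>Q. cube Q \<Longrightarrow> vnorm s (\<lambda>x. ereal (max 0 (cavg Q (\<lambda>y. \<bar>b y\<bar>) - b x) * indicator Q x)) \<le> ennreal C * vnorm s (chi Q)"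
  shows "b \<in> BMO" "negpart b \<in> Linfty"
proof -
  note [measurable] = loc_integrable_measurable[OF b]
  have "(\<integral>\<^sup>+y\<in>Q. ennreal (cavg Q (\<lambda>y. \<bar>b y\<bar>) - b y) \<partial>lebesgue) \<le> ennreal (A * C) * emeasure lebesgue Q"
    if Q: "cube Q" for Q
  proof -
    note [measurable] = cube_sets[OF Q]
    define g where "g x = max 0 (cavg Q (\<lambda>y. \<bar>b y\<bar>) - b x) * indicator Q x" for x
    have eq: "(\<integral>\<^sup>+y\<in>Q. ennreal (cavg Q (\<lambda>y. \<bar>b y\<bar>) - b y) \<partial>lebesgue) = (\<integral>\<^sup>+y\<in>Q. ennreal (g y) \<partial>lebesgue)"
      by (intro nn_integral_cong) (auto simp: g_def indicator_def max_def ennreal_neg)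
    have "(\<integral>\<^sup>+y\<in>Q. ennreal (g y) \<partial>lebesgue) \<le> (\<integral>\<^sup>+y\<in>Q. ennreal \<bar>b y - cavg Q (\<lambda>y. \<bar>b y\<bar>)\<bar> \<partial>lebesgue)"
      by (intro nn_integral_mono) (auto simp: g_def indicator_def intro!: ennreal_leI)
    also have "\<dots> < top" unfolding nn_abs_eq[OF b Q] by simp
    finally have fin: "(\<integral>\<^sup>+y\<in>Q. ennreal (g y) \<partial>lebesgue) \<noteq> top" by simp
    show ?thesis
      unfolding eq
    proof (rule cube_average_le[OF A s Q _ _ _ C _ fin])
      show "g \<in> borel_measurable lebesgue" unfolding g_def[abs_def] by measurable
      show "vnorm s (\<lambda>x. ereal (g x)) \<le> ennreal C * vnorm s (chi Q)" unfolding g_def by (rule le[OF Q])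
    qed (auto simp: g_def)
  qed
  with bmo_if_excess_bounded[OF b, of "A * C"] A C show "b \<in> BMO" "negpart b \<in> Linfty" by auto
qed

lemma ennreal_cavg_abs:
  assumes "loc_integrable b" "cube Q"
  shows "(\<integral>\<^sup>+y\<in>Q. ennreal \<bar>b y\<bar> \<partial>lebesgue) = ennreal (cavg Q (\<lambda>y. \<bar>b y\<bar>) * measure lebesgue Q)"
  using nn_abs_eq[OF assms, of 0] cube_emeasure(2)[OF assms(2)] by (simp add: cavg_def)

text \<open>Testing the local maximal function with \<open>Q\<close> itself shows that, after the
  normalisation, it is at least the mean of \<open>|b|\<close>. The function inside the norm
  therefore dominates the excess of that mean over \<open>b\<close>, also where the maximal function
  is infinite.\<close>

lemma bmo_if_osc_cond:
  fixes b s :: "real^'n \<Rightarrow> real"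
  assumes b: "loc_integrable b" and sB: "s \<in> Bexp" and osc: "osc_cond \<alpha> b s"
  shows "b \<in> BMO \<and> negpart b \<in> Linfty"
proof -
  have sP: "s \<in> Pexp" using sB by (simp add: Bexp_def)
  note s = PexpD(1,2)[OF sP]
  have s0: "0 \<le> s x" for x using s(2)[of x] by simp
  obtain A where A: "0 < A" "ballbd s A" using Bexp_ballbd[OF sB] by blast
  obtain C where C: "0 < C" and le: "\<And>Q. cube Q \<Longrightarrow> vnorm s (\<lambda>x. if x \<in> Q then ereal (b x) -
      ereal (measure lebesgue Q powr (- \<alpha> / real CARD('n))) * enn2ereal (Mloc \<alpha> Q b x) else 0)
      \<le> ennreal C * vnorm s (chi Q)"
    using osc_condD[OF osc s(2)] by blast
  have "vnorm s (\<lambda>x. ereal (max 0 (cavg Q (\<lambda>y. \<bar>b y\<bar>) - b x) * indicator Q x)) \<le> ennreal C * vnorm s (chi Q)"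
    if Q: "cube Q" for Q
  proof -
    define V where "V = measure lebesgue Q"
    define m where "m = cavg Q (\<lambda>y. \<bar>b y\<bar>)"
    have V: "0 < V" using cube_emeasure[OF Q] by (simp add: V_def)
    define f where "f x = (if x \<in> Q then ereal (b x) -
      ereal (measure lebesgue Q powr (- \<alpha> / real CARD('n))) * enn2ereal (Mloc \<alpha> Q b x) else 0)" for x
    have m0: "0 \<le> m" unfolding m_def cavg_def using V by (intro divide_nonneg_nonneg) (auto simp: set_lebesgue_integral_def V_def)
    have "ennreal 1 * eabs (ereal (max 0 (m - b x) * indicator Q x)) \<le> eabs (f x)" for x
    proof (cases "x \<in> Q")
      case True
      define M where "M = ennreal (V powr (- \<alpha> / real CARD('n))) * Mloc \<alpha> Q b x"
      have "ennreal m \<le> M"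
      proof -
        have "V powr (- \<alpha> / real CARD('n)) * (V powr (\<alpha> / real CARD('n) - 1) * (m * V)) = (V powr (- \<alpha> / real CARD('n)) * V powr (\<alpha> / real CARD('n) - 1) * V powr 1) * m"
          using V by simp
        also have "V powr (- \<alpha> / real CARD('n)) * V powr (\<alpha> / real CARD('n) - 1) * V powr 1 = 1"
          using V by (simp flip: powr_add)
        finally have "ennreal m = ennreal (V powr (- \<alpha> / real CARD('n))) * (ennreal (V powr (\<alpha> / real CARD('n) - 1)) * ennreal (m * V))"
          using m0 V by (simp add: ennreal_mult[symmetric])
        also have "\<dots> \<le> M"
          unfolding M_def
        proof (intro mult_left_mono)
          show "ennreal (V powr (\<alpha> / real CARD('n) - 1)) * ennreal (m * V) \<le> Mloc \<alpha> Q b x"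
            unfolding Mloc_def V_def m_def ennreal_cavg_abs[OF b Q, symmetric] using Q True by (intro SUP_upper2[of Q]) auto
        qed simp
        finally show ?thesis .
      qed
      have f: "f x = ereal (b x) - enn2ereal M"
        using True by (simp add: f_def M_def V_def times_ennreal.rep_eq enn2ereal_ennreal)
      show ?thesis
      proof (cases M)
        case (real v)
        then have "m \<le> v" using \<open>ennreal m \<le> M\<close> by simp
        then have "max 0 (m - b x) \<le> \<bar>b x - v\<bar>" by simp
        then have "ennreal (max 0 (m - b x)) \<le> ennreal \<bar>b x - v\<bar>" by (rule ennreal_leI)
        moreover have "eabs (ereal (max 0 (m - b x) * indicator Q x)) = ennreal (max 0 (m - b x))"
          using True by (simp only: eabs_ereal indicator_simps(1) mult_1_right abs_of_nonneg max.cobounded1)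
        moreover have "f x = ereal (b x - v)" unfolding f using real by (simp add: enn2ereal_ennreal)
        ultimately show ?thesis by (simp only: eabs_ereal ennreal_1 mult_1)
      next
        case top
        then show ?thesis unfolding f by simp
      qed
    qed simp
    then have "ennreal 1 * vnorm s (\<lambda>x. ereal (max 0 (m - b x) * indicator Q x)) \<le> vnorm s f"
      by (intro vnorm_scale_mono s0) auto
    also have "\<dots> \<le> ennreal C * vnorm s (chi Q)" unfolding f_def by (rule le[OF Q])
    finally show ?thesis by (simp add: m_def)
  qed
  from bmo_if_excess_vnorm[OF b s(2) A(2,1) C this] show ?thesis by blast
qed

section \<open>Testing the commutator on indicators of cubes\<close>

lemma Mfrac_indicator:
  fixes Q :: "(real^'n) set"
  assumes Q: "cube Q" "x \<in> Q" and \<alpha>: "0 < \<alpha>" "\<alpha> < real CARD('n)"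
  shows "Mfrac \<alpha> (indicator Q) x = ennreal (measure lebesgue Q powr (\<alpha> / real CARD('n)))"
proof -
  define \<theta> where "\<theta> = \<alpha> / real CARD('n)"
  have \<theta>: "0 < \<theta>" "\<theta> < 1" using \<alpha> by (auto simp: \<theta>_def)
  define V where "V = measure lebesgue Q"
  have V: "0 < V" "emeasure lebesgue Q = ennreal V" using cube_emeasure[OF Q(1)] by (auto simp: V_def)
  have pw: "U powr (\<theta> - 1) * U = U powr \<theta>" if "0 < U" for U
  proof -
    have "U powr \<theta> = U powr (\<theta> - 1) * U powr 1" by (subst powr_add[symmetric]) simp
    then show ?thesis using that by simp
  qed
  have I: "(\<integral>\<^sup>+y\<in>P. ennreal \<bar>indicator Q y\<bar> \<partial>lebesgue) = emeasure lebesgue (P \<inter> Q)" if "cube P" for P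
  proof -
    have "(\<integral>\<^sup>+y\<in>P. ennreal \<bar>indicator Q y\<bar> \<partial>lebesgue) = (\<integral>\<^sup>+y. indicator (P \<inter> Q) y \<partial>lebesgue)"
      by (intro nn_integral_cong) (auto simp: indicator_def)
    then show ?thesis using cube_sets[OF that] cube_sets[OF Q(1)] by simp
  qed
  show ?thesis
  proof (rule antisym)
    show "Mfrac \<alpha> (indicator Q) x \<le> ennreal (measure lebesgue Q powr (\<alpha> / real CARD('n)))"
      unfolding Mfrac_def \<theta>_def[symmetric]
    proof (rule SUP_least)
      fix P assume "P \<in> {Q. cube Q \<and> x \<in> Q}"
      then have P: "cube P" by simp
      define U where "U = measure lebesgue P"
      have U: "0 < U" "emeasure lebesgue P = ennreal U" using cube_emeasure[OF P] by (auto simp: U_def)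
      have "emeasure lebesgue (P \<inter> Q) \<le> ennreal (min U V)"
        using cube_sets[OF P] cube_sets[OF Q(1)] emeasure_mono[of "P \<inter> Q" P lebesgue] emeasure_mono[of "P \<inter> Q" Q lebesgue] U V
        by (simp add: min_def)
      then have "ennreal (U powr (\<theta> - 1)) * (\<integral>\<^sup>+y\<in>P. ennreal \<bar>indicator Q y\<bar> \<partial>lebesgue) \<le> ennreal (U powr (\<theta> - 1)) * ennreal (min U V)"
        unfolding I[OF P] by (rule mult_left_mono) simp
      also have "\<dots> = ennreal (U powr (\<theta> - 1) * min U V)" using U V by (simp add: ennreal_mult)
      \<comment> \<open>Smaller cubes lose because the power \<open>\<theta>\<close> is positive,
        larger ones because \<open>\<theta> - 1\<close> is negative, so \<open>Q\<close> itself is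
        optimal.\<close>
      also have "\<dots> \<le> ennreal (V powr \<theta>)"
      proof (rule ennreal_leI)
        show "U powr (\<theta> - 1) * min U V \<le> V powr \<theta>"
        proof (cases "U \<le> V")
          case True
          then show ?thesis using pw[OF U(1)] U \<theta> by (simp add: powr_mono2)
        next
          case False
          then have "U powr (\<theta> - 1) * V \<le> V powr (\<theta> - 1) * V" using V \<theta> by (intro mult_right_mono powr_mono2') auto
          then show ?thesis using False pw[OF V(1)] by simp
        qed
      qed
      finally show "ennreal (measure lebesgue P powr (\<theta> - 1)) * (\<integral>\<^sup>+y\<in>P. ennreal \<bar>indicator Q y\<bar> \<partial>lebesgue) \<le> ennreal (measure lebesgue Q powr \<theta>)"
        by (simp add: U_def V_def)
    qed
    have "ennreal (V powr \<theta>) = ennreal (V powr (\<theta> - 1)) * (\<integral>\<^sup>+y\<in>Q. ennreal \<bar>indicator Q y\<bar> \<partial>lebesgue)"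
      unfolding I[OF Q(1)] using V pw[OF V(1)] by (simp add: ennreal_mult[symmetric])
    also have "\<dots> \<le> Mfrac \<alpha> (indicator Q) x"
      unfolding Mfrac_def V_def \<theta>_def using Q by (intro SUP_upper2[of Q]) auto
    finally show "ennreal (measure lebesgue Q powr (\<alpha> / real CARD('n))) \<le> Mfrac \<alpha> (indicator Q) x"
      by (simp add: V_def \<theta>_def)
  qed
qed

text \<open>On \<open>Q\<close> the fractional maximal function of the indicator equals
  \<open>|Q| powr \<theta>\<close>, and that of \<open>b\<close> times the indicator is at least
  \<open>|Q| powr \<theta>\<close> times the mean of \<open>|b|\<close>. Where \<open>b\<close> lies
  below this mean, the commutator is thus at least \<open>|Q| powr \<theta>\<close> times the
  excess. Comparing the norms of the indicator for \<open>p\<close> and \<open>q\<close> costs the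
  same power of \<open>|Q|\<close>, which cancels.\<close>

lemma bmo_if_commutator_bounded:
  fixes b p q :: "real^'n \<Rightarrow> real"
  assumes b: "loc_integrable b" and \<alpha>: "0 < \<alpha>" "\<alpha> < real CARD('n)" and pq: "Bgam \<alpha> p q"
    and bo: "bounded_op p q (comm \<alpha> b)"
  shows "b \<in> BMO \<and> negpart b \<in> Linfty"
proof -
  define \<theta> where "\<theta> = \<alpha> / real CARD('n)"
  define s where "s x = q x * (real CARD('n) - \<alpha>) / real CARD('n)" for x
  note facts = Bgam_facts[OF pq \<alpha>, folded \<theta>_def s_def]
  note \<theta> = facts(1,2)
  have sP: "s \<in> Pexp" using facts(3) by (simp add: Bexp_def)
  note s = PexpD(1,2)[OF sP] and p = PexpD(1,2)[OF facts(4)]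
  note [measurable] = s(1) p(1) loc_integrable_measurable[OF b]
  obtain A where A: "0 < A" "ballbd s A" using Bexp_ballbd[OF facts(3)] by blast
  have q0: "0 \<le> q x" and p0: "0 \<le> p x" for x using facts(6)[of x] p(2)[of x] by auto
  have qs: "1 / (1 - \<theta>) * s x = q x" for x using \<theta> by (simp add: facts(5))
  have qm [measurable]: "q \<in> borel_measurable lebesgue"
    using borel_measurable_times[OF borel_measurable_const[of "1 / (1 - \<theta>)"] s(1)] by (simp only: qs)
  \<comment> \<open>Boundedness of the maximal operator is known for
    \<open>s = q * (1 - \<theta>)\<close>, while the excess is measured with
    \<open>q\<close>.\<close>
  have "ballbd (\<lambda>x. 1 / (1 - \<theta>) * s x) (A powr (1 / (1 / (1 - \<theta>))))"
    using \<theta> by (intro ballbd_power A s) auto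
  then have qb: "ballbd q (A powr (1 - \<theta>))" by (simp only: qs) simp
  obtain C where C: "0 < C" and bd: "\<And>f. in_Lvar p f \<Longrightarrow> vnorm q (comm \<alpha> b f) \<le> ennreal C * vnorm p (\<lambda>x. ereal (f x))"
    using bounded_opE[OF bo] by metis
  have "vnorm q (\<lambda>x. ereal (max 0 (cavg Q (\<lambda>y. \<bar>b y\<bar>) - b x) * indicator Q x)) \<le> ennreal (2 * C) * vnorm q (chi Q)"
    if Q: "cube Q" for Q
  proof -
    define V where "V = measure lebesgue Q"
    define m where "m = cavg Q (\<lambda>y. \<bar>b y\<bar>)"
    define k where "k = V powr \<theta>"
    have V: "0 < V" "emeasure lebesgue Q = ennreal V" using cube_emeasure[OF Q] by (auto simp: V_def)
    have k: "0 < k" using V by (simp add: k_def)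
    note [measurable] = cube_sets[OF Q]
    have m0: "0 \<le> m" unfolding m_def cavg_def using V by (intro divide_nonneg_nonneg) (auto simp: set_lebesgue_integral_def V_def)
    have eabs_chi: "eabs (chi Q x) = indicator Q x" for x :: "real^'n" by (auto simp: indicator_def)
    have "vnorm p (chi Q) < top" by (rule vnorm_chi(2)[OF Q p(2)])
    then obtain c where "vnorm p (chi Q) = ennreal c" "0 \<le> c" by (cases "vnorm p (chi Q)") auto
    then have "vnorm p (chi Q) < ennreal (c + 1)" by (simp add: ennreal_less_iff)
    then have "0 < c + 1" "vmodular p (chi Q) (c + 1) \<le> 1" by (rule vnorm_less[OF _ p0])+
    moreover from this(2) have "vmodular p (chi Q) (c + 1) < \<infinity>"
      unfolding infinity_ennreal_def by (rule le_less_trans) simp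
    moreover have "indicator Q \<in> borel_measurable lebesgue" by measurable
    ultimately have "in_Lvar p (indicator Q)" unfolding in_Lvar_def by blast
    then have cC: "vnorm q (comm \<alpha> b (indicator Q)) \<le> ennreal C * vnorm p (chi Q)" by (rule bd)
    have "ennreal k * vnorm q (\<lambda>x. ereal (max 0 (m - b x) * indicator Q x)) \<le> vnorm q (comm \<alpha> b (indicator Q))"
    proof (rule vnorm_scale_mono[OF k _ q0])
      fix x
      show "ennreal k * eabs (ereal (max 0 (m - b x) * indicator Q x)) \<le> eabs (comm \<alpha> b (indicator Q) x)"
      proof (cases "x \<in> Q \<and> b x \<le> m")
        case True
        define U where "U = Mfrac \<alpha> (\<lambda>y. b y * indicator Q y) x"
        have lo: "ennreal (k * m) \<le> U"
        proof -
          have "k = V powr (\<theta> - 1) * V"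
          proof -
            have "V powr \<theta> = V powr (\<theta> - 1) * V powr 1" by (subst powr_add[symmetric]) simp
            then show ?thesis using V by (simp add: k_def)
          qed
          then have "ennreal (k * m) = ennreal (V powr (\<theta> - 1)) * ennreal (m * V)"
            using m0 V by (simp add: ennreal_mult[symmetric] mult_ac)
          also have "ennreal (m * V) = (\<integral>\<^sup>+y\<in>Q. ennreal \<bar>b y * indicator Q y\<bar> \<partial>lebesgue)"
            unfolding m_def V_def ennreal_cavg_abs[OF b Q, symmetric] by (intro nn_integral_cong) (auto simp: indicator_def)
          also have "ennreal (V powr (\<theta> - 1)) * \<dots> \<le> U"
            unfolding U_def Mfrac_def V_def \<theta>_def using Q True by (intro SUP_upper2[of Q]) auto
          finally show ?thesis .
        qed
        have cm: "comm \<alpha> b (indicator Q) x = ereal (b x * k) - enn2ereal U"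
          using True Q unfolding comm_def U_def by (simp add: Mfrac_indicator \<alpha> enn2ereal_ennreal k_def V_def \<theta>_def)
        show ?thesis
        proof (cases U)
          case (real u)
          then have "k * m \<le> u" using lo by simp
          then have "k * (m - b x) \<le> \<bar>b x * k - u\<bar>" by (simp add: algebra_simps)
          then show ?thesis using True real k unfolding cm
            by (auto simp: enn2ereal_ennreal max_def ennreal_mult[symmetric] intro!: ennreal_leI)
        next
          case top
          then show ?thesis unfolding cm by simp
        qed
      next
        case False
        then have zero: "max 0 (m - b x) * indicator Q x = 0" by auto
        show ?thesis unfolding zero by simp
      qed
    qed
    also have "\<dots> \<le> ennreal C * vnorm p (chi Q)" by (rule cC)
    also have "\<dots> \<le> ennreal C * (ennreal (2 * k) * vnorm q (chi Q))"
    proof (intro mult_left_mono vnorm_transfer)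
      fix t assume t: "0 < t" "vmodular q (chi Q) t \<le> 1"
      have "vmodular p (chi Q) (2 * k * t) \<le> 1"
      proof -
        \<comment> \<open>Young's inequality with weights \<open>p x / q x\<close> and
          \<open>p x * \<theta>\<close>, which add up to 1. The 2 in \<open>2 * k * t\<close> yields
          the factor \<open>1/2\<close> that makes up for two terms on the right, each of mass at
          most 1.\<close>
        have pt: "epow (ennreal (1 / (2 * k * t)) * eabs (chi Q x)) (p x) \<le>
            ennreal (1/2) * (epow (ennreal (1 / t) * eabs (chi Q x)) (q x) + ennreal (1 / V) * indicator Q x)" for x
        proof (cases "x \<in> Q")
          case True
          have d: "p x / q x + p x * \<theta> = 1"
            using facts(7)[of x] \<theta> facts(6)[of x] by (simp add: facts(5))
          have "(1 / (2 * k * t)) powr p x = (1/2) powr p x * ((1 / t) powr p x * (1 / k) powr p x)"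
            by (simp add: powr_mult[symmetric] mult_ac)
          also have "\<dots> \<le> 1/2 * ((1 / t) powr p x * (1 / k) powr p x)"
            using powr_mono'[OF p(2)[of x], of "1/2"] by (intro mult_right_mono) auto
          also have "(1 / t) powr p x * (1 / k) powr p x = ((1 / t) powr q x) powr (p x / q x) * (1 / V) powr (p x * \<theta>)"
          proof -
            have "(1 / t) powr p x = ((1 / t) powr q x) powr (p x / q x)" using facts(6)[of x] by (simp add: powr_powr)
            moreover have "(1 / k) powr p x = (1 / V) powr (p x * \<theta>)" using V by (simp add: k_def powr_divide powr_powr mult.commute)
            ultimately show ?thesis by simp
          qed
          also have "((1 / t) powr q x) powr (p x / q x) * (1 / V) powr (p x * \<theta>) \<le> (p x / q x) * (1 / t) powr q x + (p x * \<theta>) * (1 / V)"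
            using d t V \<theta> p0[of x] q0[of x] by (intro Youngs_inequality_0) auto
          also have "(p x / q x) * (1 / t) powr q x + (p x * \<theta>) * (1 / V) \<le> 1 * (1 / t) powr q x + 1 * (1 / V)"
          proof (intro add_mono mult_right_mono)
            have "0 \<le> p x / q x" "0 \<le> p x * \<theta>" using p0[of x] q0[of x] \<theta> by auto
            then show "p x / q x \<le> 1" "p x * \<theta> \<le> 1" using d by linarith+
          qed (use V in auto)
          finally have "(1 / (2 * k * t)) powr p x \<le> 1/2 * ((1 / t) powr q x + 1 / V)"
            by (simp add: mult_left_mono)
          then have "ennreal ((1 / (2 * k * t)) powr p x) \<le> ennreal (1/2) * ennreal ((1 / t) powr q x + 1 / V)"
            by (subst ennreal_mult'[symmetric]) (auto intro: ennreal_leI)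
          then show ?thesis using True t k V by (simp add: ennreal_plus)
        qed simp
        have "vmodular p (chi Q) (2 * k * t) \<le> (\<integral>\<^sup>+x. ennreal (1/2) * (epow (ennreal (1 / t) * eabs (chi Q x)) (q x) + ennreal (1 / V) * indicator Q x) \<partial>lebesgue)"
          using t k unfolding vmodular_eq[OF mult_pos_pos[OF mult_pos_pos[OF zero_less_numeral k] t(1)]] mdl_def by (intro nn_integral_mono pt)
        also have "\<dots> = ennreal (1/2) * (vmodular q (chi Q) t + ennreal (1 / V) * emeasure lebesgue Q)"
          unfolding vmodular_eq[OF t(1)] mdl_def eabs_chi
          by (subst nn_integral_cmult, measurable, subst nn_integral_add, measurable) (simp add: nn_integral_cmult_indicator)
        also have "\<dots> \<le> ennreal (1/2) * (1 + 1)"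
          using t(2) V by (intro mult_left_mono add_mono) (auto simp: ennreal_mult[symmetric])
        also have "\<dots> = 1"
        proof -
          have "ennreal (1/2) * ennreal 2 = 1" by (subst ennreal_mult[symmetric]) auto
          then show ?thesis by simp
        qed
        finally show ?thesis .
      qed
      then show "vnorm p (chi Q) \<le> ennreal (2 * k * t)" using t k by (intro vnorm_le) auto
    qed (use k in auto)
    also have "\<dots> = ennreal k * (ennreal (2 * C) * vnorm q (chi Q))"
      using k C by (simp add: ennreal_mult mult_ac)
    finally show ?thesis
      using k unfolding m_def by (subst (asm) ennreal_mult_le_mult_iff) (auto simp: ennreal_eq_0_iff)
  qed
  then show ?thesis
    using bmo_if_excess_vnorm[OF b facts(6) qb, of "2 * C"] A(1) C by auto
qed

lemma exists_Bgam:
  assumes "0 < \<alpha>" "\<alpha> < real CARD('n)"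
  shows "\<exists>p q :: real^'n \<Rightarrow> real. Bgam \<alpha> p q"
proof -
  define \<theta> where "\<theta> = \<alpha> / real CARD('n)"
  have \<theta>: "0 < \<theta>" "\<theta> < 1" using assms by (auto simp: \<theta>_def)
  \<comment> \<open>Chosen so that \<open>q * (1 - \<theta>) = 2\<close>, the constant exponent
    already known to be admissible.\<close>
  define p where "p = 2 / (1 + \<theta>)"
  define q where "q = 2 / (1 - \<theta>)"
  have p: "1 < p" "p < 1 / \<theta>" using \<theta> by (auto simp: p_def field_simps)
  have "(\<lambda>x :: real^'n. p) \<in> Pexp" unfolding Pexp_def using p by (auto intro!: exI[of _ p])
  moreover have "\<exists>C < real CARD('n) / \<alpha>. AE x :: real^'n in lebesgue. p \<le> C"
    using p(2) by (intro exI[of _ p]) (auto simp: \<theta>_def)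
  moreover have "1 / q = 1 / p - \<alpha> / real CARD('n)"
    unfolding \<theta>_def[symmetric] using \<theta> by (simp add: p_def q_def field_simps)
  moreover have "q * (real CARD('n) - \<alpha>) / real CARD('n) = 2"
  proof -
    have "q * (real CARD('n) - \<alpha>) / real CARD('n) = q * (1 - \<theta>)" by (simp add: \<theta>_def field_simps)
    also have "\<dots> = 2" using \<theta> by (simp add: q_def field_simps)
    finally show ?thesis .
  qed
  ultimately have "Bgam \<alpha> (\<lambda>x :: real^'n. p) (\<lambda>x. q)" unfolding Bgam_def using const2_Bexp by simp
  then show ?thesis by blast
qed

theorem theorem1p2:
  fixes b :: "real^'n \<Rightarrow> real" and \<alpha> :: real
  assumes "0 < \<alpha>" and "\<alpha> < real CARD('n)" and "loc_integrable b"
  defines "S1 \<equiv> b \<in> BMO \<and> negpart b \<in> Linfty"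
    and "S2 \<equiv> (\<exists>p q. Bgam \<alpha> p q \<and> bounded_op p q (comm \<alpha> b))"
    and "S3 \<equiv> (\<forall>p q. Bgam \<alpha> p q \<longrightarrow> bounded_op p q (comm \<alpha> b))"
    and "S4 \<equiv> (\<exists>s. s \<in> Bexp \<and> osc_cond \<alpha> b s)"
    and "S5 \<equiv> (\<forall>s. s \<in> Bexp \<longrightarrow> osc_cond \<alpha> b s)"
  shows "(S1 \<longleftrightarrow> S2) \<and> (S1 \<longleftrightarrow> S3) \<and> (S1 \<longleftrightarrow> S4) \<and> (S1 \<longleftrightarrow> S5)"
proof -
  note \<alpha> = assms(1,2) and b = assms(3)
  have S1D: "\<exists>B N. bmo_bd b B \<and> (AE x in lebesgue. negpart b x \<le> N) \<and> 0 \<le> N" if S1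
  proof -
    obtain B where B: "bmo_bd b B" using \<open>S1\<close> BMO_iff by (auto simp: S1_def)
    obtain N where N: "AE x in lebesgue. \<bar>negpart b x\<bar> \<le> N" using \<open>S1\<close> by (auto simp: S1_def Linfty_def)
    have "AE x in lebesgue. negpart b x \<le> max N 0" using N by (rule AE_mp) auto
    then show ?thesis using B by (intro exI[of _ B] exI[of _ "max N 0"]) auto
  qed
  have 13: "S1 \<Longrightarrow> S3" using S1D commutator_bounded_if_bmo[OF _ _ _ \<alpha>] unfolding S3_def by blast
  have 15: "S1 \<Longrightarrow> S5" using S1D osc_cond_if_bmo[OF _ _ _ \<alpha>] unfolding S5_def by blast
  have 32: "S3 \<Longrightarrow> S2" using exists_Bgam[OF \<alpha>] unfolding S2_def S3_def by blast
  have 54: "S5 \<Longrightarrow> S4" using const2_Bexp unfolding S4_def S5_def by blast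
  have 21: "S2 \<Longrightarrow> S1" using bmo_if_commutator_bounded[OF b \<alpha>] unfolding S1_def S2_def by blast
  have 41: "S4 \<Longrightarrow> S1" using bmo_if_osc_cond[OF b] unfolding S1_def S4_def by blast
  show ?thesis using 13 15 32 54 21 41 by blast
qed

end
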